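(* Let $G=(V,E)$ be a finite connected decomposable graph. 1) Fix $r>0$, let $X$ be an $M_G$-valued random vector and assume $\mathbb P_{N\mid X}=\operatorname{nm}_G(r,X)$. The random vector $p=(\mathbb P(N=n\mid X))_{n\in\mathbb N^V}$ is strong (directed) hyper Markov (that is, strong hyper Markov over $G$, respectively strong directed hyper Markov over every moral DAG with skeleton $G$) if and only if for every moral DAG $\mathcal G$ with skeleton $G$ the random vector $u^{\mathcal G}(X)=(u_i^{\mathcal G}(X))_{i\in V}$ has independent components. 2) Fix $r\in\{1,2,\ldots\}$, let $Y$ be a $(0,\infty)^V$-valued random vector and assume $\mathbb P_{N\mid Y}=\operatorname{mult}_G(r,Y)$. The random vector $p=(\mathbb P(N=n\mid Y))_{n\in\mathbb N^V}$ is strong (directed) hyper Markov (that is, strong hyper Markov over $G$, respectively strong directed hyper Markov over every moral DAG with skeleton $G$) if and only if for every moral DAG $\mathcal G$ with skeleton $G$ the random vector $w^{\mathcal G}(Y)=(w_i^{\mathcal G}(Y))_{i\in V}$ has independent components.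
   Context: $\mathbb N=\{0,1,2,\ldots\}$. $G=(V,E)$ is a finite undirected simple graph; $G^*$ its complement graph; $G_A$ the subgraph induced by $A\subset V$. A clique is a set of pairwise adjacent vertices ($\emptyset$ and singletons are cliques); $\mathcal C_G$ is the set of cliques and $\mathcal C_G^+$ the set of maximal cliques. $G$ is decomposable iff it is chordal (no induced cycle of length greater than 3). A moral DAG $\mathcal G$ with skeleton $G$ is an orientation of all edges of $G$ without directed cycles such that any two distinct parents of a common vertex are adjacent. $\mathfrak{pa}(i)=\{j:j\to i\}$; $\mathfrak{de}(i)$ is the set of vertices reachable from $i$ by a directed path of length at least 1; $\overline{\mathfrak{de}}(i)=\mathfrak{de}(i)\cup\{i\}$; $\mathfrak{nde}(i)=V\setminus\overline{\mathfrak{de}}(i)$. $\Delta_G(x)=\sum_{C\in\mathcal C_{G^*}}(-1)^{|C|}\prod_{i\in C}x_i$, $\delta_G(y)=\sum_{C\in\mathcal C_{G^*}}\prod_{i\in C}y_i$; for $A\subset V$, $\Delta_A(x):=\Delta_{G_A}(x_A)$, $\delta_A(y):=\delta_{G_A}(y_A)$, $\Delta_\emptyset=\delta_\emptyset=1$; $M_G=\{x\in(0,\infty)^V:\Delta_A(x)>0\ \forall A\subset V\}$. $x_A=(x_i)_{i\in A}$, $x^n=\prod_{i\in V}x_i^{n_i}$, $|n_A|=\sum_{i\in A}n_i$, $|n|=|n_V|$. For $x\in M_G$, $y\in(0,\infty)^V$, $i\in V$: $$u_i^{\mathcal G}(x)=1-\frac{\Delta_{\overline{\mathfrak{de}}(i)}(x)}{\Delta_{\mathfrak{de}(i)}(x)},\qquad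 w_i^{\mathcal G}(y)=\frac{\delta_{\overline{\mathfrak{de}}(i)}(y)}{\delta_{\mathfrak{de}(i)}(y)}-1.$$ For an integer $r\ge1$, $\binom{r}{n}_G$ is defined by $\delta_G(y)^r=\sum_{n\in\mathbb N^V}\binom{r}{n}_G y^n$; for real $r>0$, $\genfrac{[}{]}{0pt}{}{|n|+r-1}{n}_G$ is defined by the formal power series $\Delta_G(x)^{-r}=\sum_{n\in\mathbb N^V}\genfrac{[}{]}{0pt}{}{|n|+r-1}{n}_G x^n$. $\operatorname{nm}_G(r,x)$ ($x\in M_G$): $\mathbb P(N=n)=\genfrac{[}{]}{0pt}{}{|n|+r-1}{n}_G\,x^n\Delta_G(x)^r$, $n\in\mathbb N^V$. $\operatorname{mult}_G(r,y)$ ($y\in(0,\infty)^V$): $\mathbb P(N=n)=\binom{r}{n}_G\,y^n\delta_G(y)^{-r}$, $n\in\mathbb N_{G,r}:=\{n\in\mathbb N^V:\max_{C\in\mathcal C_G^+}|n_C|\le r\}$. Families of random variables: with $X$ denoting the random parameter ($Y$ in part 2), for $A,B\subset V$, $$p_A=\big(\mathbb P(N_A=n_A\mid X)\big)_{n_A\in\mathbb N^A},\qquad p_{B\mid A}=\left(\frac{\mathbb P(N_{A\cup B}=n_{A\cup B}\mid X)}{\mathbb P(N_A=n_A\mid X)}\right)_{n_{A\cup B}\in\mathbb N^{A\cup B}}$$ (in the multinomial case the index is restricted to $n_{A\cup B}$ for which the denominator is nonzero, a condition not depending on the parameter value). A decomposition $(A,B,C)$ of $G$ is a triple of non-empty,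 pairwise disjoint subsets of $V$ with $A\cup B\cup C=V$ such that $C$ is a clique and $C$ separates $A$ and $B$ in $G$, i.e. every path from a vertex of $A$ to a vertex of $B$ intersects $C$. $p$ is strong hyper Markov over $G$ if for all decompositions $(A,B,C)$ of $G$, $p_{B\cup C\mid A\cup C}$ and $p_{A\cup C}$ are independent. $p$ is strong directed hyper Markov over $\mathcal G$ if for all $i\in V$, $p_{\{i\}\mid\mathfrak{pa}(i)}$ and $p_{\mathfrak{nde}(i)}$ are independent.
   Formalization: In both parts, "strong hyper Markov over G alone implies independent components" is dropped, being false (two adjacent vertices admit no decomposition); proved: directed iff independent components, and strong hyper Markov over G together with directed iff independent components. *)

theory Defs
  imports "HOL-Probability.Probability" "HOL-Library.Poly_Mapping"
begin

section \<open>Graphs\<close>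

text \<open>A graph is given by its vertex set \<open>V\<close> and its adjacency relation \<open>E\<close>, so each undirected
  edge \<open>{i, j}\<close> is represented by both \<open>(i, j)\<close> and \<open>(j, i)\<close>.\<close>

definition simple_graph :: "'v set \<Rightarrow> ('v \<times> 'v) set \<Rightarrow> bool" where
  "simple_graph V E \<longleftrightarrow> finite V \<and> E \<subseteq> V \<times> V \<and> sym E \<and> irrefl E"

definition compl_edges :: "'v set \<Rightarrow> ('v \<times> 'v) set \<Rightarrow> ('v \<times> 'v) set" where
  "compl_edges V E = {(i, j). i \<in> V \<and> j \<in> V \<and> i \<noteq> j \<and> (i, j) \<notin> E}"

definition induced_edges :: "('v \<times> 'v) set \<Rightarrow> 'v set \<Rightarrow> ('v \<times> 'v) set" where
  "induced_edges E A = E \<inter> A \<times> A"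

definition cliques :: "'v set \<Rightarrow> ('v \<times> 'v) set \<Rightarrow> 'v set set" where
  "cliques V E = {C. C \<subseteq> V \<and> (\<forall>i\<in>C. \<forall>j\<in>C. i \<noteq> j \<longrightarrow> (i, j) \<in> E)}"

definition max_cliques :: "'v set \<Rightarrow> ('v \<times> 'v) set \<Rightarrow> 'v set set" where
  "max_cliques V E = {C \<in> cliques V E. \<forall>C'\<in>cliques V E. C \<subseteq> C' \<longrightarrow> C' = C}"

definition graph_path :: "'v set \<Rightarrow> ('v \<times> 'v) set \<Rightarrow> 'v list \<Rightarrow> bool" where
  "graph_path V E p \<longleftrightarrow>
     p \<noteq> [] \<and> distinct p \<and> set p \<subseteq> V \<and> successively (\<lambda>i j. (i, j) \<in> E) p"

definition connected_graph :: "'v set \<Rightarrow> ('v \<times> 'v) set \<Rightarrow> bool" where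
  "connected_graph V E \<longleftrightarrow>
     (\<forall>i\<in>V. \<forall>j\<in>V. \<exists>p. graph_path V E p \<and> hd p = i \<and> last p = j)"

definition induced_cycle :: "'v set \<Rightarrow> ('v \<times> 'v) set \<Rightarrow> 'v list \<Rightarrow> bool" where
  "induced_cycle V E c \<longleftrightarrow>
     3 \<le> length c \<and> distinct c \<and> set c \<subseteq> V \<and>
     (\<forall>a<length c. \<forall>b<length c.
        (c ! a, c ! b) \<in> E \<longleftrightarrow> b = Suc a mod length c \<or> a = Suc b mod length c)"

definition decomposable :: "'v set \<Rightarrow> ('v \<times> 'v) set \<Rightarrow> bool" where
  "decomposable V E \<longleftrightarrow> (\<forall>c. induced_cycle V E c \<longrightarrow> length c \<le> 3)"

definition separates :: "'v set \<Rightarrow> ('v \<times> 'v) set \<Rightarrow> 'v set \<Rightarrow> 'v set \<Rightarrow> 'v set \<Rightarrow> bool" where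
  "separates V E C A B \<longleftrightarrow>
     (\<forall>p. graph_path V E p \<and> hd p \<in> A \<and> last p \<in> B \<longrightarrow> set p \<inter> C \<noteq> {})"

definition decomposition ::
    "'v set \<Rightarrow> ('v \<times> 'v) set \<Rightarrow> 'v set \<Rightarrow> 'v set \<Rightarrow> 'v set \<Rightarrow> bool" where
  "decomposition V E A B C \<longleftrightarrow>
     A \<noteq> {} \<and> B \<noteq> {} \<and> C \<noteq> {} \<and> A \<inter> B = {} \<and> A \<inter> C = {} \<and> B \<inter> C = {} \<and>
     A \<union> B \<union> C = V \<and> C \<in> cliques V E \<and> separates V E C A B"


section \<open>Moral directed acyclic graphs\<close>

text \<open>\<open>(j, i) \<in> D\<close> stands for the arrow \<open>j \<rightarrow> i\<close>.\<close>

definition moral_dag :: "('v \<times> 'v) set \<Rightarrow> ('v \<times> 'v) set \<Rightarrow> bool" where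
  "moral_dag E D \<longleftrightarrow>
     D \<union> D\<inverse> = E \<and> D \<inter> D\<inverse> = {} \<and> acyclic D \<and>
     (\<forall>i j k. (i, k) \<in> D \<and> (j, k) \<in> D \<and> i \<noteq> j \<longrightarrow> (i, j) \<in> E)"

definition pa :: "('v \<times> 'v) set \<Rightarrow> 'v \<Rightarrow> 'v set" where
  "pa D i = {j. (j, i) \<in> D}"

definition de :: "('v \<times> 'v) set \<Rightarrow> 'v \<Rightarrow> 'v set" where
  "de D i = {j. (i, j) \<in> D\<^sup>+}"

definition de_bar :: "('v \<times> 'v) set \<Rightarrow> 'v \<Rightarrow> 'v set" where
  "de_bar D i = insert i (de D i)"

definition nde :: "'v set \<Rightarrow> ('v \<times> 'v) set \<Rightarrow> 'v \<Rightarrow> 'v set" where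
  "nde V D i = V - de_bar D i"


section \<open>Clique polynomials of the complement graph\<close>

definition Delta :: "'v set \<Rightarrow> ('v \<times> 'v) set \<Rightarrow> ('v \<Rightarrow> real) \<Rightarrow> real" where
  "Delta V E x = (\<Sum>C\<in>cliques V (compl_edges V E). (-1) ^ card C * (\<Prod>i\<in>C. x i))"

definition delta :: "'v set \<Rightarrow> ('v \<times> 'v) set \<Rightarrow> ('v \<Rightarrow> real) \<Rightarrow> real" where
  "delta V E y = (\<Sum>C\<in>cliques V (compl_edges V E). \<Prod>i\<in>C. y i)"

definition Delta_on :: "('v \<times> 'v) set \<Rightarrow> 'v set \<Rightarrow> ('v \<Rightarrow> real) \<Rightarrow> real" where
  "Delta_on E A x = Delta A (induced_edges E A) x"

definition delta_on :: "('v \<times> 'v) set \<Rightarrow> 'v set \<Rightarrow> ('v \<Rightarrow> real) \<Rightarrow> real" where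
  "delta_on E A y = delta A (induced_edges E A) y"

definition M_graph :: "'v set \<Rightarrow> ('v \<times> 'v) set \<Rightarrow> ('v \<Rightarrow> real) set" where
  "M_graph V E = {x \<in> V \<rightarrow>\<^sub>E {0<..}. \<forall>A. A \<subseteq> V \<longrightarrow> Delta_on E A x > 0}"

definition u_map :: "('v \<times> 'v) set \<Rightarrow> ('v \<times> 'v) set \<Rightarrow> ('v \<Rightarrow> real) \<Rightarrow> 'v \<Rightarrow> real" where
  "u_map E D x i = 1 - Delta_on E (de_bar D i) x / Delta_on E (de D i) x"

definition w_map :: "('v \<times> 'v) set \<Rightarrow> ('v \<times> 'v) set \<Rightarrow> ('v \<Rightarrow> real) \<Rightarrow> 'v \<Rightarrow> real" where
  "w_map E D y i = delta_on E (de_bar D i) y / delta_on E (de D i) y - 1"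


section \<open>Graph negative multinomial and graph multinomial distributions\<close>

text \<open>Polynomials in the variables indexed by \<open>'v\<close> are elements of the ring
  \<open>('v \<Rightarrow>\<^sub>0 nat) \<Rightarrow>\<^sub>0 real\<close>; \<open>mono_exp A n\<close> is the exponent of the monomial with exponent
  \<open>n i\<close> in the variable \<open>i \<in> A\<close>.\<close>

definition mono_exp :: "'v set \<Rightarrow> ('v \<Rightarrow> nat) \<Rightarrow> 'v \<Rightarrow>\<^sub>0 nat" where
  "mono_exp A n = (\<Sum>i\<in>A. Poly_Mapping.single i (n i))"

definition Delta_poly :: "'v set \<Rightarrow> ('v \<times> 'v) set \<Rightarrow> ('v \<Rightarrow>\<^sub>0 nat) \<Rightarrow>\<^sub>0 real" where
  "Delta_poly V E = (\<Sum>C\<in>cliques V (compl_edges V E).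
     Poly_Mapping.single (mono_exp C (\<lambda>_. 1)) ((-1) ^ card C))"

definition delta_poly :: "'v set \<Rightarrow> ('v \<times> 'v) set \<Rightarrow> ('v \<Rightarrow>\<^sub>0 nat) \<Rightarrow>\<^sub>0 real" where
  "delta_poly V E = (\<Sum>C\<in>cliques V (compl_edges V E).
     Poly_Mapping.single (mono_exp C (\<lambda>_. 1)) 1)"

text \<open>The coefficient of \<open>y\<^sup>n\<close> in \<open>\<delta>\<^sub>G(y)\<^sup>r\<close>.\<close>

definition mult_coeff :: "'v set \<Rightarrow> ('v \<times> 'v) set \<Rightarrow> nat \<Rightarrow> ('v \<Rightarrow> nat) \<Rightarrow> real" where
  "mult_coeff V E r n = Poly_Mapping.lookup (delta_poly V E ^ r) (mono_exp V n)"

text \<open>The coefficient of \<open>x\<^sup>n\<close> in the formal power series \<open>\<Delta>\<^sub>G(x)\<close> to the power \<open>-r\<close>.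
  A formal power series \<open>1 + F\<close>, where \<open>F\<close> has zero constant term, has as its real power with
  exponent \<open>s\<close> the binomial series, the sum over all \<open>k\<close> of \<open>(s gchoose k) F^k\<close>.
  Every monomial of \<open>(\<Delta>\<^sub>G - 1)^k\<close> has total degree at least \<open>k\<close>, so
  only the terms \<open>k \<le> |n|\<close> contribute to the coefficient of \<open>x\<^sup>n\<close>.\<close>

definition nm_coeff :: "'v set \<Rightarrow> ('v \<times> 'v) set \<Rightarrow> real \<Rightarrow> ('v \<Rightarrow> nat) \<Rightarrow> real" where
  "nm_coeff V E r n = (\<Sum>k\<le>(\<Sum>i\<in>V. n i).
     ((- r) gchoose k) * Poly_Mapping.lookup ((Delta_poly V E - 1) ^ k) (mono_exp V n))"

definition mult_support :: "'v set \<Rightarrow> ('v \<times> 'v) set \<Rightarrow> nat \<Rightarrow> ('v \<Rightarrow> nat) set" where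
  "mult_support V E r =
     {n \<in> V \<rightarrow>\<^sub>E UNIV. Max ((\<lambda>C. \<Sum>i\<in>C. n i) ` max_cliques V E) \<le> r}"

definition nm_mass ::
    "'v set \<Rightarrow> ('v \<times> 'v) set \<Rightarrow> real \<Rightarrow> ('v \<Rightarrow> real) \<Rightarrow> ('v \<Rightarrow> nat) \<Rightarrow> real" where
  "nm_mass V E r x n = nm_coeff V E r n * (\<Prod>i\<in>V. x i ^ n i) * Delta V E x powr r"

definition mult_mass ::
    "'v set \<Rightarrow> ('v \<times> 'v) set \<Rightarrow> nat \<Rightarrow> ('v \<Rightarrow> real) \<Rightarrow> ('v \<Rightarrow> nat) \<Rightarrow> real" where
  "mult_mass V E r y n =
     (if n \<in> mult_support V E r
      then mult_coeff V E r n * (\<Prod>i\<in>V. y i ^ n i) / delta V E y ^ r else 0)"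


section \<open>Conditional probabilities given the random parameter\<close>

text \<open>\<open>X\<close> is the random parameter, a random vector indexed by \<open>V\<close>, and \<open>N\<close> is the vector of
  counts; \<open>cond_marg M V X N A n\<close> is (a version of) the conditional probability
  \<open>P(N\<^sub>A = n | X)\<close>, given the sigma-algebra generated by \<open>X\<close>. The choice of the version does not
  matter below: all families are countable, and independence is not affected by modifications
  on null sets.\<close>

definition cond_marg ::
    "'a measure \<Rightarrow> 'v set \<Rightarrow> ('a \<Rightarrow> 'v \<Rightarrow> real) \<Rightarrow> ('a \<Rightarrow> 'v \<Rightarrow> nat)
     \<Rightarrow> 'v set \<Rightarrow> ('v \<Rightarrow> nat) \<Rightarrow> 'a \<Rightarrow> real" where
  "cond_marg M V X N A n =
     real_cond_exp M (vimage_algebra (space M) X (PiM V (\<lambda>_. borel)))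
       (indicat_real {\<omega> \<in> space M. restrict (N \<omega>) A = n})"

definition has_cond_law ::
    "'a measure \<Rightarrow> 'v set \<Rightarrow> ('a \<Rightarrow> 'v \<Rightarrow> real) \<Rightarrow> ('a \<Rightarrow> 'v \<Rightarrow> nat)
     \<Rightarrow> (('v \<Rightarrow> real) \<Rightarrow> ('v \<Rightarrow> nat) \<Rightarrow> real) \<Rightarrow> bool" where
  "has_cond_law M V X N K \<longleftrightarrow>
     N \<in> measurable M (count_space (V \<rightarrow>\<^sub>E UNIV)) \<and>
     (\<forall>n \<in> V \<rightarrow>\<^sub>E UNIV. AE \<omega> in M. cond_marg M V X N V n \<omega> = K (X \<omega>) n)"

definition marg_index :: "'v set \<Rightarrow> ('v \<Rightarrow> nat) set" where
  "marg_index A = A \<rightarrow>\<^sub>E UNIV"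

definition marg_family ::
    "'a measure \<Rightarrow> 'v set \<Rightarrow> ('a \<Rightarrow> 'v \<Rightarrow> real) \<Rightarrow> ('a \<Rightarrow> 'v \<Rightarrow> nat)
     \<Rightarrow> 'v set \<Rightarrow> 'a \<Rightarrow> ('v \<Rightarrow> nat) \<Rightarrow> real" where
  "marg_family M V X N A \<omega> = (\<lambda>n\<in>marg_index A. cond_marg M V X N A n \<omega>)"

text \<open>\<open>cond_family M V X N B A\<close> is the family \<open>p\<close> with subscript \<open>B | A\<close>. Its index set leaves out
  the \<open>n\<close> for which the denominator vanishes; for the graph negative multinomial
  distribution there are none.\<close>

definition cond_index ::
    "'a measure \<Rightarrow> 'v set \<Rightarrow> ('a \<Rightarrow> 'v \<Rightarrow> real) \<Rightarrow> ('a \<Rightarrow> 'v \<Rightarrow> nat)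
     \<Rightarrow> 'v set \<Rightarrow> 'v set \<Rightarrow> ('v \<Rightarrow> nat) set" where
  "cond_index M V X N B A =
     {n \<in> A \<union> B \<rightarrow>\<^sub>E UNIV. AE \<omega> in M. cond_marg M V X N A (restrict n A) \<omega> \<noteq> 0}"

definition cond_family ::
    "'a measure \<Rightarrow> 'v set \<Rightarrow> ('a \<Rightarrow> 'v \<Rightarrow> real) \<Rightarrow> ('a \<Rightarrow> 'v \<Rightarrow> nat)
     \<Rightarrow> 'v set \<Rightarrow> 'v set \<Rightarrow> 'a \<Rightarrow> ('v \<Rightarrow> nat) \<Rightarrow> real" where
  "cond_family M V X N B A \<omega> =
     (\<lambda>n\<in>cond_index M V X N B A.
        cond_marg M V X N (A \<union> B) n \<omega> / cond_marg M V X N A (restrict n A) \<omega>)"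

definition indep_cond_marg ::
    "'a measure \<Rightarrow> 'v set \<Rightarrow> ('a \<Rightarrow> 'v \<Rightarrow> real) \<Rightarrow> ('a \<Rightarrow> 'v \<Rightarrow> nat)
     \<Rightarrow> 'v set \<Rightarrow> 'v set \<Rightarrow> 'v set \<Rightarrow> bool" where
  "indep_cond_marg M V X N B A A' \<longleftrightarrow>
     prob_space.indep_var M
       (PiM (cond_index M V X N B A) (\<lambda>_. borel)) (cond_family M V X N B A)
       (PiM (marg_index A') (\<lambda>_. borel)) (marg_family M V X N A')"

text \<open>A complete graph has no decomposition, all three parts being non-empty. For such a graph
  \<open>strong_hyper_markov\<close> is vacuous, and it does not imply \<open>strong_directed_hyper_markov\<close>.\<close>

definition strong_hyper_markov ::
    "'a measure \<Rightarrow> 'v set \<Rightarrow> ('v \<times> 'v) set \<Rightarrow> ('a \<Rightarrow> 'v \<Rightarrow> real) \<Rightarrow> ('a \<Rightarrow> 'v \<Rightarrow> nat) \<Rightarrow> bool" where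
  "strong_hyper_markov M V E X N \<longleftrightarrow>
     (\<forall>A B C. decomposition V E A B C \<longrightarrow>
        indep_cond_marg M V X N (B \<union> C) (A \<union> C) (A \<union> C))"

definition strong_directed_hyper_markov ::
    "'a measure \<Rightarrow> 'v set \<Rightarrow> ('v \<times> 'v) set \<Rightarrow> ('a \<Rightarrow> 'v \<Rightarrow> real) \<Rightarrow> ('a \<Rightarrow> 'v \<Rightarrow> nat) \<Rightarrow> bool" where
  "strong_directed_hyper_markov M V D X N \<longleftrightarrow>
     (\<forall>i\<in>V. indep_cond_marg M V X N {i} (pa D i) (nde V D i))"

end

theory Submission
  imports Defs
begin

text \<open>Fix a moral DAG with skeleton the given graph and let \<open>u\<close> be the vector of the \<open>u_map\<close>
  coordinates. The key fact is that the graph negative multinomial law is a product over the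
  vertices: given the counts at the parents of \<open>i\<close>, with sum \<open>m\<close>, the count at \<open>i\<close> is negative
  binomial with size \<open>r + m\<close> and parameter \<open>u i\<close> (\<open>nm_mass_eq_prod\<close>). Replacing \<open>r\<close> by \<open>-r\<close> and
  \<open>x\<close> by \<open>-y\<close> turns this into the statement that the graph multinomial law is a product of
  binomial laws (\<open>mult_mass_eq_prod\<close>), so both parts of the theorem become one statement about
  conditional laws that factorize along a DAG (the locale \<open>conditional_factorization\<close>).

  In such a product the family \<open>p\<close> with subscript \<open>i | pa(i)\<close> is a function of \<open>u i\<close> alone, the
  family with subscript \<open>nde(i)\<close> is a function of the \<open>u j\<close> with \<open>j\<close> a non-descendant of \<open>i\<close>,
  and these coordinates can in turn be recovered from the families. Hence the strong directed
  hyper Markov property says that every coordinate is independent of those at its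
  non-descendants; read along a topological order this is mutual independence
  (\<open>directed_iff_indep\<close>).

  For the undirected property, a decomposition \<open>(A, B, C)\<close> of a chordal graph admits a moral
  orientation in which \<open>A \<union> C\<close> contains the parents of its members
  (\<open>ex_moral_dag_decomposition\<close>). In this orientation the family of \<open>A \<union> C\<close> depends on the
  coordinates in \<open>A \<union> C\<close> and the conditional family on those in \<open>B\<close>, so independent coordinates
  make the two families independent.

  The product formula has two halves. The coefficients of the \<open>s\<close>-th power of the clique
  polynomial count \<open>s\<close>-tuples of stable sets, and a simplicial vertex splits off a binomial
  coefficient from this count (\<open>stable_count_simplicial\<close>); since the coefficients of the power
  with exponent \<open>-r\<close> are polynomials in \<open>r\<close>, this settles real \<open>r\<close> as well (\<open>nm_coeff_eq_prod\<close>).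
  On the parameter side, the clique polynomial is the product of the \<open>1 - u i\<close>, and \<open>x i\<close> is
  \<open>u i\<close> times the product of the \<open>1 - u j\<close> over the children \<open>j\<close> of \<open>i\<close>
  (\<open>u_map_parametrization\<close>).\<close>

section \<open>Moral orientations of chordal graphs\<close>

lemma rtrancl_imp_successively:
  assumes "(x, y) \<in> R\<^sup>*"
  shows "\<exists>p. p \<noteq> [] \<and> hd p = x \<and> last p = y \<and> successively (\<lambda>a b. (a, b) \<in> R) p"
  using assms
proof (induction rule: converse_rtrancl_induct)
  case base
  show ?case by (rule exI[of _ "[y]"]) auto
next
  case (step a b)
  then obtain p where p: "p \<noteq> []" "hd p = b" "last p = y" "successively (\<lambda>a b. (a, b) \<in> R) p"
    by blast
  show ?case by (rule exI[of _ "a # p"]) (use p step(1) in \<open>auto simp: successively_Cons\<close>)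
qed

text \<open>A walk of least length between two points has no repetition and no shortcut, since either
  one would allow a piece to be cut out.\<close>

lemma ex_induced_walk:
  assumes "(x, y) \<in> R\<^sup>*"
  obtains p where "p \<noteq> []" "hd p = x" "last p = y" "distinct p"
    "successively (\<lambda>a b. (a, b) \<in> R) p"
    "\<And>i j. Suc i < j \<Longrightarrow> j < length p \<Longrightarrow> (p ! i, p ! j) \<notin> R"
proof -
  define Q where "Q p \<longleftrightarrow> p \<noteq> [] \<and> hd p = x \<and> last p = y \<and> successively (\<lambda>a b. (a, b) \<in> R) p" for p
  obtain p0 where "Q p0" using rtrancl_imp_successively[OF assms] unfolding Q_def by blast
  define p where "p = arg_min length Q"
  have "Q p" and least: "\<And>q. Q q \<Longrightarrow> length p \<le> length q"
    using arg_min_nat_lemma[of Q p0 length, OF \<open>Q p0\<close>] by (auto simp: p_def)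
  then have p: "p \<noteq> []" "hd p = x" "last p = y" "successively (\<lambda>a b. (a, b) \<in> R) p"
    by (auto simp: Q_def)
  have "distinct p"
  proof (rule ccontr)
    assume "\<not> distinct p"
    then obtain xs ys zs v where d: "p = xs @ [v] @ ys @ [v] @ zs"
      using not_distinct_decomp by blast
    have "Q (xs @ [v] @ zs)"
      using p unfolding d Q_def
      by (cases xs; cases zs) (auto simp: successively_append_iff successively_Cons hd_append)
    from least[OF this] show False by (simp add: d)
  qed
  moreover have "(p ! i, p ! j) \<notin> R" if ij: "Suc i < j" "j < length p" for i j
  proof
    assume e: "(p ! i, p ! j) \<in> R"
    have d: "p = take i p @ p ! i # drop (Suc i) p"
      using ij by (simp add: id_take_nth_drop)
    have suc1: "successively (\<lambda>a b. (a, b) \<in> R) (take (Suc i) p)"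
      using p(4) by (metis append_take_drop_id successively_append_iff)
    have suc2: "successively (\<lambda>a b. (a, b) \<in> R) (drop j p)"
      using p(4) by (metis append_take_drop_id successively_append_iff)
    have "last (take (Suc i) p) = p ! i" using ij by (simp add: take_Suc_conv_app_nth)
    moreover have "hd (drop j p) = p ! j" using ij by (simp add: hd_drop_conv_nth)
    moreover have "hd (take (Suc i) p) = x" using p ij by simp
    moreover have "last (drop j p) = y" using p ij by simp
    moreover have "take (Suc i) p \<noteq> []" "drop j p \<noteq> []" using ij by auto
    ultimately have "Q (take (Suc i) p @ drop j p)"
      using e suc1 suc2 unfolding Q_def by (auto simp: successively_append_iff)
    from least[OF this] show False using ij by auto
  qed
  ultimately show thesis using that p by blast
qed

lemma simple_graph_subset:
  "simple_graph V E \<Longrightarrow> W \<subseteq> V \<Longrightarrow> simple_graph W (induced_edges E W)"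
  by (auto simp: simple_graph_def induced_edges_def sym_def irrefl_def intro: finite_subset)

lemma decomposable_subset:
  assumes "decomposable V E" "W \<subseteq> V"
  shows "decomposable W (induced_edges E W)"
  unfolding decomposable_def
proof (intro allI impI)
  fix c assume c: "induced_cycle W (induced_edges E W) c"
  have "(c ! a, c ! b) \<in> induced_edges E W \<longleftrightarrow> (c ! a, c ! b) \<in> E" if "a < length c" "b < length c" for a b
    using c that nth_mem by (fastforce simp: induced_cycle_def induced_edges_def)
  then have "induced_cycle V E c" using c assms(2) by (simp add: induced_cycle_def) blast
  then show "length c \<le> 3" using assms(1) by (simp add: decomposable_def)
qed

text \<open>In a chordal graph, if two vertices \<open>x\<close> and \<open>y\<close> are joined by a path through \<open>U\<close> and have a
  common neighbour \<open>r\<close> with no neighbour in \<open>U\<close>, then they are adjacent: otherwise a shortest such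
  path closes up at \<open>r\<close> to an induced cycle with at least four vertices.\<close>

lemma decomposable_chord:
  assumes G: "simple_graph V E" and dec: "decomposable V E"
    and xy: "(x, y) \<in> (E \<inter> (insert x (insert y U)) \<times> (insert x (insert y U)))\<^sup>*"
    and V: "x \<in> V" "y \<in> V" "U \<subseteq> V"
    and r: "(r, x) \<in> E" "(r, y) \<in> E" "\<And>u. u \<in> U \<Longrightarrow> (r, u) \<notin> E" "r \<notin> U"
    and "x \<noteq> y"
  shows "(x, y) \<in> E"
proof (rule ccontr)
  assume nxy: "(x, y) \<notin> E"
  define S where "S = insert x (insert y U)"
  have sym: "\<And>a b. (a, b) \<in> E \<Longrightarrow> (b, a) \<in> E" and irr: "\<And>a. (a, a) \<notin> E" and "r \<in> V"
    using G r(1) by (auto simp: simple_graph_def sym_def irrefl_def)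
  obtain p where p: "p \<noteq> []" "hd p = x" "last p = y" "distinct p"
    "successively (\<lambda>a b. (a, b) \<in> E \<inter> S \<times> S) p"
    "\<And>i j. Suc i < j \<Longrightarrow> j < length p \<Longrightarrow> (p ! i, p ! j) \<notin> E \<inter> S \<times> S"
    using ex_induced_walk[OF xy] unfolding S_def[symmetric] by blast
  define n where "n = length p"
  have n0: "p ! 0 = x" "p ! (n - 1) = y" "n > 0"
    using p by (auto simp: hd_conv_nth last_conv_nth n_def)
  have "n \<noteq> 1" using n0 \<open>x \<noteq> y\<close> by auto
  then have "n \<ge> 2" using n0(3) by linarith
  have step: "(p ! i, p ! Suc i) \<in> E \<inter> S \<times> S" if "Suc i < n" for i
    using p(5) that by (simp add: successively_conv_nth n_def)
  have "n \<noteq> 2"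
    using step[of 0] n0 nxy by auto
  with \<open>n \<ge> 2\<close> have n3: "n \<ge> 3" by simp
  have inS: "p ! i \<in> S" if "i < n" for i
  proof (cases "Suc i < n")
    case True
    with step[OF this] show ?thesis by auto
  next
    case False
    with that n3 have "i = n - 1" by simp
    then show ?thesis using n0 by (simp add: S_def)
  qed
  have adj: "(p ! i, p ! j) \<in> E \<longleftrightarrow> j = Suc i \<or> i = Suc j" if "i < n" "j < n" for i j
  proof -
    consider "i = j" | "j = Suc i" | "i = Suc j" | "Suc i < j" | "Suc j < i" by linarith
    then show ?thesis
    proof cases
      case 4
      then show ?thesis using p(6)[of i j] inS that by (auto simp: n_def)
    next
      case 5
      then have "(p ! j, p ! i) \<notin> E" using p(6)[of j i] inS that by (auto simp: n_def)
      then show ?thesis using 5 sym by auto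
    qed (use step that irr sym in auto)
  qed
  have radj: "(r, p ! i) \<in> E \<longleftrightarrow> i = 0 \<or> i = n - 1" if "i < n" for i
  proof -
    have "p ! i \<in> U" if i: "i \<noteq> 0" "i \<noteq> n - 1"
    proof -
      have "p ! i \<noteq> p ! 0" "p ! i \<noteq> p ! (n - 1)"
        using i \<open>i < n\<close> p(1) nth_eq_iff_index_eq[OF p(4), of i 0] nth_eq_iff_index_eq[OF p(4), of i "n - 1"]
        by (auto simp: n_def)
      then show ?thesis using inS[OF \<open>i < n\<close>] n0 by (auto simp: S_def)
    qed
    then show ?thesis using r n0 by auto
  qed
  have "r \<notin> S" using r irr by (auto simp: S_def)
  have "induced_cycle V E (r # p)"
    unfolding induced_cycle_def
  proof (intro conjI allI impI)
    show "3 \<le> length (r # p)" using n3 by (simp add: n_def)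
    have "set p \<subseteq> S" using inS by (auto simp: in_set_conv_nth n_def)
    then show "distinct (r # p)" using p(4) \<open>r \<notin> S\<close> by auto
    show "set (r # p) \<subseteq> V" using \<open>set p \<subseteq> S\<close> V \<open>r \<in> V\<close> by (auto simp: S_def)
  next
    fix a b assume "a < length (r # p)" "b < length (r # p)"
    then have ab: "a < Suc n" "b < Suc n" by (auto simp: n_def)
    have len: "length (r # p) = Suc n" by (simp add: n_def)
    have m: "Suc k mod Suc n = (if k = n then 0 else Suc k)" if "k < Suc n" for k
      using that by auto
    show "((r # p) ! a, (r # p) ! b) \<in> E \<longleftrightarrow>
       b = Suc a mod length (r # p) \<or> a = Suc b mod length (r # p)"
      unfolding len m[OF ab(1)] m[OF ab(2)]
    proof (cases a; cases b)
      fix i j assume ij: "a = Suc i" "b = Suc j"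
      then show "((r # p) ! a, (r # p) ! b) \<in> E \<longleftrightarrow>
       b = (if a = n then 0 else Suc a) \<or> a = (if b = n then 0 else Suc b)"
        using adj[of i j] ab by auto
    next
      fix j assume "a = 0" "b = Suc j"
      then show "((r # p) ! a, (r # p) ! b) \<in> E \<longleftrightarrow>
       b = (if a = n then 0 else Suc a) \<or> a = (if b = n then 0 else Suc b)"
        using radj[of j] ab n3 by auto
    next
      fix i assume "a = Suc i" "b = 0"
      then show "((r # p) ! a, (r # p) ! b) \<in> E \<longleftrightarrow>
       b = (if a = n then 0 else Suc a) \<or> a = (if b = n then 0 else Suc b)"
        using radj[of i] ab n3 sym by auto
    qed (use irr n3 in auto)
  qed
  then have "length (r # p) \<le> 3" using dec unfolding decomposable_def by blast
  then show False using n3 by (simp add: n_def)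
qed

text \<open>Take a connected set \<open>U\<close> that is maximal among those whose closed neighbourhood is not
  everything. By maximality each vertex of its boundary \<open>S\<close> is adjacent to every vertex of the
  remainder \<open>R\<close>, so chordality makes \<open>S\<close> a clique. As no edge joins \<open>U\<close> and \<open>R\<close>, the clique \<open>K\<close> misses
  one of them, and the induction applies to that side together with \<open>S\<close>.\<close>

lemma ex_simplicial_outside_clique:
  assumes "simple_graph W E" "decomposable W E" "K \<in> cliques W E" "K \<noteq> W"
  shows "\<exists>v\<in>W - K. {j. (v, j) \<in> E} \<in> cliques W E"
  using assms
proof (induction "card W" arbitrary: W E K rule: less_induct)
  case less
  note G = less.prems(1)
  have sym: "\<And>a b. (a, b) \<in> E \<Longrightarrow> (b, a) \<in> E" and irr: "\<And>a. (a, a) \<notin> E"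
    and EW: "E \<subseteq> W \<times> W" and fin: "finite W"
    using G by (auto simp: simple_graph_def sym_def irrefl_def)
  have KW: "K \<subseteq> W" and Kc: "\<And>i j. i \<in> K \<Longrightarrow> j \<in> K \<Longrightarrow> i \<noteq> j \<Longrightarrow> (i, j) \<in> E"
    using less.prems(3) by (auto simp: cliques_def)
  show ?case
  proof (cases "\<forall>i\<in>W. \<forall>j\<in>W. i \<noteq> j \<longrightarrow> (i, j) \<in> E")
    case True
    obtain v where "v \<in> W - K" using KW less.prems(4) by blast
    moreover have "{j. (v, j) \<in> E} \<in> cliques W E" using True EW by (auto simp: cliques_def)
    ultimately show ?thesis by blast
  next
    case False
    then obtain a b where ab: "a \<in> W" "b \<in> W" "a \<noteq> b" "(a, b) \<notin> E" by blast
    \<comment> \<open>The set \<open>far U\<close> is the complement of the closed neighbourhood of \<open>U\<close>.\<close>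
    define far where "far U = {r \<in> W. r \<notin> U \<and> (\<forall>u\<in>U. (u, r) \<notin> E)}" for U
    define conn where "conn U \<longleftrightarrow> (\<forall>x\<in>U. \<forall>y\<in>U. (x, y) \<in> (E \<inter> U \<times> U)\<^sup>*)" for U
    define \<U> where "\<U> = {U. U \<subseteq> W \<and> U \<noteq> {} \<and> conn U \<and> far U \<noteq> {}}"
    have "finite \<U>" using fin by (auto simp: \<U>_def intro: finite_subset[of _ "Pow W"])
    moreover have "{a} \<in> \<U>" using ab by (auto simp: \<U>_def far_def conn_def)
    ultimately obtain U where U: "U \<in> \<U>" and max: "\<And>U'. U' \<in> \<U> \<Longrightarrow> U \<subseteq> U' \<Longrightarrow> U = U'"
      using finite_has_maximal2[of \<U> "{a}"] by blast
    define R where "R = far U"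
    define S where "S = W - U - R"
    have UW: "U \<subseteq> W" "U \<noteq> {}" "R \<noteq> {}" and cU: "conn U" and RW: "R \<subseteq> W" "R \<inter> U = {}"
      using U by (auto simp: \<U>_def R_def far_def)
    have noUR: "(u, r) \<notin> E" "(r, u) \<notin> E" if "u \<in> U" "r \<in> R" for u r
      using that sym by (auto simp: R_def far_def)
    have Sadj: "\<exists>u\<in>U. (u, s) \<in> E" if "s \<in> S" for s
      using that by (auto simp: S_def R_def far_def)
    have RS: "(r, s) \<in> E" if s: "s \<in> S" and r: "r \<in> R" for r s
    proof (rule ccontr)
      assume nrs: "(r, s) \<notin> E"
      obtain u where u: "u \<in> U" "(u, s) \<in> E" using Sadj[OF s] by blast
      let ?U = "insert s U"
      have "(E \<inter> U \<times> U)\<^sup>* \<subseteq> (E \<inter> ?U \<times> ?U)\<^sup>*" by (rule rtrancl_mono) auto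
      then have c1: "(x, y) \<in> (E \<inter> ?U \<times> ?U)\<^sup>*" if "x \<in> U" "y \<in> U" for x y
        using cU that by (auto simp: conn_def)
      have us: "(u, s) \<in> (E \<inter> ?U \<times> ?U)\<^sup>*" "(s, u) \<in> (E \<inter> ?U \<times> ?U)\<^sup>*"
        using u sym by (auto intro!: r_into_rtrancl)
      have "(x, u) \<in> (E \<inter> ?U \<times> ?U)\<^sup>*" "(u, x) \<in> (E \<inter> ?U \<times> ?U)\<^sup>*" if "x \<in> ?U" for x
        using that us c1 u(1) by auto
      then have "conn ?U" unfolding conn_def by (meson rtrancl_trans)
      moreover have "r \<in> far ?U" using r nrs s sym by (auto simp: far_def R_def S_def)
      ultimately have "?U \<in> \<U>" using UW s by (auto simp: \<U>_def S_def)
      from max[OF this] show False using s by (auto simp: S_def)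
    qed
    have Sc: "(x, y) \<in> E" if xy: "x \<in> S" "y \<in> S" "x \<noteq> y" for x y
    proof -
      obtain r where r: "r \<in> R" using UW by blast
      obtain u where u: "u \<in> U" "(u, x) \<in> E" using Sadj[OF xy(1)] by blast
      obtain u' where u': "u' \<in> U" "(u', y) \<in> E" using Sadj[OF xy(2)] by blast
      let ?T = "insert x (insert y U)"
      have "(E \<inter> U \<times> U)\<^sup>* \<subseteq> (E \<inter> ?T \<times> ?T)\<^sup>*" by (rule rtrancl_mono) auto
      then have "(u, u') \<in> (E \<inter> ?T \<times> ?T)\<^sup>*" using cU u u' by (auto simp: conn_def)
      moreover have "(x, u) \<in> E \<inter> ?T \<times> ?T" "(u', y) \<in> E \<inter> ?T \<times> ?T" using u u' sym by auto
      ultimately have path: "(x, y) \<in> (E \<inter> ?T \<times> ?T)\<^sup>*"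
        by (meson converse_rtrancl_into_rtrancl rtrancl.rtrancl_into_rtrancl)
      have xy': "x \<in> W" "y \<in> W" "r \<notin> U" using xy r RW by (auto simp: S_def)
      have re: "(r, x) \<in> E" "(r, y) \<in> E" "\<And>u. u \<in> U \<Longrightarrow> (r, u) \<notin> E"
        using xy r RS noUR by auto
      show ?thesis
        by (rule decomposable_chord[OF G less.prems(2) path xy'(1,2) UW(1) re(1,2) _ xy'(3) xy(3)])
          (rule re(3))
    qed
    \<comment> \<open>For each of \<open>U\<close> and \<open>R\<close>, a vertex found in it by induction keeps all its neighbours, which lie in \<open>T \<union> S\<close>.\<close>
    have side: "\<exists>v\<in>T - K. {j. (v, j) \<in> E} \<in> cliques W E"
      if T: "T \<subseteq> W" "T \<noteq> {}" "T \<inter> S = {}" "T \<union> S \<noteq> W" "K \<inter> T = {}"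
        and nb: "\<And>v j. v \<in> T \<Longrightarrow> (v, j) \<in> E \<Longrightarrow> j \<in> T \<union> S" for T
    proof -
      let ?W = "T \<union> S"
      have sub: "?W \<subseteq> W" using T by (auto simp: S_def)
      then have "card ?W < card W" using T fin by (simp add: psubset_card_mono psubset_eq)
      moreover have "S \<in> cliques ?W (induced_edges E ?W)"
        using Sc by (auto simp: cliques_def induced_edges_def)
      ultimately obtain v where v: "v \<in> ?W - S"
        "{j. (v, j) \<in> induced_edges E ?W} \<in> cliques ?W (induced_edges E ?W)"
        using less.hyps[of ?W "induced_edges E ?W" S] simple_graph_subset[OF G sub]
          decomposable_subset[OF less.prems(2) sub] T by blast
      have "{j. (v, j) \<in> induced_edges E ?W} = {j. (v, j) \<in> E}"
        using v(1) nb by (auto simp: induced_edges_def)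
      then have "{j. (v, j) \<in> E} \<in> cliques W E"
        using v(2) EW by (auto simp: cliques_def induced_edges_def)
      then show ?thesis using v(1) T by blast
    qed
    show ?thesis
    proof (cases "K \<inter> U = {}")
      case True
      have "\<exists>v\<in>U - K. {j. (v, j) \<in> E} \<in> cliques W E"
        by (rule side) (use UW RW True noUR EW in \<open>auto simp: S_def\<close>)
      then show ?thesis using UW by blast
    next
      case False
      then have "K \<inter> R = {}" using Kc noUR RW by blast
      then have "\<exists>v\<in>R - K. {j. (v, j) \<in> E} \<in> cliques W E"
        by (intro side) (use UW RW noUR EW in \<open>auto simp: S_def\<close>)
      then show ?thesis using RW by blast
    qed
  qed
qed

lemma moral_dagD:
  assumes "moral_dag E D"
  shows "acyclic D" "D \<union> D\<inverse> = E" "D \<inter> D\<inverse> = {}"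
    "(i, j) \<in> E \<longleftrightarrow> (i, j) \<in> D \<or> (j, i) \<in> D"
    "(i, k) \<in> D \<Longrightarrow> (j, k) \<in> D \<Longrightarrow> i \<noteq> j \<Longrightarrow> (i, j) \<in> E"
proof -
  show un: "D \<union> D\<inverse> = E" and "acyclic D" "D \<inter> D\<inverse> = {}"
    using assms by (simp_all add: moral_dag_def)
  have "\<forall>i j k. (i, k) \<in> D \<and> (j, k) \<in> D \<and> i \<noteq> j \<longrightarrow> (i, j) \<in> E"
    using assms unfolding moral_dag_def by (elim conjE)
  then show "(i, k) \<in> D \<Longrightarrow> (j, k) \<in> D \<Longrightarrow> i \<noteq> j \<Longrightarrow> (i, j) \<in> E" by blast
  show "(i, j) \<in> E \<longleftrightarrow> (i, j) \<in> D \<or> (j, i) \<in> D"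
    unfolding un[symmetric] by simp
qed

text \<open>Removing simplicial vertices one at a time and orienting the edges of the removed vertex towards
  it gives a moral orientation. The vertices outside \<open>T\<close> can be removed first because a clique
  \<open>K\<close> shields them from the rest of \<open>T\<close>.\<close>

lemma ex_moral_dag_ancestral:
  assumes "simple_graph W E" "decomposable W E" "T \<subseteq> W" "K \<in> cliques W E" "K \<subseteq> T"
    and "\<And>i j. i \<in> T - K \<Longrightarrow> j \<in> W - T \<Longrightarrow> (i, j) \<notin> E"
  shows "\<exists>D. moral_dag E D \<and> (\<forall>(j, i)\<in>D. i \<in> T \<longrightarrow> j \<in> T)"
  using assms
proof (induction "card W" arbitrary: W E T K rule: less_induct)
  case less
  note G = less.prems(1)
  have sym: "\<And>a b. (a, b) \<in> E \<Longrightarrow> (b, a) \<in> E" and irr: "\<And>a. (a, a) \<notin> E"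
    and EW: "E \<subseteq> W \<times> W" and fin: "finite W"
    using G by (auto simp: simple_graph_def sym_def irrefl_def)
  have extend: "\<exists>D'. moral_dag E D' \<and> (\<forall>(j, i)\<in>D'. i \<in> T' \<longrightarrow> j \<in> T')"
    if v: "v \<in> W" "{j. (v, j) \<in> E} \<in> cliques W E"
      and D: "moral_dag (induced_edges E (W - {v})) D" "\<forall>(j, i)\<in>D. i \<in> T0 \<longrightarrow> j \<in> T0"
      and T': "T' = T0 \<and> v \<notin> T' \<or> T' = W" for v D T0 T'
  proof (intro exI conjI)
    let ?F = "induced_edges E (W - {v})"
    let ?D = "D \<union> {j. (v, j) \<in> E} \<times> {v}"
    have DF: "D \<union> D\<inverse> = ?F" "D \<inter> D\<inverse> = {}" "acyclic D"
      and mor: "\<And>i j k. (i, k) \<in> D \<Longrightarrow> (j, k) \<in> D \<Longrightarrow> i \<noteq> j \<Longrightarrow> (i, j) \<in> ?F"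
      using moral_dagD[OF D(1)] by auto
    have Dv: "a \<noteq> v" "b \<noteq> v" "(a, b) \<in> E" "(b, a) \<in> E" if "(a, b) \<in> D" for a b
      using that DF(1) sym by (auto simp: induced_edges_def)
    have "acyclic ?D"
    proof (rule acyclicI, intro allI notI)
      have stay: "(x, y) \<in> D\<^sup>+" if "(x, y) \<in> ?D\<^sup>+" "y \<noteq> v" for x y
        using that
      proof (induction rule: trancl_induct)
        case (base y)
        then show ?case by auto
      next
        case (step y z)
        then have yz: "(y, z) \<in> D" by auto
        then have "y \<noteq> v" using Dv by blast
        then show ?case using step yz by (meson trancl_into_trancl)
      qed
      fix x assume xx: "(x, x) \<in> ?D\<^sup>+"
      show False
      proof (cases "x = v")
        case True
        then obtain z where "(v, z) \<in> ?D" using xx by (meson tranclD)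
        then show False using Dv irr by auto
      next
        case False
        then show False using stay[OF xx] DF(3) by (auto simp: acyclic_def)
      qed
    qed
    moreover have "?D \<union> ?D\<inverse> = E"
    proof
      show "?D \<union> ?D\<inverse> \<subseteq> E" using Dv sym by auto
      show "E \<subseteq> ?D \<union> ?D\<inverse>"
      proof
        fix e assume e: "e \<in> E"
        obtain a b where ab: "e = (a, b)" by fastforce
        show "e \<in> ?D \<union> ?D\<inverse>"
        proof (cases "a = v \<or> b = v")
          case True
          then show ?thesis using e ab sym by auto
        next
          case False
          then have "e \<in> ?F" using e ab EW by (auto simp: induced_edges_def)
          then show ?thesis using DF(1) by auto
        qed
      qed
    qed
    moreover have "?D \<inter> ?D\<inverse> = {}" using DF(2) Dv irr by auto
    moreover have "(i, j) \<in> E" if "(i, k) \<in> ?D" "(j, k) \<in> ?D" "i \<noteq> j" for i j k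
    proof (cases "k = v")
      case True
      then have "(v, i) \<in> E" "(v, j) \<in> E" using that Dv by auto
      then show ?thesis using v(2) that(3) by (auto simp: cliques_def)
    next
      case False
      then show ?thesis using that mor by (auto simp: induced_edges_def)
    qed
    ultimately show "moral_dag E ?D" unfolding moral_dag_def by blast
    show "\<forall>(j, i)\<in>?D. i \<in> T' \<longrightarrow> j \<in> T'"
      using T' D(2) EW \<open>?D \<union> ?D\<inverse> = E\<close> by blast
  qed
  show ?case
  proof (cases "W = {}")
    case True
    then have "moral_dag E {}" using EW by (auto simp: moral_dag_def acyclic_def)
    then show ?thesis by blast
  next
    case False
    show ?thesis
    proof (cases "T = W")
      case True
      have "{} \<in> cliques W E" by (auto simp: cliques_def)
      then obtain v where v: "v \<in> W" "{j. (v, j) \<in> E} \<in> cliques W E"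
        using ex_simplicial_outside_clique[OF G less.prems(2)] False by blast
      let ?W = "W - {v}"
      have "card ?W < card W" using v fin by (meson card_Diff1_less)
      then have "\<exists>D. moral_dag (induced_edges E ?W) D \<and> (\<forall>(j, i)\<in>D. i \<in> ?W \<longrightarrow> j \<in> ?W)"
        by (rule less.hyps[of ?W "induced_edges E ?W" ?W "{}"])
          (use simple_graph_subset[OF G] decomposable_subset[OF less.prems(2)] in
            \<open>auto simp: cliques_def\<close>)
      then show ?thesis using extend[OF v] True by blast
    next
      case neq: False
      let ?U = "(W - T) \<union> K"
      have sub: "?U \<subseteq> W" using less.prems by auto
      have KU: "K \<in> cliques ?U (induced_edges E ?U)" "K \<noteq> ?U"
        using less.prems neq by (auto simp: cliques_def induced_edges_def)
      obtain v where v: "v \<in> ?U - K"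
          "{j. (v, j) \<in> induced_edges E ?U} \<in> cliques ?U (induced_edges E ?U)"
        using ex_simplicial_outside_clique[OF simple_graph_subset[OF G sub]
            decomposable_subset[OF less.prems(2) sub] KU] by blast
      have vT: "v \<in> W" "v \<notin> T" using v(1) by auto
      have "{j. (v, j) \<in> induced_edges E ?U} = {j. (v, j) \<in> E}"
        using v(1) less.prems(6) sym EW by (fastforce simp: induced_edges_def)
      then have vc: "{j. (v, j) \<in> E} \<in> cliques W E"
        using v(2) EW by (auto simp: cliques_def induced_edges_def)
      let ?W = "W - {v}"
      have "card ?W < card W" using vT fin by (meson card_Diff1_less)
      then have "\<exists>D. moral_dag (induced_edges E ?W) D \<and> (\<forall>(j, i)\<in>D. i \<in> T \<longrightarrow> j \<in> T)"
        by (rule less.hyps[of ?W "induced_edges E ?W" T K])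
          (use simple_graph_subset[OF G] decomposable_subset[OF less.prems(2)] less.prems vT in
            \<open>auto simp: cliques_def induced_edges_def\<close>)
      then show ?thesis using extend[OF vT(1) vc] vT by blast
    qed
  qed
qed

text \<open>An edge is a path with two vertices, which has no room for the separator.\<close>

lemma decomposition_no_edge:
  assumes "simple_graph V E" "decomposition V E A B C" "a \<in> A" "b \<in> B"
  shows "(a, b) \<notin> E"
proof
  assume "(a, b) \<in> E"
  then have "graph_path V E [a, b]"
    using assms by (auto simp: graph_path_def decomposition_def)
  then have "set [a, b] \<inter> C \<noteq> {}"
    using assms unfolding decomposition_def separates_def by fastforce
  then show False using assms by (auto simp: decomposition_def)
qed

text \<open>In a decomposition, \<open>C\<close> is the clique that shields \<open>A\<close> from \<open>B\<close>.\<close>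

lemma ex_moral_dag_decomposition:
  assumes G: "simple_graph V E" "decomposable V E" and dec: "decomposition V E A B C"
  shows "\<exists>D. moral_dag E D \<and> (\<forall>(j, i)\<in>D. i \<in> A \<union> C \<longrightarrow> j \<in> A \<union> C)"
proof (rule ex_moral_dag_ancestral[OF G, of _ C])
  show "(i, j) \<notin> E" if "i \<in> A \<union> C - C" "j \<in> V - (A \<union> C)" for i j
    using decomposition_no_edge[OF G(1) dec, of i j] dec that by (auto simp: decomposition_def)
qed (use dec in \<open>auto simp: decomposition_def\<close>)

section \<open>Ancestral sets\<close>

lemma ex_sink:
  assumes "finite W" "W \<noteq> {}" "acyclic D"
  shows "\<exists>v\<in>W. \<forall>j\<in>W. (v, j) \<notin> D"
proof -
  let ?D = "D \<inter> W \<times> W"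
  have "wf (?D\<inverse>)"
    using assms acyclic_subset[of D ?D] by (intro finite_acyclic_wf_converse) auto
  then obtain v where "v \<in> W" "\<And>y. (y, v) \<in> ?D\<inverse> \<Longrightarrow> y \<notin> W"
    using assms(2) by (metis ex_in_conv wfE_min)
  then show ?thesis by blast
qed

lemma ex_source:
  assumes "finite W" "W \<noteq> {}" "acyclic D"
  shows "\<exists>v\<in>W. \<forall>j\<in>W. (j, v) \<notin> D"
  using ex_sink[of W "D\<inverse>"] assms by simp

text \<open>Closed under parents. For the converse of \<open>D\<close> this is closure under descendants, and \<open>pa\<close>
  of the converse is the set of children.\<close>

definition ancestral :: "('v \<times> 'v) set \<Rightarrow> 'v set \<Rightarrow> bool" where
  "ancestral D S \<longleftrightarrow> (\<forall>i\<in>S. pa D i \<subseteq> S)"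

lemma ancestral_remove_sink:
  "ancestral D S \<Longrightarrow> \<forall>j\<in>S. (v, j) \<notin> D \<Longrightarrow> ancestral D (S - {v})"
  by (auto simp: ancestral_def pa_def)

text \<open>Every ancestral set can be emptied by removing sinks, and stays ancestral on the way.\<close>

lemma ancestral_induct [consumes 3, case_names empty sink]:
  assumes "finite S" "acyclic D" "ancestral D S"
    and "P {}"
    and "\<And>S v. finite S \<Longrightarrow> ancestral D S \<Longrightarrow> v \<in> S \<Longrightarrow> \<forall>j\<in>S. (v, j) \<notin> D \<Longrightarrow> P (S - {v}) \<Longrightarrow> P S"
  shows "P S"
  using assms(1,3)
proof (induction S rule: finite_psubset_induct)
  case (psubset S)
  show ?case
  proof (cases "S = {}")
    case False
    then obtain v where v: "v \<in> S" "\<forall>j\<in>S. (v, j) \<notin> D"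
      using ex_sink[OF psubset.hyps False assms(2)] by blast
    show ?thesis
      by (rule assms(5)[OF psubset.hyps psubset.prems v], rule psubset.IH)
         (use v ancestral_remove_sink[OF psubset.prems] in auto)
  qed (simp add: assms(4))
qed

text \<open>Every ancestral set is reached from \<open>V\<close> by removing sinks: a source of the complement of
  \<open>S\<close> is a sink of the set obtained by adding it to \<open>S\<close>.\<close>

lemma ancestral_downward_induct [consumes 5, case_names all sink]:
  assumes "finite V" "acyclic D" "D \<subseteq> V \<times> V" "ancestral D S" "S \<subseteq> V"
    and "P V"
    and "\<And>S v. ancestral D S \<Longrightarrow> ancestral D (insert v S) \<Longrightarrow> v \<in> V \<Longrightarrow> v \<notin> S \<Longrightarrow> S \<subseteq> V \<Longrightarrow>
       P (insert v S) \<Longrightarrow> P S"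
  shows "P S"
  using assms(4,5)
proof (induction "card (V - S)" arbitrary: S rule: less_induct)
  case less
  show ?case
  proof (cases "S = V")
    case False
    then obtain v where v: "v \<in> V - S" "\<forall>j\<in>V - S. (j, v) \<notin> D"
      using ex_source[OF _ _ assms(2), of "V - S"] assms(1) less.prems by auto
    have anc: "ancestral D (insert v S)"
      using v less.prems assms(3) by (auto simp: ancestral_def pa_def)
    have "V - insert v S \<subset> V - S" using v by auto
    then have "card (V - insert v S) < card (V - S)" using assms(1) by (simp add: psubset_card_mono)
    then have "P (insert v S)" using less.hyps anc v less.prems by blast
    then show ?thesis using assms(7)[OF less.prems(1) anc] v less.prems by blast
  qed (simp add: assms(6))
qed

section \<open>Tuples of stable sets\<close>

text \<open>Cliques of the complement graph, described in the graph itself.\<close>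

definition stable_sets :: "('v \<times> 'v) set \<Rightarrow> 'v set \<Rightarrow> 'v set set" where
  "stable_sets E W = {C. C \<subseteq> W \<and> (\<forall>i\<in>C. \<forall>j\<in>C. (i, j) \<notin> E)}"

lemma cliques_compl_edges:
  "irrefl E \<Longrightarrow> cliques W (compl_edges W (induced_edges E W)) = stable_sets E W"
  by (rule set_eqI) (fastforce simp: cliques_def compl_edges_def induced_edges_def stable_sets_def irrefl_def)

lemma finite_stable_sets [simp]: "finite W \<Longrightarrow> finite (stable_sets E W)"
  by (auto simp: stable_sets_def intro: finite_subset[of _ "Pow W"])

lemma empty_in_stable_sets [simp]: "{} \<in> stable_sets E W"
  by (auto simp: stable_sets_def)

lemma finite_in_stable_sets: "finite W \<Longrightarrow> C \<in> stable_sets E W \<Longrightarrow> finite C"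
  by (auto simp: stable_sets_def intro: finite_subset)

text \<open>A stable set that contains \<open>v\<close> is \<open>v\<close> together with a stable set that avoids the
  neighbours of \<open>v\<close>.\<close>

lemma sum_stable_sets:
  fixes f :: "'v set \<Rightarrow> 'a::comm_monoid_add"
  assumes "finite W" "sym E" "irrefl E" "v \<in> W"
  shows "(\<Sum>C\<in>stable_sets E W. f C) = (\<Sum>C\<in>stable_sets E (W - {v}). f C) +
    (\<Sum>C\<in>stable_sets E (W - {v} - {j. (v, j) \<in> E}). f (insert v C))"
proof -
  let ?A = "stable_sets E (W - {v})" and ?B = "stable_sets E (W - {v} - {j. (v, j) \<in> E})"
  have "stable_sets E W = ?A \<union> insert v ` ?B"
  proof
    show "?A \<union> insert v ` ?B \<subseteq> stable_sets E W"
      using assms by (auto simp: stable_sets_def irrefl_def sym_def)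
    show "stable_sets E W \<subseteq> ?A \<union> insert v ` ?B"
    proof
      fix C assume C: "C \<in> stable_sets E W"
      show "C \<in> ?A \<union> insert v ` ?B"
      proof (cases "v \<in> C")
        case True
        then have "C = insert v (C - {v})" by auto
        moreover have "C - {v} \<in> ?B" using C True by (auto simp: stable_sets_def)
        ultimately show ?thesis by blast
      next
        case False
        then show ?thesis using C by (auto simp: stable_sets_def)
      qed
    qed
  qed
  moreover have "?A \<inter> insert v ` ?B = {}" by (auto simp: stable_sets_def)
  moreover have "inj_on (insert v) ?B" by (rule inj_onI) (auto simp: stable_sets_def)
  ultimately show ?thesis
    using assms(1) by (simp add: sum.union_disjoint sum.reindex)
qed

definition lower :: "'v set \<Rightarrow> ('v \<Rightarrow> nat) \<Rightarrow> 'v \<Rightarrow> nat" where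
  "lower C n i = (if i \<in> C then n i - 1 else n i)"

text \<open>The number of \<open>r\<close>-tuples of stable sets in which each vertex \<open>i\<close> occurs \<open>n i\<close> times. The
  recursion picks the first set of the tuple; the condition \<open>0 < n i\<close> keeps the truncated
  subtraction in \<open>lower\<close> exact.\<close>

primrec stable_count :: "('v \<times> 'v) set \<Rightarrow> 'v set \<Rightarrow> nat \<Rightarrow> ('v \<Rightarrow> nat) \<Rightarrow> real" where
  "stable_count E W 0 n = (if \<forall>i\<in>W. n i = 0 then 1 else 0)"
| "stable_count E W (Suc r) n =
     (\<Sum>C\<in>stable_sets E W. if \<forall>i\<in>C. 0 < n i then stable_count E W r (lower C n) else 0)"

lemma stable_count_cong:
  "(\<And>i. i \<in> W \<Longrightarrow> n i = m i) \<Longrightarrow> stable_count E W r n = stable_count E W r m"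
proof (induction r arbitrary: n m)
  case (Suc r)
  have "(\<forall>i\<in>C. 0 < n i) \<longleftrightarrow> (\<forall>i\<in>C. 0 < m i)" if "C \<in> stable_sets E W" for C
    using that Suc.prems by (force simp: stable_sets_def)
  moreover have "stable_count E W r (lower C n) = stable_count E W r (lower C m)" for C
    by (rule Suc.IH) (simp add: lower_def Suc.prems)
  ultimately show ?case unfolding stable_count.simps by (intro sum.cong) auto
qed auto

lemma sum_lower:
  assumes "finite K" "\<forall>i\<in>C. 0 < n i"
  shows "(\<Sum>i\<in>K. lower C n i) + card (C \<inter> K) = (\<Sum>i\<in>K. n i)"
  using assms(1)
proof (induction K)
  case (insert i K)
  have "C \<inter> insert i K = (if i \<in> C then insert i (C \<inter> K) else C \<inter> K)" by auto
  then show ?case using insert assms(2) by (auto simp: lower_def)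
qed simp

lemma card_stable_clique_le_1:
  assumes "finite K" "C \<in> stable_sets E W" "\<And>i j. i \<in> K \<Longrightarrow> j \<in> K \<Longrightarrow> i \<noteq> j \<Longrightarrow> (i, j) \<in> E"
  shows "card (C \<inter> K) \<le> 1"
proof -
  have "\<And>a b. a \<in> C \<inter> K \<Longrightarrow> b \<in> C \<inter> K \<Longrightarrow> a = b"
    using assms(2,3) unfolding stable_sets_def by blast
  then show ?thesis using assms(1) by (metis card_le_Suc0_iff_eq finite_Int One_nat_def)
qed

text \<open>The neighbours \<open>K\<close> of \<open>v\<close> form a clique, so each of the \<open>r\<close> stable sets meets \<open>K\<close> in at
  most one vertex, and as many sets as the sum of \<open>n\<close> over \<open>K\<close> are met. The \<open>n v\<close> copies of \<open>v\<close>
  can go exactly to the other sets. The formal proof is by induction on \<open>r\<close>, where Pascal's rule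
  accounts for whether \<open>v\<close> joins the first set. When the sum over \<open>K\<close> exceeds \<open>r\<close>, both counts
  are zero, so it does not matter that the generalized binomial coefficient may then be nonzero.\<close>

lemma stable_count_simplicial:
  fixes E :: "('v \<times> 'v) set"
  assumes "finite W" "sym E" "irrefl E" "v \<in> W"
    and K: "K = {j \<in> W. (v, j) \<in> E}" "\<And>i j. i \<in> K \<Longrightarrow> j \<in> K \<Longrightarrow> i \<noteq> j \<Longrightarrow> (i, j) \<in> E"
  shows "stable_count E W r n =
    ((real r - real (\<Sum>i\<in>K. n i)) gchoose n v) * stable_count E (W - {v}) r n"
proof (induction r arbitrary: n)
  case 0
  have fK: "finite K" "K \<subseteq> W - {v}" using assms(1,3) K(1) by (auto simp: irrefl_def)
  show ?case
  proof (cases "\<forall>i\<in>W - {v}. n i = 0")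
    case True
    then have s: "(\<Sum>i\<in>K. n i) = 0" using fK by (intro sum.neutral) auto
    have w: "(\<forall>i\<in>W. n i = 0) \<longleftrightarrow> n v = 0" using True assms(4) by auto
    show ?thesis unfolding s stable_count.simps w using True by (cases "n v") simp_all
  next
    case False
    then show ?thesis by auto
  qed
next
  case (Suc r)
  have fK: "finite K" "K \<subseteq> W - {v}" using assms(1,3) K(1) by (auto simp: irrefl_def)
  let ?W = "W - {v}"
  define a where "a = real r - real (\<Sum>i\<in>K. n i)"
  let ?f = "\<lambda>C. if \<forall>i\<in>C. 0 < n i then stable_count E ?W r (lower C n) else 0"
  let ?g = "\<lambda>C. if n v = 0 then 0 else (a gchoose (n v - 1)) * ?f C"
  have first: "(if \<forall>i\<in>C. 0 < n i then stable_count E W r (lower C n) else 0) =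
     ((a + real (card (C \<inter> K))) gchoose n v) * ?f C" if C: "C \<in> stable_sets E ?W" for C
  proof (cases "\<forall>i\<in>C. 0 < n i")
    case True
    have "v \<notin> C" using C by (auto simp: stable_sets_def)
    then have "lower C n v = n v" by (simp add: lower_def)
    moreover have "real r - real (\<Sum>i\<in>K. lower C n i) = a + real (card (C \<inter> K))"
      unfolding a_def sum_lower[OF fK(1) True, symmetric] by simp
    ultimately show ?thesis using True Suc.IH[of "lower C n"] by simp
  next
    case False
    show ?thesis unfolding if_not_P[OF False] by simp
  qed
  have second: "(if \<forall>i\<in>insert v C. 0 < n i then stable_count E W r (lower (insert v C) n) else 0) =
     ?g C" (is "?l = _") if C: "C \<in> stable_sets E (?W - {j. (v, j) \<in> E})" for C
  proof (cases "\<forall>i\<in>insert v C. 0 < n i")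
    case True
    have "insert v C \<inter> K = {}" using C K(1) fK(2) by (auto simp: stable_sets_def)
    then have "(\<Sum>i\<in>K. lower (insert v C) n i) = (\<Sum>i\<in>K. n i)"
      by (intro sum.cong) (auto simp: lower_def)
    then have "real r - real (\<Sum>i\<in>K. lower (insert v C) n i) = a" by (simp only: a_def)
    moreover have "stable_count E ?W r (lower (insert v C) n) = stable_count E ?W r (lower C n)"
      by (rule stable_count_cong) (auto simp: lower_def)
    moreover have "lower (insert v C) n v = n v - 1" by (simp add: lower_def)
    ultimately show ?thesis using True Suc.IH[of "lower (insert v C) n"] by simp
  next
    case False
    then have "n v = 0 \<or> \<not> (\<forall>i\<in>C. 0 < n i)" by auto
    then show ?thesis unfolding if_not_P[OF False] by (elim disjE) (simp, simp only: if_False mult_zero_right if_cancel)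
  qed
  have filter: "stable_sets E (?W - {j. (v, j) \<in> E}) = {C \<in> stable_sets E ?W. C \<inter> K = {}}"
    using K(1) by (auto simp: stable_sets_def)
  have pascal: "((a + real (card (C \<inter> K))) gchoose n v) * ?f C + (if C \<inter> K = {} then ?g C else 0) =
      ((a + 1) gchoose n v) * ?f C" if C: "C \<in> stable_sets E ?W" for C
  proof (cases "C \<inter> K = {}")
    case True
    have "(a gchoose n v) + (if n v = 0 then 0 else a gchoose (n v - 1)) = (a + 1) gchoose n v"
      by (cases "n v") (simp_all add: gbinomial_Suc_Suc)
    then have "(a gchoose n v) * ?f C + (if n v = 0 then 0 else a gchoose (n v - 1)) * ?f C
      = ((a + 1) gchoose n v) * ?f C" by (simp only: distrib_right[symmetric])
    moreover have "(if n v = 0 then 0 else a gchoose (n v - 1)) * ?f C = ?g C" by (cases "n v = 0") (simp_all only: if_True if_False simp_thms mult_zero_left)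
    ultimately show ?thesis using True by (simp only: card.empty of_nat_0 add_0_right if_True simp_thms)
  next
    case False
    then have "card (C \<inter> K) = 1"
      using card_stable_clique_le_1[OF fK(1) C K(2)] fK(1) by (simp add: le_Suc_eq)
    then show ?thesis using False by (simp only: of_nat_1 if_False add_0_right)
  qed
  have "stable_count E W (Suc r) n = (\<Sum>C\<in>stable_sets E ?W. ((a + real (card (C \<inter> K))) gchoose n v) * ?f C)
     + (\<Sum>C\<in>stable_sets E (?W - {j. (v, j) \<in> E}). ?g C)"
    unfolding stable_count.simps sum_stable_sets[OF assms(1-4)]
    by (rule arg_cong2[of _ _ _ _ "(+)"]; rule sum.cong[OF refl]; erule first second)
  also have "(\<Sum>C\<in>stable_sets E (?W - {j. (v, j) \<in> E}). ?g C) =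
     (\<Sum>C\<in>stable_sets E ?W. if C \<inter> K = {} then ?g C else 0)"
    unfolding filter by (rule sum.inter_filter) (simp add: assms)
  also have "(\<Sum>C\<in>stable_sets E ?W. ((a + real (card (C \<inter> K))) gchoose n v) * ?f C) + \<dots> =
     (\<Sum>C\<in>stable_sets E ?W. ((a + 1) gchoose n v) * ?f C)"
    unfolding sum.distrib[symmetric] by (rule sum.cong[OF refl]) (rule pascal)
  also have "\<dots> = ((a + 1) gchoose n v) * stable_count E ?W (Suc r) n"
    by (simp add: sum_distrib_left)
  also have "a + 1 = real (Suc r) - real (\<Sum>i\<in>K. n i)" by (simp only: a_def of_nat_Suc)
  finally show ?case .
qed

text \<open>A sink of an ancestral set is simplicial in it, its neighbours being its parents.\<close>

lemma stable_count_eq_prod: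
  assumes "finite W" "sym E" "irrefl E" "moral_dag E D" "ancestral D W"
  shows "stable_count E W r n = (\<Prod>i\<in>W. (real r - real (\<Sum>j\<in>pa D i. n j)) gchoose n i)"
  using assms(1) moral_dagD(1)[OF assms(4)] assms(5)
proof (induction W rule: ancestral_induct)
  case empty
  have "stable_sets E {} = {{}}" by (auto simp: stable_sets_def)
  then show ?case by (induction r arbitrary: n) auto
next
  case (sink S v)
  have pa: "pa D v = {j \<in> S. (v, j) \<in> E}"
    using sink moral_dagD(4)[OF assms(4)] by (auto simp: ancestral_def pa_def)
  have "(i, j) \<in> E" if "i \<in> pa D v" "j \<in> pa D v" "i \<noteq> j" for i j
    using moral_dagD(5)[OF assms(4)] that by (auto simp: pa_def)
  then have "stable_count E S r n = ((real r - real (\<Sum>i\<in>pa D v. n i)) gchoose n v) * stable_count E (S - {v}) r n"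
    by (rule stable_count_simplicial[OF sink(1) assms(2,3) sink(3) pa])
  then show ?case using sink by (simp add: prod.remove[of S v])
qed

section \<open>Coefficients of powers of the clique polynomials\<close>

lemma lookup_mono_exp:
  "finite A \<Longrightarrow> Poly_Mapping.lookup (mono_exp A n) i = (if i \<in> A then n i else 0)"
  unfolding mono_exp_def lookup_sum lookup_single when_def by (simp add: sum.delta)

lemma mono_exp_eq_add_iff:
  assumes "finite W" "C \<subseteq> W"
  shows "mono_exp W n = mono_exp C (\<lambda>_. 1) + d \<longleftrightarrow>
    (\<forall>i\<in>C. 0 < n i) \<and> d = mono_exp W (lower C n)"
proof -
  have "finite C" using assms finite_subset by blast
  then have "mono_exp W n = mono_exp C (\<lambda>_. 1) + d \<longleftrightarrow>
     (\<forall>i. (if i \<in> W then n i else 0) = (if i \<in> C then 1 else 0) + Poly_Mapping.lookup d i)"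
    by (simp add: poly_mapping_eq_iff fun_eq_iff lookup_add lookup_mono_exp assms(1))
  also have "\<dots> \<longleftrightarrow> (\<forall>i\<in>C. 0 < n i) \<and>
     (\<forall>i. Poly_Mapping.lookup d i = (if i \<in> W then lower C n i else 0))"
    (is "(\<forall>i. ?P i) \<longleftrightarrow> ?Q \<and> (\<forall>i. ?R i)")
  proof -
    have "?P i \<longleftrightarrow> (i \<in> C \<longrightarrow> 0 < n i) \<and> ?R i" for i
      using assms(2) by (cases "i \<in> C"; cases "i \<in> W") (auto simp: lower_def)
    then show ?thesis by blast
  qed
  also have "(\<forall>i. Poly_Mapping.lookup d i = (if i \<in> W then lower C n i else 0)) \<longleftrightarrow>
      d = mono_exp W (lower C n)"
    by (simp add: poly_mapping_eq_iff fun_eq_iff lookup_mono_exp assms(1))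
  finally show ?thesis .
qed

lemma lookup_single_mult:
  fixes p :: "('v \<Rightarrow>\<^sub>0 nat) \<Rightarrow>\<^sub>0 real"
  shows "Poly_Mapping.lookup (Poly_Mapping.single a c * p) k =
    c * Sum_any (\<lambda>q. Poly_Mapping.lookup p q when k = a + q)"
  unfolding lookup_mult lookup_single by (simp add: when_mult)

text \<open>Multiplying by a polynomial whose monomials are squarefree lowers the exponents by one on
  each of their supports; this is the recursion of \<open>stable_count\<close>.\<close>

lemma lookup_stable_poly_mult:
  fixes Q :: "('v \<Rightarrow>\<^sub>0 nat) \<Rightarrow>\<^sub>0 real"
  assumes "finite W" "\<And>C. C \<in> \<S> \<Longrightarrow> C \<subseteq> W"
  shows "Poly_Mapping.lookup ((\<Sum>C\<in>\<S>. Poly_Mapping.single (mono_exp C (\<lambda>_. 1)) (c C)) * Q) (mono_exp W n)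
    = (\<Sum>C\<in>\<S>. if \<forall>i\<in>C. 0 < n i then c C * Poly_Mapping.lookup Q (mono_exp W (lower C n)) else 0)"
  unfolding sum_distrib_right lookup_sum
proof (rule sum.cong[OF refl])
  fix C assume "C \<in> \<S>"
  then have C: "C \<subseteq> W" using assms(2) by blast
  show "Poly_Mapping.lookup (Poly_Mapping.single (mono_exp C (\<lambda>_. 1)) (c C) * Q) (mono_exp W n) =
     (if \<forall>i\<in>C. 0 < n i then c C * Poly_Mapping.lookup Q (mono_exp W (lower C n)) else 0)"
    unfolding lookup_single_mult mono_exp_eq_add_iff[OF assms(1) C]
  proof (cases "\<forall>i\<in>C. 0 < n i")
    case False
    show "c C * Sum_any (\<lambda>q. Poly_Mapping.lookup Q q when (\<forall>i\<in>C. 0 < n i) \<and> q = mono_exp W (lower C n)) =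
     (if \<forall>i\<in>C. 0 < n i then c C * Poly_Mapping.lookup Q (mono_exp W (lower C n)) else 0)"
      by (simp only: False simp_thms when_simps Sum_any_eq_zero_iff finite.emptyI Collect_empty_eq mult_zero_right if_False) simp
  qed simp
qed

lemma mono_exp_eq_0_iff: "finite W \<Longrightarrow> mono_exp W n = 0 \<longleftrightarrow> (\<forall>i\<in>W. n i = 0)"
  by (auto simp: poly_mapping_eq_iff fun_eq_iff lookup_mono_exp)

lemma lookup_delta_poly_power:
  assumes "finite W" "irrefl E"
  shows "Poly_Mapping.lookup (delta_poly W (induced_edges E W) ^ r) (mono_exp W n) = stable_count E W r n"
proof (induction r arbitrary: n)
  case 0
  show ?case using assms by (simp add: lookup_one mono_exp_eq_0_iff when_def)
next
  case (Suc r)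
  have "Poly_Mapping.lookup (delta_poly W (induced_edges E W) ^ Suc r) (mono_exp W n) =
    (\<Sum>C\<in>stable_sets E W. if \<forall>i\<in>C. 0 < n i then 1 *
       Poly_Mapping.lookup (delta_poly W (induced_edges E W) ^ r) (mono_exp W (lower C n)) else 0)"
    unfolding power_Suc delta_poly_def[of W] cliques_compl_edges[OF assms(2)]
    by (rule lookup_stable_poly_mult) (use assms in \<open>auto simp: stable_sets_def\<close>)
  then show ?case unfolding Suc.IH mult_1 stable_count.simps .
qed

lemma lookup_Delta_poly_power:
  assumes "finite W" "irrefl E"
  shows "Poly_Mapping.lookup (Delta_poly W (induced_edges E W) ^ r) (mono_exp W n) =
    (-1) ^ (\<Sum>i\<in>W. n i) * stable_count E W r n"
proof (induction r arbitrary: n)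
  case 0
  show ?case using assms by (simp add: lookup_one mono_exp_eq_0_iff when_def)
next
  case (Suc r)
  have "Poly_Mapping.lookup (Delta_poly W (induced_edges E W) ^ Suc r) (mono_exp W n) =
    (\<Sum>C\<in>stable_sets E W. if \<forall>i\<in>C. 0 < n i then (-1) ^ card C *
       Poly_Mapping.lookup (Delta_poly W (induced_edges E W) ^ r) (mono_exp W (lower C n)) else 0)"
    unfolding power_Suc Delta_poly_def[of W] cliques_compl_edges[OF assms(2)]
    by (rule lookup_stable_poly_mult) (use assms in \<open>auto simp: stable_sets_def\<close>)
  also have "\<dots> = (\<Sum>C\<in>stable_sets E W. (-1) ^ (\<Sum>i\<in>W. n i) *
      (if \<forall>i\<in>C. 0 < n i then stable_count E W r (lower C n) else 0))"
  proof (rule sum.cong[OF refl])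
    fix C assume "C \<in> stable_sets E W"
    then have CW: "C \<inter> W = C" by (auto simp: stable_sets_def)
    show "(if \<forall>i\<in>C. 0 < n i then (-1) ^ card C *
        Poly_Mapping.lookup (Delta_poly W (induced_edges E W) ^ r) (mono_exp W (lower C n)) else 0) =
      (-1) ^ (\<Sum>i\<in>W. n i) * (if \<forall>i\<in>C. 0 < n i then stable_count E W r (lower C n) else 0)"
    proof (cases "\<forall>i\<in>C. 0 < n i")
      case True
      have e: "(\<Sum>i\<in>W. n i) = (\<Sum>i\<in>W. lower C n i) + card C"
        using sum_lower[OF assms(1) True] unfolding CW by simp
      show ?thesis unfolding if_P[OF True] Suc.IH e power_add by simp
    next
      case False
      show ?thesis unfolding if_not_P[OF False] by simp
    qed
  qed
  finally show ?case by (simp add: sum_distrib_left)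
qed

text \<open>Removing the constant term leaves only monomials of positive degree.\<close>

lemma lookup_Delta_poly_minus_1_power:
  assumes "finite W" "irrefl E" "(\<Sum>i\<in>W. n i) < k"
  shows "Poly_Mapping.lookup ((Delta_poly W (induced_edges E W) - 1) ^ k) (mono_exp W n) = 0"
  using assms(3)
proof (induction k arbitrary: n)
  case 0
  then show ?case by simp
next
  case (Suc k)
  let ?S = "stable_sets E W - {{}}"
  have "Delta_poly W (induced_edges E W) - 1 =
     (\<Sum>C\<in>?S. Poly_Mapping.single (mono_exp C (\<lambda>_. 1)) ((-1) ^ card C))"
    unfolding Delta_poly_def cliques_compl_edges[OF assms(2)]
    using assms(1) by (simp add: sum.remove[of "stable_sets E W" "{}"] mono_exp_def)
  then have "Poly_Mapping.lookup ((Delta_poly W (induced_edges E W) - 1) ^ Suc k) (mono_exp W n) =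
    (\<Sum>C\<in>?S. if \<forall>i\<in>C. 0 < n i then (-1) ^ card C *
       Poly_Mapping.lookup ((Delta_poly W (induced_edges E W) - 1) ^ k) (mono_exp W (lower C n)) else 0)"
    unfolding power_Suc using assms(1)
    by (simp only:) (rule lookup_stable_poly_mult, auto simp: stable_sets_def)
  also have "\<dots> = 0"
  proof (rule sum.neutral, rule ballI)
    fix C assume C: "C \<in> ?S"
    then have "C \<inter> W = C" "C \<noteq> {}" by (auto simp: stable_sets_def)
    moreover have "finite C" using C assms(1) by (auto intro: finite_in_stable_sets)
    ultimately have "card (C \<inter> W) > 0" by (simp add: card_gt_0_iff)
    then have "(\<Sum>i\<in>W. lower C n i) < k" if "\<forall>i\<in>C. 0 < n i"
      using sum_lower[OF assms(1) that] Suc.prems by linarith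
    then show "(if \<forall>i\<in>C. 0 < n i then (-1) ^ card C *
       Poly_Mapping.lookup ((Delta_poly W (induced_edges E W) - 1) ^ k) (mono_exp W (lower C n)) else 0) = 0"
      by (simp add: Suc.IH)
  qed
  finally show ?case .
qed

lemma lookup_of_nat_mult:
  fixes p :: "('v \<Rightarrow>\<^sub>0 nat) \<Rightarrow>\<^sub>0 real"
  shows "Poly_Mapping.lookup (of_nat m * p) k = of_nat m * Poly_Mapping.lookup p k"
  by (induction m) (simp_all add: distrib_right lookup_add)

text \<open>For \<open>r = -s\<close> the binomial series is the binomial theorem for \<open>((\<Delta> - 1) + 1)^s\<close>: its terms
  with \<open>k > s\<close> vanish by the binomial coefficient and those with \<open>k > |n|\<close> by the degree.\<close>

lemma nm_coeff_minus_nat: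
  assumes "finite W" "irrefl E"
  shows "nm_coeff W (induced_edges E W) (- real s) n = (-1) ^ (\<Sum>i\<in>W. n i) * stable_count E W s n"
proof -
  let ?N = "\<Sum>i\<in>W. n i" and ?D = "Delta_poly W (induced_edges E W)"
  let ?l = "\<lambda>k. Poly_Mapping.lookup ((?D - 1) ^ k) (mono_exp W n)"
  have "?D ^ s = ((?D - 1) + 1) ^ s" by simp
  also have "\<dots> = (\<Sum>k\<le>s. of_nat (s choose k) * (?D - 1) ^ k)"
    unfolding binomial_ring by simp
  finally have "Poly_Mapping.lookup (?D ^ s) (mono_exp W n) = (\<Sum>k\<le>s. of_nat (s choose k) * ?l k)"
    by (simp only: lookup_sum lookup_of_nat_mult)
  also have "\<dots> = (\<Sum>k\<le>max s ?N. of_nat (s choose k) * ?l k)"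
    by (rule sum.mono_neutral_left) auto
  also have "\<dots> = (\<Sum>k\<le>?N. of_nat (s choose k) * ?l k)"
    by (rule sum.mono_neutral_right) (auto simp: lookup_Delta_poly_minus_1_power[OF assms])
  also have "\<dots> = nm_coeff W (induced_edges E W) (- real s) n"
    by (simp add: nm_coeff_def binomial_gbinomial)
  finally show ?thesis using lookup_Delta_poly_power[OF assms] by simp
qed

lemma real_polynomial_function_gchoose_affine:
  "real_polynomial_function (\<lambda>x::real. (- x - c) gchoose k)"
  unfolding gbinomial_prod_rev
  by (intro real_polynomial_function_divide real_polynomial_function_prod
        real_polynomial_function_diff real_polynomial_function_minus
        real_polynomial_function.intros(1,2) bounded_linear_ident) auto

lemma real_polynomial_function_eqI:
  fixes f g :: "real \<Rightarrow> real"
  assumes "real_polynomial_function f" "real_polynomial_function g" "\<And>s::nat. f (- real s) = g (- real s)"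
  shows "f = g"
proof -
  obtain a n where an: "(\<lambda>x. f x - g x) = (\<lambda>x. \<Sum>i\<le>n::nat. a i * x ^ i)"
    using real_polynomial_function_imp_sum[OF real_polynomial_function_diff[OF assms(1,2)]] by blast
  have "range (\<lambda>s::nat. - real s) \<subseteq> {x. (\<Sum>i\<le>n. a i * x ^ i) = 0}"
    using assms(3) fun_cong[OF an, symmetric] by auto
  moreover have "infinite (range (\<lambda>s::nat. - real s))"
    by (rule range_inj_infinite) (simp add: inj_def)
  ultimately have "\<not> finite {x. (\<Sum>i\<le>n. a i * x ^ i) = 0}" using finite_subset by blast
  then have "\<forall>i\<le>n. a i = 0" using polyfun_finite_roots[of a n] by blast
  then have "f x - g x = 0" for x using fun_cong[OF an, of x] by simp
  then show ?thesis by (simp add: fun_eq_iff)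
qed

text \<open>Both sides are polynomials in \<open>r\<close>, so it suffices to compare them at the negative
  integers, where the left-hand side counts tuples of stable sets up to sign.\<close>

lemma nm_coeff_eq_prod:
  assumes "finite W" "sym E" "irrefl E" "moral_dag E D" "ancestral D W"
  shows "nm_coeff W (induced_edges E W) r n =
    (\<Prod>i\<in>W. (-1) ^ n i * ((- r - real (\<Sum>j\<in>pa D i. n j)) gchoose n i))"
proof -
  have "(\<lambda>r. nm_coeff W (induced_edges E W) r n) =
    (\<lambda>r. \<Prod>i\<in>W. (-1) ^ n i * ((- r - real (\<Sum>j\<in>pa D i. n j)) gchoose n i))"
  proof (rule real_polynomial_function_eqI)
    have "real_polynomial_function (\<lambda>x::real. (- x) gchoose k)" for k
      using real_polynomial_function_gchoose_affine[of 0 k] by simp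
    then show "real_polynomial_function (\<lambda>r. nm_coeff W (induced_edges E W) r n)"
      unfolding nm_coeff_def
      by (intro real_polynomial_function_sum real_polynomial_function.intros(2,4)) auto
    show "real_polynomial_function (\<lambda>r. \<Prod>i\<in>W. (-1) ^ n i * ((- r - real (\<Sum>j\<in>pa D i. n j)) gchoose n i))"
      by (intro real_polynomial_function_prod real_polynomial_function.intros(2,4)
          real_polynomial_function_gchoose_affine assms)
    show "nm_coeff W (induced_edges E W) (- real s) n =
       (\<Prod>i\<in>W. (-1) ^ n i * ((- (- real s) - real (\<Sum>j\<in>pa D i. n j)) gchoose n i))" for s
      unfolding nm_coeff_minus_nat[OF assms(1,3)] stable_count_eq_prod[OF assms] prod.distrib
      by (simp add: power_sum)
  qed
  then show ?thesis by (rule fun_cong)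
qed

section \<open>Clique polynomials as products along a moral DAG\<close>

lemma Delta_on_eq: "irrefl E \<Longrightarrow> Delta_on E A x = (\<Sum>C\<in>stable_sets E A. (-1) ^ card C * (\<Prod>i\<in>C. x i))"
  by (simp add: Delta_on_def Delta_def cliques_compl_edges)

lemma Delta_on_empty [simp]: "irrefl E \<Longrightarrow> Delta_on E {} x = 1"
proof -
  have "stable_sets E {} = {{}}" by (auto simp: stable_sets_def)
  then show "irrefl E \<Longrightarrow> Delta_on E {} x = 1" by (simp add: Delta_on_eq)
qed

lemma delta_on_eq_Delta_on:
  assumes "irrefl E" "finite A"
  shows "delta_on E A y = Delta_on E A (\<lambda>i. - y i)"
  unfolding Delta_on_eq[OF assms(1)] delta_on_def delta_def cliques_compl_edges[OF assms(1)]
proof (rule sum.cong[OF refl])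
  fix C assume "C \<in> stable_sets E A"
  show "prod y C = (-1) ^ card C * (\<Prod>i\<in>C. - y i)"
    unfolding prod_uminus mult.assoc[symmetric] power_mult_distrib[symmetric] by simp
qed

lemma delta_on_pos:
  assumes "irrefl E" "finite A" "\<And>i. i \<in> A \<Longrightarrow> 0 < y i"
  shows "0 < delta_on E A y"
  unfolding delta_on_def delta_def cliques_compl_edges[OF assms(1)]
proof (rule sum_pos)
  show "0 < prod y C" if "C \<in> stable_sets E A" for C
    using that assms(3) by (auto simp: stable_sets_def intro!: prod_pos)
  show "stable_sets E A \<noteq> {}" using empty_in_stable_sets by blast
qed (simp add: assms(2))

lemma w_map_eq_u_map:
  assumes "irrefl E" "finite (de D i)"
  shows "w_map E D y i = - u_map E D (\<lambda>i. - y i) i"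
  using assms(2) by (simp add: w_map_def u_map_def delta_on_eq_Delta_on[OF assms(1)] de_bar_def)

lemma Delta_on_remove:
  assumes "finite A" "sym E" "irrefl E" "v \<in> A"
  shows "Delta_on E A x = Delta_on E (A - {v}) x - x v * Delta_on E (A - {v} - {j. (v, j) \<in> E}) x"
proof -
  let ?B = "stable_sets E (A - {v} - {j. (v, j) \<in> E})"
  have "(\<Sum>C\<in>?B. (-1) ^ card (insert v C) * prod x (insert v C)) =
      (\<Sum>C\<in>?B. - x v * ((-1) ^ card C * prod x C))"
  proof (rule sum.cong[OF refl])
    fix C assume C: "C \<in> ?B"
    then have "finite C" "v \<notin> C"
      using assms(1) by (auto simp: stable_sets_def intro: finite_subset)
    then show "(-1) ^ card (insert v C) * prod x (insert v C) = - x v * ((-1) ^ card C * prod x C)"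
      by simp
  qed
  then show ?thesis
    unfolding Delta_on_eq[OF assms(3)] sum_stable_sets[OF assms] by (simp add: sum_distrib_left sum_negf)
qed

text \<open>The stable sets that contain \<open>i\<close> live on \<open>A\<close> without \<open>i\<close> and its children. By morality a
  parent in \<open>A\<close> of a child of the source \<open>i\<close> is again a child of \<open>i\<close>, so this set is closed
  under descendants, and the ratio of its polynomial to that of \<open>A - {i}\<close> involves only the
  children of \<open>i\<close>. The factor that is split off is therefore the same for every \<open>A\<close>, in
  particular for \<open>i\<close> and its descendants, which is where \<open>u_map\<close> is defined.\<close>

lemma Delta_on_source:
  fixes E :: "('v \<times> 'v) set"
  assumes "finite A" "sym E" "irrefl E" "moral_dag E D" and A: "ancestral (D\<inverse>) A"
    and i: "i \<in> A" "\<forall>j\<in>A. (j, i) \<notin> D"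
    and IH: "\<And>B. ancestral (D\<inverse>) B \<Longrightarrow> B \<subset> A \<Longrightarrow> Delta_on E B x = (\<Prod>j\<in>B. 1 - u j)"
    and nz: "\<And>B. B \<subseteq> A \<Longrightarrow> Delta_on E B x \<noteq> 0"
  shows "Delta_on E A x = Delta_on E (A - {i}) x * (1 - x i / (\<Prod>j\<in>pa (D\<inverse>) i. 1 - u j))"
proof -
  note E_iff = moral_dagD(4)[OF assms(4)]
  let ?ch = "pa (D\<inverse>) i"
  have ch: "?ch \<subseteq> A - {i}"
    using A i assms(3) E_iff by (auto simp: ancestral_def pa_def irrefl_def)
  have A1: "ancestral (D\<inverse>) (A - {i})" using A i by (auto simp: ancestral_def pa_def)
  have A2: "ancestral (D\<inverse>) (A - {i} - ?ch)"
    unfolding ancestral_def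
  proof (intro ballI subsetI)
    fix k c assume k: "k \<in> A - {i} - ?ch" and "c \<in> pa (D\<inverse>) k"
    then have kc: "(k, c) \<in> D" by (simp add: pa_def)
    have "c \<in> A" using A k kc by (auto simp: ancestral_def pa_def)
    moreover have "c \<noteq> i" using i(2) k kc by auto
    moreover have "(i, c) \<notin> D"
    proof
      assume "(i, c) \<in> D"
      then have "(i, k) \<in> E" using moral_dagD(5)[OF assms(4) _ kc] k by auto
      then show False using k i E_iff by (auto simp: pa_def)
    qed
    ultimately show "c \<in> A - {i} - ?ch" by (simp add: pa_def)
  qed
  have N: "A - {i} - {j. (i, j) \<in> E} = A - {i} - ?ch"
    using E_iff i by (auto simp: pa_def)
  have e1: "Delta_on E (A - {i}) x = (\<Prod>j\<in>A - {i}. 1 - u j)"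
    using IH[OF A1] i(1) by blast
  have e2: "Delta_on E (A - {i} - ?ch) x = (\<Prod>j\<in>A - {i} - ?ch. 1 - u j)"
    using IH[OF A2] i(1) by blast
  have split: "(\<Prod>j\<in>A - {i}. 1 - u j) = (\<Prod>j\<in>A - {i} - ?ch. 1 - u j) * (\<Prod>j\<in>?ch. 1 - u j)"
    using prod.subset_diff[OF ch] assms(1) by blast
  have "(\<Prod>j\<in>A - {i}. 1 - u j) \<noteq> 0" using nz[of "A - {i}"] e1 by auto
  then have "(\<Prod>j\<in>?ch. 1 - u j) \<noteq> 0" unfolding split by simp
  then show ?thesis
    unfolding Delta_on_remove[OF assms(1-3) i(1)] N e1 e2 split by (simp add: field_simps)
qed

lemma ancestral_de_bar: "ancestral (D\<inverse>) (de_bar D i)" "ancestral (D\<inverse>) (de D i)"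
  by (auto simp: ancestral_def de_bar_def de_def pa_def intro: trancl_into_trancl)

lemma de_bar_subset: "ancestral (D\<inverse>) A \<Longrightarrow> i \<in> A \<Longrightarrow> de_bar D i \<subseteq> A"
proof -
  assume A: "ancestral (D\<inverse>) A" "i \<in> A"
  have "j \<in> A" if "(i, j) \<in> D\<^sup>+" for j
    using that by (induction rule: trancl_induct) (use A in \<open>auto simp: ancestral_def pa_def\<close>)
  then show ?thesis using A by (auto simp: de_bar_def de_def)
qed

text \<open>The preceding computation for the set of \<open>i\<close> and its descendants.\<close>

lemma u_map_eq:
  fixes E :: "('v \<times> 'v) set"
  assumes "finite A" "sym E" "irrefl E" "moral_dag E D" "ancestral (D\<inverse>) A" "i \<in> A"
    and IH: "\<And>B. ancestral (D\<inverse>) B \<Longrightarrow> B \<subset> de_bar D i \<Longrightarrow> Delta_on E B x = (\<Prod>j\<in>B. 1 - u_map E D x j)"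
    and nz: "\<And>B. B \<subseteq> A \<Longrightarrow> Delta_on E B x \<noteq> 0"
  shows "u_map E D x i = x i / (\<Prod>j\<in>pa (D\<inverse>) i. 1 - u_map E D x j)"
proof -
  have sub: "de_bar D i \<subseteq> A" by (rule de_bar_subset) fact+
  have ac: "(i, i) \<notin> D\<^sup>+" using moral_dagD(1)[OF assms(4)] by (simp add: acyclic_def)
  then have minus: "de_bar D i - {i} = de D i" by (auto simp: de_bar_def de_def)
  have "Delta_on E (de_bar D i) x = Delta_on E (de_bar D i - {i}) x * (1 - x i / (\<Prod>j\<in>pa (D\<inverse>) i. 1 - u_map E D x j))"
  proof (rule Delta_on_source[OF _ assms(2-4) ancestral_de_bar(1)])
    show "\<forall>j\<in>de_bar D i. (j, i) \<notin> D"
      using ac by (auto simp: de_bar_def de_def intro: trancl_into_trancl)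
    show "Delta_on E B x \<noteq> 0" if "B \<subseteq> de_bar D i" for B
      using nz[of B] that sub by blast
    show "finite (de_bar D i)" using sub assms(1) finite_subset by blast
  qed (use IH in \<open>auto simp: de_bar_def\<close>)
  moreover have "Delta_on E (de D i) x \<noteq> 0" using nz[of "de D i"] sub by (auto simp: de_bar_def)
  ultimately show ?thesis unfolding minus u_map_def by simp
qed

text \<open>Removing sources one at a time.\<close>

lemma Delta_on_eq_prod:
  fixes E :: "('v \<times> 'v) set"
  assumes "finite A" "sym E" "irrefl E" "moral_dag E D" "ancestral (D\<inverse>) A"
    and nz: "\<And>B. B \<subseteq> A \<Longrightarrow> Delta_on E B x \<noteq> 0"
  shows "Delta_on E A x = (\<Prod>i\<in>A. 1 - u_map E D x i)"
  using assms(1,5) nz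
proof (induction A rule: finite_psubset_induct)
  case (psubset A)
  have IH: "Delta_on E B x = (\<Prod>j\<in>B. 1 - u_map E D x j)" if "ancestral (D\<inverse>) B" "B \<subset> A" for B
    using psubset.IH[OF that(2,1)] psubset.prems(2) that(2) by blast
  show ?case
  proof (cases "A = {}")
    case False
    then obtain i where i: "i \<in> A" "\<forall>j\<in>A. (j, i) \<notin> D"
      using ex_source[OF psubset.hyps False moral_dagD(1)[OF assms(4)]] by blast
    have "Delta_on E A x = Delta_on E (A - {i}) x * (1 - x i / (\<Prod>j\<in>pa (D\<inverse>) i. 1 - u_map E D x j))"
      by (rule Delta_on_source[OF psubset.hyps assms(2-4) psubset.prems(1) i])
        (use IH psubset.prems in auto)
    also have "x i / (\<Prod>j\<in>pa (D\<inverse>) i. 1 - u_map E D x j) = u_map E D x i"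
      by (rule u_map_eq[symmetric, OF psubset.hyps assms(2-4) psubset.prems(1) i(1)])
        (use IH psubset.prems de_bar_subset[OF psubset.prems(1) i(1)] in auto)
    also have "Delta_on E (A - {i}) x = (\<Prod>j\<in>A - {i}. 1 - u_map E D x j)"
      by (rule IH) (use psubset.prems(1) i in \<open>auto simp: ancestral_def pa_def\<close>)
    finally show ?thesis using i psubset.hyps by (simp add: prod.remove[of A i])
  qed (simp add: assms)
qed

section \<open>Factorization of the two laws\<close>

text \<open>For \<open>r > 0\<close> the negative binomial weight at \<open>k\<close> of size \<open>r + m\<close> and success parameter
  \<open>u\<close>. For \<open>r = -s\<close> and \<open>u = -t\<close> it is the binomial weight at \<open>k\<close> with \<open>s - m\<close> trials and odds
  \<open>t\<close>, provided \<open>m \<le> s\<close>.\<close>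

definition nb_term :: "real \<Rightarrow> nat \<Rightarrow> nat \<Rightarrow> real \<Rightarrow> real" where
  "nb_term r k m u = (-1) ^ k * ((- r - real m) gchoose k) * u ^ k * (1 - u) powr (r + real m)"

lemma u_map_less_1:
  assumes "Delta_on E (de D i) x > 0" "Delta_on E (de_bar D i) x > 0"
  shows "u_map E D x i < 1"
  using assms by (simp add: u_map_def)

lemma u_map_parametrization:
  fixes E :: "('v \<times> 'v) set"
  assumes G: "simple_graph V E" and D: "moral_dag E D"
    and pos: "\<And>A. A \<subseteq> V \<Longrightarrow> 0 < Delta_on E A x"
  shows "i \<in> V \<Longrightarrow> u_map E D x i < 1"
    and "i \<in> V \<Longrightarrow> x i = u_map E D x i * (\<Prod>j\<in>pa (D\<inverse>) i. 1 - u_map E D x j)"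
    and "i \<in> V \<Longrightarrow> 0 < x i \<Longrightarrow> 0 < u_map E D x i"
    and "Delta_on E V x = (\<Prod>i\<in>V. 1 - u_map E D x i)"
proof -
  have fin: "finite V" and sym: "sym E" and irr: "irrefl E" and EV: "E \<subseteq> V \<times> V"
    using G by (auto simp: simple_graph_def)
  have anc: "ancestral (D\<inverse>) V"
    using EV moral_dagD(2)[OF D] by (auto simp: ancestral_def pa_def)
  have nz: "Delta_on E B x \<noteq> 0" if "B \<subseteq> V" for B using pos[OF that] by simp
  let ?u = "u_map E D x"
  have sub: "de_bar D i \<subseteq> V" "de D i \<subseteq> V" if "i \<in> V" for i
    using de_bar_subset[OF anc that] by (auto simp: de_bar_def)
  show u1: "?u i < 1" if "i \<in> V" for i
    using u_map_less_1[OF pos pos] sub[OF that] by simp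
  have Delta: "Delta_on E B x = (\<Prod>j\<in>B. 1 - ?u j)" if "ancestral (D\<inverse>) B" "B \<subseteq> V" for B
    by (rule Delta_on_eq_prod[OF finite_subset[OF that(2) fin] sym irr D that(1)])
      (use nz that in auto)
  then show "Delta_on E V x = (\<Prod>i\<in>V. 1 - ?u i)" using anc by blast
  have prod_pos: "(\<Prod>j\<in>pa (D\<inverse>) i. 1 - ?u j) > 0" if "i \<in> V" for i
    using anc that u1 by (intro prod_pos) (auto simp: ancestral_def)
  show x: "x i = ?u i * (\<Prod>j\<in>pa (D\<inverse>) i. 1 - ?u j)" if i: "i \<in> V" for i
  proof -
    have "?u i = x i / (\<Prod>j\<in>pa (D\<inverse>) i. 1 - ?u j)"
      by (rule u_map_eq[OF fin sym irr D anc i]) (use Delta sub(1)[OF i] nz in auto)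
    then show ?thesis using prod_pos[OF i] by simp
  qed
  show "0 < ?u i" if "i \<in> V" "0 < x i"
    using x[OF that(1)] that(2) prod_pos[OF that(1)] zero_less_mult_pos2 by metis
qed

text \<open>In the monomial \<open>x^n\<close> each factor \<open>x i\<close> contributes a factor \<open>1 - u j\<close> for every child
  \<open>j\<close> of \<open>i\<close>; collecting them at \<open>j\<close> raises \<open>1 - u j\<close> to the sum of the counts at the parents of
  \<open>j\<close>.\<close>

lemma nm_mass_eq_prod:
  fixes E :: "('v \<times> 'v) set"
  assumes G: "simple_graph V E" and D: "moral_dag E D"
    and pos: "\<And>A. A \<subseteq> V \<Longrightarrow> 0 < Delta_on E A x"
  shows "nm_mass V E r x n = (\<Prod>i\<in>V. nb_term r (n i) (\<Sum>j\<in>pa D i. n j) (u_map E D x i))"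
proof -
  have fin: "finite V" and sym: "sym E" and irr: "irrefl E" and EV: "E \<subseteq> V \<times> V"
    using G by (auto simp: simple_graph_def)
  have ind: "induced_edges E V = E" using EV by (auto simp: induced_edges_def)
  have DV: "D \<subseteq> V \<times> V" using EV moral_dagD(2)[OF D] by auto
  have anc: "ancestral D V" using DV by (auto simp: ancestral_def pa_def)
  let ?u = "u_map E D x"
  have u1: "0 < 1 - ?u i" if "i \<in> V" for i
    using u_map_parametrization(1)[OF G D, of x i] pos that by simp
  have x: "x i = ?u i * (\<Prod>j\<in>pa (D\<inverse>) i. 1 - ?u j)" if "i \<in> V" for i
    by (rule u_map_parametrization(2)[OF G D]) (use pos that in auto)
  have "(\<Prod>i\<in>V. x i ^ n i) = (\<Prod>i\<in>V. ?u i ^ n i) * (\<Prod>i\<in>V. \<Prod>j\<in>pa (D\<inverse>) i. (1 - ?u j) ^ n i)"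
    unfolding prod.distrib[symmetric]
    by (rule prod.cong[OF refl], subst x) (simp_all add: power_mult_distrib prod_power_distrib)
  also have "(\<Prod>i\<in>V. \<Prod>j\<in>pa (D\<inverse>) i. (1 - ?u j) ^ n i) =
      (\<Prod>i\<in>V. \<Prod>j\<in>{j. j \<in> V \<and> (i, j) \<in> D}. (1 - ?u j) ^ n i)"
    by (intro prod.cong refl) (use DV in \<open>auto simp: pa_def\<close>)
  also have "\<dots> = (\<Prod>j\<in>V. \<Prod>i\<in>{i. i \<in> V \<and> (i, j) \<in> D}. (1 - ?u j) ^ n i)"
    by (rule prod.swap_restrict[OF fin fin])
  also have "\<dots> = (\<Prod>j\<in>V. (1 - ?u j) ^ (\<Sum>i\<in>pa D j. n i))"
    unfolding power_sum by (intro prod.cong refl) (use DV in \<open>auto simp: pa_def\<close>)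
  finally have mono: "(\<Prod>i\<in>V. x i ^ n i) =
      (\<Prod>i\<in>V. ?u i ^ n i) * (\<Prod>i\<in>V. (1 - ?u i) ^ (\<Sum>j\<in>pa D i. n j))" .
  have "Delta V E x = Delta_on E V x" by (simp add: Delta_on_def ind)
  then have pw: "Delta V E x powr r = (\<Prod>i\<in>V. (1 - ?u i) powr r)"
    using u_map_parametrization(4)[OF G D, of x] pos prod_powr_distrib[of "\<lambda>i. 1 - ?u i" V r] by simp
  show ?thesis
    unfolding nm_mass_def mono pw nm_coeff_eq_prod[OF fin sym irr D anc, unfolded ind]
      prod.distrib[symmetric]
    by (rule prod.cong[OF refl])
      (use u1 in \<open>simp add: nb_term_def powr_add powr_realpow del: of_nat_sum\<close>)
qed

text \<open>The last parent \<open>j\<close> of \<open>v\<close> has all the other parents of \<open>v\<close> among its own parents. So if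
  the parents of \<open>v\<close> carry more than \<open>s\<close>, then so does \<open>j\<close> with its parents, and going back
  along the DAG leads to a vertex \<open>k\<close> at which the bound \<open>s\<close> is exceeded for the first time. The
  binomial factor of \<open>k\<close> is then zero.\<close>

lemma overloaded_parents:
  fixes n :: "'v \<Rightarrow> nat"
  assumes "finite V" "D \<subseteq> V \<times> V" "moral_dag E D" "s < (\<Sum>j\<in>pa D v. n j)"
  shows "\<exists>k. (k, v) \<in> D\<^sup>+ \<and> (\<Sum>j\<in>pa D k. n j) \<le> s \<and> s < (\<Sum>j\<in>pa D k. n j) + n k"
proof -
  have "finite D" using assms(1,2) finite_subset by blast
  then have "wf D" using moral_dagD(1)[OF assms(3)] by (simp add: finite_acyclic_wf)
  then show ?thesis using assms(4)
  proof (induction v rule: wf_induct_rule)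
    case (less v)
    have fin: "finite (pa D j)" for j
      by (rule finite_subset[OF _ assms(1)]) (use assms(2) in \<open>auto simp: pa_def\<close>)
    have "pa D v \<noteq> {}" using less.prems by auto
    then obtain j where j: "j \<in> pa D v" "\<forall>i\<in>pa D v. (j, i) \<notin> D"
      using ex_sink[OF fin _ moral_dagD(1)[OF assms(3)]] by blast
    have "pa D v \<subseteq> insert j (pa D j)"
    proof
      fix i assume i: "i \<in> pa D v"
      show "i \<in> insert j (pa D j)"
      proof (cases "i = j")
        case False
        have "(i, v) \<in> D" "(j, v) \<in> D" using i j by (auto simp: pa_def)
        then have "(i, j) \<in> E" using moral_dagD(5)[OF assms(3)] False by blast
        moreover have "(j, i) \<notin> D" using i j by blast
        ultimately show ?thesis using moral_dagD(4)[OF assms(3)] by (simp add: pa_def)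
      qed simp
    qed
    then have "(\<Sum>i\<in>pa D v. n i) \<le> (\<Sum>i\<in>insert j (pa D j). n i)"
      using fin by (intro sum_mono2) auto
    also have "\<dots> \<le> (\<Sum>i\<in>pa D j. n i) + n j" using fin by (simp add: sum.insert_if)
    finally have le: "s < (\<Sum>i\<in>pa D j. n i) + n j" using less.prems by simp
    have jv: "(j, v) \<in> D" using j by (simp add: pa_def)
    show ?case
    proof (cases "(\<Sum>i\<in>pa D j. n i) \<le> s")
      case True
      then show ?thesis using le jv by blast
    next
      case False
      then show ?thesis using less.IH[OF jv] jv by (meson not_le trancl_into_trancl)
    qed
  qed
qed

text \<open>The same argument, started at the last vertex of a clique.\<close>

lemma overloaded_clique:
  fixes n :: "'v \<Rightarrow> nat"
  assumes "finite V" "D \<subseteq> V \<times> V" "moral_dag E D" "K \<in> cliques V E" "s < (\<Sum>j\<in>K. n j)"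
  shows "\<exists>k\<in>V. (\<Sum>j\<in>pa D k. n j) \<le> s \<and> s < (\<Sum>j\<in>pa D k. n j) + n k"
proof -
  have fin: "finite (pa D j)" for j
    by (rule finite_subset[OF _ assms(1)]) (use assms(2) in \<open>auto simp: pa_def\<close>)
  have K: "K \<subseteq> V" "finite K" using assms(1,4) by (auto simp: cliques_def intro: finite_subset)
  have "K \<noteq> {}" using assms(5) by auto
  then obtain j where j: "j \<in> K" "\<forall>i\<in>K. (j, i) \<notin> D"
    using ex_sink[OF K(2) _ moral_dagD(1)[OF assms(3)]] by blast
  have "K \<subseteq> insert j (pa D j)"
    using j assms(4) moral_dagD(4)[OF assms(3)] by (auto simp: pa_def cliques_def)
  then have "(\<Sum>i\<in>K. n i) \<le> (\<Sum>i\<in>insert j (pa D j). n i)"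
    using fin by (intro sum_mono2) auto
  also have "\<dots> \<le> (\<Sum>i\<in>pa D j. n i) + n j" using fin by (simp add: sum.insert_if)
  finally have le: "s < (\<Sum>i\<in>pa D j. n i) + n j" using assms(5) by simp
  show ?thesis
  proof (cases "(\<Sum>i\<in>pa D j. n i) \<le> s")
    case True
    then show ?thesis using le j K by blast
  next
    case False
    then obtain k where k: "(k, j) \<in> D\<^sup>+" "(\<Sum>j\<in>pa D k. n j) \<le> s" "s < (\<Sum>j\<in>pa D k. n j) + n k"
      using overloaded_parents[OF assms(1-3)] by (metis not_le)
    have "k \<in> V" using k(1) assms(2) by (meson SigmaD1 subsetD tranclD)
    then show ?thesis using k by blast
  qed
qed

lemma nb_term_overloaded:
  assumes "m \<le> s" "s < m + k"
  shows "nb_term (- real s) k m u = 0"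
proof -
  have "(real s - real m) gchoose k = real ((s - m) choose k)"
    using assms by (simp add: binomial_gbinomial of_nat_diff)
  then show ?thesis using assms by (simp add: nb_term_def binomial_eq_0)
qed

text \<open>The multinomial mass is the negative multinomial formula at \<open>-s\<close> and \<open>-y\<close>. Outside the
  support some clique carries more than \<open>s\<close>, and then one of the factors vanishes.\<close>

lemma mult_mass_eq_prod:
  fixes E :: "('v \<times> 'v) set"
  assumes G: "simple_graph V E" and D: "moral_dag E D" and pos: "\<And>i. i \<in> V \<Longrightarrow> 0 < y i"
    and n: "n \<in> V \<rightarrow>\<^sub>E UNIV"
  shows "mult_mass V E s y n = (\<Prod>i\<in>V. nb_term (- real s) (n i) (\<Sum>j\<in>pa D i. n j) (- w_map E D y i))"
proof -
  have fin: "finite V" and sym: "sym E" and irr: "irrefl E" and EV: "E \<subseteq> V \<times> V"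
    using G by (auto simp: simple_graph_def)
  have ind: "induced_edges E V = E" using EV by (auto simp: induced_edges_def)
  have DV: "D \<subseteq> V \<times> V" using EV moral_dagD(2)[OF D] by auto
  have anc: "ancestral D V" "ancestral (D\<inverse>) V" using DV by (auto simp: ancestral_def pa_def)
  let ?x = "\<lambda>i. - y i"
  have wu: "- w_map E D y i = u_map E D ?x i" if "i \<in> V" for i
  proof -
    have "finite (de D i)"
      using de_bar_subset[OF anc(2) that] fin by (auto simp: de_bar_def intro: finite_subset)
    then show ?thesis using w_map_eq_u_map[OF irr] by simp
  qed
  have Dpos: "0 < Delta_on E A ?x" if "A \<subseteq> V" for A
    using delta_on_pos[OF irr finite_subset[OF that fin]] delta_on_eq_Delta_on[OF irr finite_subset[OF that fin]]
      pos that by (metis subsetD)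
  have nm: "nm_mass V E (- real s) ?x n =
      (\<Prod>i\<in>V. nb_term (- real s) (n i) (\<Sum>j\<in>pa D i. n j) (- w_map E D y i))"
  proof -
    have "nm_mass V E (- real s) ?x n =
        (\<Prod>i\<in>V. nb_term (- real s) (n i) (\<Sum>j\<in>pa D i. n j) (u_map E D ?x i))"
      by (rule nm_mass_eq_prod[OF G D]) (rule Dpos)
    also have "\<dots> = (\<Prod>i\<in>V. nb_term (- real s) (n i) (\<Sum>j\<in>pa D i. n j) (- w_map E D y i))"
      by (intro prod.cong refl) (simp add: wu)
    finally show ?thesis .
  qed
  have mono: "(\<Prod>i\<in>V. ?x i ^ n i) = (-1) ^ (\<Sum>i\<in>V. n i) * (\<Prod>i\<in>V. y i ^ n i)"
    unfolding power_sum prod.distrib[symmetric] by (intro prod.cong refl) (simp flip: power_mult_distrib)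
  have delta: "delta V E y = Delta V E ?x"
    using delta_on_eq_Delta_on[OF irr fin, of y] by (simp add: delta_on_def Delta_on_def ind)
  have "0 < Delta V E ?x" using Dpos[of V] by (simp add: Delta_on_def ind)
  then have pw: "Delta V E ?x powr (- real s) = inverse (delta V E y ^ s)"
    by (simp add: delta powr_minus powr_realpow)
  have coeff: "nm_coeff V E (- real s) n = (-1) ^ (\<Sum>i\<in>V. n i) * mult_coeff V E s n"
    using nm_coeff_minus_nat[OF fin irr, of s n] lookup_delta_poly_power[OF fin irr, of s n]
    by (simp add: mult_coeff_def ind)
  have formula: "nm_mass V E (- real s) ?x n = mult_coeff V E s n * (\<Prod>i\<in>V. y i ^ n i) / delta V E y ^ s"
    unfolding nm_mass_def coeff mono pw by (simp add: divide_inverse flip: power_add mult.assoc power_mult_distrib)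
  show ?thesis
  proof (cases "n \<in> mult_support V E s")
    case True
    then show ?thesis using nm formula by (simp add: mult_mass_def)
  next
    case False
    have fmc: "finite (max_cliques V E)"
      by (rule finite_subset[of _ "Pow V"]) (use fin in \<open>auto simp: max_cliques_def cliques_def\<close>)
    have fc: "finite (cliques V E)"
      by (rule finite_subset[of _ "Pow V"]) (use fin in \<open>auto simp: cliques_def\<close>)
    have "{} \<in> cliques V E" by (auto simp: cliques_def)
    then obtain C where "C \<in> cliques V E" "\<forall>C'\<in>cliques V E. C \<subseteq> C' \<longrightarrow> C = C'"
      using finite_has_maximal[OF fc] by blast
    then have "max_cliques V E \<noteq> {}" by (auto simp: max_cliques_def)
    then have "Max ((\<lambda>C. \<Sum>i\<in>C. n i) ` max_cliques V E) \<in> (\<lambda>C. \<Sum>i\<in>C. n i) ` max_cliques V E"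
      using fmc by (intro Max_in) auto
    moreover have "s < Max ((\<lambda>C. \<Sum>i\<in>C. n i) ` max_cliques V E)"
      using False n by (auto simp: mult_support_def)
    ultimately obtain K where "K \<in> cliques V E" "s < (\<Sum>i\<in>K. n i)"
      by (auto simp: max_cliques_def)
    then obtain k where "k \<in> V" "(\<Sum>j\<in>pa D k. n j) \<le> s" "s < (\<Sum>j\<in>pa D k. n j) + n k"
      using overloaded_clique[OF fin DV D] by blast
    then have "(\<Prod>i\<in>V. nb_term (- real s) (n i) (\<Sum>j\<in>pa D i. n j) (- w_map E D y i)) = 0"
      using fin nb_term_overloaded[of "\<Sum>j\<in>pa D k. n j" s "n k"] by (intro prod_zero) auto
    then show ?thesis using False by (simp add: mult_mass_def)
  qed
qed

lemma nb_term_sums: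
  assumes "\<bar>u\<bar> < 1"
  shows "(\<lambda>k. nb_term r k m u) sums 1"
proof -
  have "(\<lambda>k. ((- r - real m) gchoose k) * (- u) ^ k * (1 - u) powr (r + real m)) sums
     ((1 + - u) powr (- r - real m) * (1 - u) powr (r + real m))"
    using assms by (intro sums_mult2 gen_binomial_real) simp
  moreover have "(1 + - u) powr (- r - real m) * (1 - u) powr (r + real m) = 1"
    using assms by (simp flip: powr_add)
  moreover have "((- r - real m) gchoose k) * (- u) ^ k * (1 - u) powr (r + real m) = nb_term r k m u" for k
    unfolding nb_term_def by (subst power_minus) simp
  ultimately show ?thesis by simp
qed

lemma nb_term_nat_sums:
  assumes "u < 1" "m \<le> s"
  shows "(\<lambda>k. nb_term (- real s) k m u) sums 1"
proof -
  have "(\<lambda>k. nb_term (- real s) k m u) sums (\<Sum>k\<le>s - m. nb_term (- real s) k m u)"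
    by (rule sums_finite) (use assms nb_term_overloaded in auto)
  also have "(\<Sum>k\<le>s - m. nb_term (- real s) k m u) =
     (\<Sum>k\<le>s - m. of_nat ((s - m) choose k) * (- u) ^ k * 1 ^ (s - m - k)) * (1 - u) powr (- real (s - m))"
    unfolding sum_distrib_right
    by (rule sum.cong[OF refl], subst power_minus)
      (use assms in \<open>simp add: nb_term_def binomial_gbinomial of_nat_diff\<close>)
  also have "\<dots> = 1"
    unfolding binomial_ring[symmetric] using assms by (simp add: powr_minus powr_realpow del: of_nat_diff)
  finally show ?thesis .
qed

section \<open>Countable additivity of conditional expectations, and independence\<close>

text \<open>The partial sums of the conditional expectations are bounded by that of \<open>g\<close>, so their
  series converges almost everywhere and in mean, and its sum has the integrals that
  characterize the conditional expectation of \<open>g\<close>.\<close>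

lemma (in finite_measure_subalgebra) real_cond_exp_sums:
  assumes f: "\<And>k::nat. integrable M (f k)" "\<And>k x. x \<in> space M \<Longrightarrow> 0 \<le> f k x"
    and g: "integrable M g" "\<And>x. x \<in> space M \<Longrightarrow> (\<lambda>k. f k x) sums g x"
  shows "AE x in M. (\<lambda>k. real_cond_exp M F (f k) x) sums real_cond_exp M F g x"
proof -
  let ?c = "\<lambda>k. real_cond_exp M F (f k)"
  have sum_le: "(\<Sum>k<K. f k x) \<le> g x" if "x \<in> space M" for K x
    using sum_le_suminf[OF sums_summable[OF g(2)[OF that]], of "{..<K}"] f(2)[OF that]
      sums_unique[OF g(2)[OF that]] by simp
  have pos: "AE x in M. \<forall>k. 0 \<le> ?c k x"
    unfolding AE_all_countable by (intro allI real_cond_exp_pos) (use f in auto)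
  have "AE x in M. (\<Sum>k<K. ?c k x) \<le> real_cond_exp M F g x" for K
  proof -
    have "AE x in M. real_cond_exp M F (\<lambda>x. \<Sum>k<K. f k x) x \<le> real_cond_exp M F g x"
      by (rule real_cond_exp_mono) (use f g sum_le in auto)
    moreover have "AE x in M. real_cond_exp M F (\<lambda>x. \<Sum>k<K. f k x) x = (\<Sum>k<K. ?c k x)"
      by (rule real_cond_exp_sum) (rule f)
    ultimately show ?thesis by eventually_elim simp
  qed
  then have bound: "AE x in M. \<forall>K. (\<Sum>k<K. ?c k x) \<le> real_cond_exp M F g x"
    by (simp add: AE_all_countable)
  have smb: "AE x in M. summable (\<lambda>k. ?c k x)"
    using pos bound by eventually_elim (rule summableI_nonneg_bounded, auto)
  have intc: "integrable M (?c k)" "integral\<^sup>L M (?c k) = integral\<^sup>L M (f k)" for k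
    using real_cond_exp_int[OF f(1)] by auto
  have sum_int: "summable (\<lambda>k. \<integral>x. norm (f k x) \<partial>M)"
  proof (rule summableI_nonneg_bounded)
    fix K
    have "(\<Sum>k<K. \<integral>x. norm (f k x) \<partial>M) = (\<integral>x. (\<Sum>k<K. f k x) \<partial>M)"
      by (subst Bochner_Integration.integral_sum)
        (use f in \<open>auto intro!: sum.cong Bochner_Integration.integral_cong\<close>)
    also have "\<dots> \<le> integral\<^sup>L M g"
      by (rule integral_mono) (use f g sum_le in auto)
    finally show "(\<Sum>k<K. \<integral>x. norm (f k x) \<partial>M) \<le> integral\<^sup>L M g" .
  qed simp
  have sum_intc: "summable (\<lambda>k. \<integral>x. norm (?c k x) \<partial>M)"
  proof -
    have "(\<integral>x. norm (?c k x) \<partial>M) = (\<integral>x. norm (f k x) \<partial>M)" for k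
    proof -
      have "(\<integral>x. norm (?c k x) \<partial>M) = integral\<^sup>L M (?c k)"
        by (rule integral_cong_AE) (use pos intc in \<open>auto elim: eventually_mono\<close>)
      also have "\<dots> = (\<integral>x. norm (f k x) \<partial>M)"
        unfolding intc by (rule Bochner_Integration.integral_cong) (use f in auto)
      finally show ?thesis .
    qed
    then show ?thesis using sum_int by simp
  qed
  have smb': "AE x in M. summable (\<lambda>k. norm (?c k x))"
    using smb pos by eventually_elim simp
  have "AE x in M. real_cond_exp M F g x = (suminf (\<lambda>k. ?c k x))"
  proof (rule real_cond_exp_charact)
    fix A assume A: "A \<in> sets F"
    then have AM: "A \<in> sets M" using subalg by (auto simp: subalgebra_def)
    have ind: "indicator A x *\<^sub>R (suminf (\<lambda>k. ?c k x)) = (suminf (\<lambda>k. indicator A x *\<^sub>R ?c k x))" for x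
      by (cases "x \<in> A") auto
    have le: "norm (indicator A x *\<^sub>R a) \<le> norm a" for x :: 'a and a :: real
      by (auto simp: indicator_def)
    have "(\<lambda>k. \<integral>x. indicator A x *\<^sub>R ?c k x \<partial>M) sums (\<integral>x. (suminf (\<lambda>k. indicator A x *\<^sub>R ?c k x)) \<partial>M)"
    proof (rule sums_integral)
      show "integrable M (\<lambda>x. indicator A x *\<^sub>R ?c k x)" for k
        by (rule integrable_mult_indicator[OF AM intc(1)])
      show "AE x in M. summable (\<lambda>k. norm (indicator A x *\<^sub>R ?c k x))"
        using smb' by eventually_elim (rule summable_comparison_test', assumption, use le in auto)
      show "summable (\<lambda>k. \<integral>x. norm (indicator A x *\<^sub>R ?c k x) \<partial>M)"
      proof (rule summable_comparison_test'[OF sum_intc])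
        fix k
        have "(\<integral>x. norm (indicator A x *\<^sub>R ?c k x) \<partial>M) \<le> (\<integral>x. norm (?c k x) \<partial>M)"
          by (intro integral_mono integrable_norm integrable_mult_indicator[OF AM intc(1)] intc(1) le)
        then show "norm (\<integral>x. norm (indicator A x *\<^sub>R ?c k x) \<partial>M) \<le> (\<integral>x. norm (?c k x) \<partial>M)"
          by simp
      qed
    qed
    moreover have "(\<lambda>k. \<integral>x. indicator A x *\<^sub>R f k x \<partial>M) sums (\<integral>x. (suminf (\<lambda>k. indicator A x *\<^sub>R f k x)) \<partial>M)"
    proof (rule sums_integral)
      show "integrable M (\<lambda>x. indicator A x *\<^sub>R f k x)" for k
        by (rule integrable_mult_indicator[OF AM f(1)])
      show "AE x in M. summable (\<lambda>k. norm (indicator A x *\<^sub>R f k x))"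
      proof (rule AE_I2)
        fix x assume "x \<in> space M"
        then have sf: "summable (\<lambda>k. f k x)" and pf: "\<And>k. 0 \<le> f k x"
          using sums_summable[OF g(2)] f(2) by blast+
        show "summable (\<lambda>k. norm (indicator A x *\<^sub>R f k x))"
        proof (rule summable_comparison_test'[OF sf, of 0])
          show "norm (norm (indicator A x *\<^sub>R f k x)) \<le> f k x" for k
            using pf[of k] by (simp add: indicator_def)
        qed
      qed
      show "summable (\<lambda>k. \<integral>x. norm (indicator A x *\<^sub>R f k x) \<partial>M)"
      proof (rule summable_comparison_test'[OF sum_int])
        fix k
        have "(\<integral>x. norm (indicator A x *\<^sub>R f k x) \<partial>M) \<le> (\<integral>x. norm (f k x) \<partial>M)"
          by (intro integral_mono integrable_norm integrable_mult_indicator[OF AM f(1)] f(1) le)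
        then show "norm (\<integral>x. norm (indicator A x *\<^sub>R f k x) \<partial>M) \<le> (\<integral>x. norm (f k x) \<partial>M)"
          by simp
      qed
    qed
    moreover have "(\<integral>x. indicator A x *\<^sub>R f k x \<partial>M) = (\<integral>x. indicator A x *\<^sub>R ?c k x \<partial>M)" for k
      using real_cond_exp_intA[OF f(1) A] by (simp add: set_lebesgue_integral_def)
    ultimately have "(\<integral>x. (suminf (\<lambda>k. indicator A x *\<^sub>R ?c k x)) \<partial>M) = (\<integral>x. (suminf (\<lambda>k. indicator A x *\<^sub>R f k x)) \<partial>M)"
      using sums_unique2 by simp
    moreover have "(\<integral>x. (suminf (\<lambda>k. indicator A x *\<^sub>R f k x)) \<partial>M) = (\<integral>x. indicator A x *\<^sub>R g x \<partial>M)"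
    proof (rule Bochner_Integration.integral_cong[OF refl])
      fix x assume "x \<in> space M"
      then have "(\<lambda>k. indicator A x *\<^sub>R f k x) sums (indicator A x *\<^sub>R g x)"
        using g(2) sums_scaleR_right by blast
      then show "(suminf (\<lambda>k. indicator A x *\<^sub>R f k x)) = indicator A x *\<^sub>R g x" by (rule sums_unique[symmetric])
    qed
    ultimately show "(\<integral>x\<in>A. g x \<partial>M) = (\<integral>x\<in>A. (suminf (\<lambda>k. ?c k x)) \<partial>M)"
      unfolding set_lebesgue_integral_def ind by simp
  next
    show "integrable M (\<lambda>x. suminf (\<lambda>k. ?c k x))" by (rule integrable_suminf[OF intc(1) smb' sum_intc])
  qed (use g in auto)
  then show ?thesis using smb by eventually_elim (simp add: summable_sums)
qed

lemma (in prob_space) indep_var_cong_AE: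
  assumes "indep_var S X T Y" "random_variable S X'" "random_variable T Y'"
    and "AE \<omega> in M. X \<omega> = X' \<omega>" "AE \<omega> in M. Y \<omega> = Y' \<omega>"
  shows "indep_var S X' T Y'"
proof -
  note rv = indep_var_rv1[OF assms(1)] indep_var_rv2[OF assms(1)]
  have "distr M S X' = distr M S X" "distr M T Y' = distr M T Y"
    by (rule distr_cong_AE; use assms rv in \<open>auto elim: eventually_mono\<close>)+
  moreover have "distr M (S \<Otimes>\<^sub>M T) (\<lambda>\<omega>. (X' \<omega>, Y' \<omega>)) = distr M (S \<Otimes>\<^sub>M T) (\<lambda>\<omega>. (X \<omega>, Y \<omega>))"
  proof (rule distr_cong_AE[OF refl refl])
    show "AE \<omega> in M. (X' \<omega>, Y' \<omega>) = (X \<omega>, Y \<omega>)"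
      using assms(4,5) by eventually_elim simp
  qed (use assms rv in measurable)
  ultimately show ?thesis using assms(1-3) unfolding indep_var_distribution_eq by simp
qed

text \<open>Independent random variables stay independent when one adds a variable that is
  independent of their joint vector.\<close>

lemma (in prob_space) indep_vars_insertI:
  fixes X :: "'i \<Rightarrow> 'a \<Rightarrow> real"
  assumes "indep_vars (\<lambda>_. borel) X J" "i \<notin> J" and rvi: "random_variable borel (X i)"
    and ind: "indep_var (PiM {i} (\<lambda>_. borel)) (\<lambda>\<omega>. \<lambda>j\<in>{i}. X j \<omega>)
      (PiM J (\<lambda>_. borel)) (\<lambda>\<omega>. \<lambda>j\<in>J. X j \<omega>)"
  shows "indep_vars (\<lambda>_. borel) X (insert i J)"
  unfolding indep_vars_def2 indep_sets_def
proof (intro conjI ballI allI impI)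
  have rvJ: "\<And>j. j \<in> J \<Longrightarrow> random_variable borel (X j)" using assms(1) by (simp add: indep_vars_def2)
  show rv: "random_variable borel (X j)" if "j \<in> insert i J" for j
    using that rvi rvJ by auto
  show "{X j -` A \<inter> space M |A. A \<in> sets borel} \<subseteq> events" if "j \<in> insert i J" for j
    using rv[OF that] by (auto simp: measurable_sets)
  fix K A assume K: "K \<subseteq> insert i J" "K \<noteq> {}" "finite K"
    and A: "A \<in> (\<Pi> j\<in>K. {X j -` A \<inter> space M |A. A \<in> sets borel})"
  have prodJ: "prob (\<Inter>j\<in>L. A j) = (\<Prod>j\<in>L. prob (A j))" if "L \<subseteq> J" "L \<subseteq> K" "L \<noteq> {}" for L
  proof -
    have "indep_sets (\<lambda>i. {X i -` A \<inter> space M |A. A \<in> sets borel}) J"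
      using assms(1) by (simp add: indep_vars_def2)
    moreover have "A \<in> (\<Pi> j\<in>L. {X j -` A \<inter> space M |A. A \<in> sets borel})" using A that by auto
    moreover have "finite L" using that K finite_subset by blast
    ultimately show ?thesis using that unfolding indep_sets_def by blast
  qed
  show "prob (\<Inter>j\<in>K. A j) = (\<Prod>j\<in>K. prob (A j))"
  proof (cases "i \<in> K")
    case False
    then show ?thesis using prodJ[of K] K by auto
  next
    case True
    define L where "L = K - {i}"
    have L: "L \<subseteq> J" "finite L" "K = insert i L" "i \<notin> L" using K True by (auto simp: L_def)
    show ?thesis
    proof (cases "L = {}")
      case True
      then show ?thesis using L by simp
    next
      case False
      have "\<forall>j\<in>K. \<exists>B\<in>sets borel. A j = X j -` B \<inter> space M"
      proof
        fix j assume "j \<in> K"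
        then have "A j \<in> {X j -` A \<inter> space M |A. A \<in> sets borel}" by (rule Pi_mem[OF A])
        then show "\<exists>B\<in>sets borel. A j = X j -` B \<inter> space M" by blast
      qed
      then obtain B where B: "\<And>j. j \<in> K \<Longrightarrow> B j \<in> sets borel \<and> A j = X j -` B j \<inter> space M"
        by metis
      let ?P = "PiM J (\<lambda>_. borel :: real measure)" and ?Y = "\<lambda>\<omega>. \<lambda>j\<in>J. X j \<omega>"
      let ?B = "{f \<in> space ?P. \<forall>j\<in>L. f j \<in> B j}"
      let ?P1 = "PiM {i} (\<lambda>_. borel :: real measure)" and ?Y1 = "\<lambda>\<omega>. \<lambda>j\<in>{i}. X j \<omega>"
      let ?B1 = "{f \<in> space ?P1. f i \<in> B i}"
      have "(\<lambda>f. f i) -` B i \<inter> space ?P1 \<in> sets ?P1"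
        using B True by (intro measurable_sets[of _ ?P1 borel]) (auto intro: measurable_component_singleton)
      then have B1s: "?B1 \<in> sets ?P1" by (simp add: vimage_def Collect_conj_eq Int_commute)
      have Bs: "?B \<in> sets ?P"
      proof (rule sets.sets_Collect_finite_All'[OF _ L(2) False])
        fix j assume "j \<in> L"
        then have "j \<in> J" "B j \<in> sets borel" using L B by auto
        then have "(\<lambda>f. f j) -` B j \<inter> space ?P \<in> sets ?P"
          by (intro measurable_sets[of _ ?P borel]) (auto intro: measurable_component_singleton)
        then show "{f \<in> space ?P. f j \<in> B j} \<in> sets ?P"
          by (simp add: vimage_def Collect_conj_eq Int_commute)
      qed
      have AB: "\<And>j. j \<in> K \<Longrightarrow> A j = X j -` B j \<inter> space M" using B by blast
      have YB: "?Y -` ?B \<inter> space M = {\<omega> \<in> space M. \<forall>j\<in>L. X j \<omega> \<in> B j}"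
        using L(1) by (auto simp: space_PiM subset_iff)
      have memL: "\<omega> \<in> (\<Inter>j\<in>L. A j) \<longleftrightarrow> (\<forall>j\<in>L. \<omega> \<in> space M \<and> X j \<omega> \<in> B j)" for \<omega>
        using AB L(3) by simp blast
      have IB: "(\<Inter>j\<in>L. A j) = {\<omega> \<in> space M. \<forall>j\<in>L. X j \<omega> \<in> B j}"
        by (rule set_eqI, unfold memL mem_Collect_eq) (use False in blast)
      have YB1: "?Y1 -` ?B1 \<inter> space M = A i"
        unfolding AB[OF True] by (auto simp: space_PiM)
      have "(\<Inter>j\<in>K. A j) = A i \<inter> (\<Inter>j\<in>L. A j)" by (simp add: L(3))
      also have "\<dots> = (\<lambda>\<omega>. (?Y1 \<omega>, ?Y \<omega>)) -` (?B1 \<times> ?B) \<inter> space M"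
        unfolding IB YB[symmetric] YB1[symmetric] by blast
      finally have "(\<Inter>j\<in>K. A j) = (\<lambda>\<omega>. (?Y1 \<omega>, ?Y \<omega>)) -` (?B1 \<times> ?B) \<inter> space M" .
      then have "prob (\<Inter>j\<in>K. A j) = prob (A i) * prob (\<Inter>j\<in>L. A j)"
        using indep_varD[OF ind B1s Bs] YB IB YB1 by (simp only:)
      also have "prob (\<Inter>j\<in>L. A j) = (\<Prod>j\<in>L. prob (A j))" by (rule prodJ) (use L False in auto)
      finally show ?thesis using L by simp
    qed
  qed
qed

section \<open>Conditional laws that factorize along a DAG\<close>

text \<open>The conditional law of the counts given \<open>X\<close> is a product along \<open>D\<close>: the factor of \<open>i\<close> is
  \<open>q k m (U i)\<close>, with \<open>k\<close> the count at \<open>i\<close> and \<open>m\<close> the sum of the counts at its parents. The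
  factors are required to be probability weights in \<open>k\<close> only if the factors of the ancestors are
  nonzero, because binomial weights have no meaning when the parents carry more than the number
  of trials. The function \<open>h\<close> recovers the parameter \<open>U i\<close> from the probability of a zero count
  when the parents have count zero.\<close>

locale conditional_factorization = prob_space M
  for M :: "'a measure" +
  fixes V :: "'v set" and D :: "('v \<times> 'v) set"
    and X :: "'a \<Rightarrow> 'v \<Rightarrow> real" and N :: "'a \<Rightarrow> 'v \<Rightarrow> nat"
    and U :: "'v \<Rightarrow> 'a \<Rightarrow> real" and R :: "real set"
    and q :: "nat \<Rightarrow> nat \<Rightarrow> real \<Rightarrow> real" and h :: "real \<Rightarrow> real"
  assumes finite_V: "finite V" and D_subset: "D \<subseteq> V \<times> V" and acyclic_D: "acyclic D"
    and X_measurable: "X \<in> measurable M (PiM V (\<lambda>_. borel))"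
    and N_measurable: "N \<in> measurable M (count_space (V \<rightarrow>\<^sub>E UNIV))"
    and U_measurable: "i \<in> V \<Longrightarrow> U i \<in> borel_measurable M"
    and U_range: "i \<in> V \<Longrightarrow> \<omega> \<in> space M \<Longrightarrow> U i \<omega> \<in> R"
    and q_measurable: "q k m \<in> borel_measurable borel"
    and factorization: "n \<in> V \<rightarrow>\<^sub>E UNIV \<Longrightarrow>
      AE \<omega> in M. cond_marg M V X N V n \<omega> = (\<Prod>i\<in>V. q (n i) (\<Sum>j\<in>pa D i. n j) (U i \<omega>))"
    and q_sums: "v \<in> V \<Longrightarrow> (\<And>i. i \<in> V \<Longrightarrow> u i \<in> R) \<Longrightarrow>
      (\<And>j. (j, v) \<in> D\<^sup>+ \<Longrightarrow> q (n j) (\<Sum>i\<in>pa D j. n i) (u j) \<noteq> 0) \<Longrightarrow>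
      (\<lambda>k. q k (\<Sum>j\<in>pa D v. n j) (u v)) sums 1"
    and h_measurable: "h \<in> borel_measurable borel"
    and h_inverse: "x \<in> R \<Longrightarrow> h (q 0 0 x) = x"
    and q_pos: "x \<in> R \<Longrightarrow> 0 < q 0 0 x"
begin

abbreviation "marg \<equiv> cond_marg M V X N"

definition w :: "('v \<Rightarrow> nat) \<Rightarrow> 'v \<Rightarrow> ('v \<Rightarrow> real) \<Rightarrow> real" where
  "w n i u = q (n i) (\<Sum>j\<in>pa D i. n j) (u i)"

abbreviation "U_at \<omega> \<equiv> \<lambda>i. U i \<omega>"

definition X_algebra :: "'a measure" where
  "X_algebra = vimage_algebra (space M) X (PiM V (\<lambda>_. borel))"

sublocale X_cond: finite_measure_subalgebra M X_algebra
proof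
  show "subalgebra M X_algebra"
    unfolding subalgebra_def X_algebra_def
    using sets_image_in_sets[OF refl X_measurable] by simp
qed

definition N_event :: "'v set \<Rightarrow> ('v \<Rightarrow> nat) \<Rightarrow> 'a set" where
  "N_event A n = {\<omega> \<in> space M. restrict (N \<omega>) A = n}"

lemma marg_eq: "marg A n = real_cond_exp M X_algebra (indicat_real (N_event A n))"
  by (simp add: cond_marg_def X_algebra_def N_event_def)

lemma N_event_sets [measurable]: "N_event A n \<in> sets M"
proof -
  have "N_event A n = N -` {f \<in> V \<rightarrow>\<^sub>E UNIV. restrict f A = n} \<inter> space M"
    using measurable_space[OF N_measurable] by (auto simp: N_event_def)
  moreover have "N -` {f \<in> V \<rightarrow>\<^sub>E UNIV. restrict f A = n} \<inter> space M \<in> sets M"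
    by (rule measurable_sets[OF N_measurable]) auto
  ultimately show ?thesis by simp
qed

lemma integrable_N_event: "integrable M (indicat_real (N_event A n))"
  by (rule integrable_real_indicator) (simp_all add: N_event_sets emeasure_eq_measure)

lemma marg_measurable [measurable]: "marg A n \<in> borel_measurable M"
  unfolding marg_eq by simp

text \<open>Summing out the count at \<open>t\<close>; repeating this step leads from the full law to every
  marginal.\<close>

lemma marg_sums:
  assumes t: "t \<in> T" and m: "m \<in> T - {t} \<rightarrow>\<^sub>E UNIV"
  shows "AE \<omega> in M. (\<lambda>k. marg T (m(t := k)) \<omega>) sums marg (T - {t}) m \<omega>"
  unfolding marg_eq
proof (rule X_cond.real_cond_exp_sums)
  fix \<omega> assume \<omega>: "\<omega> \<in> space M"
  have "restrict (N \<omega>) T = m(t := k) \<longleftrightarrow> N \<omega> t = k \<and> restrict (N \<omega>) (T - {t}) = m" for k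
  proof
    assume e: "restrict (N \<omega>) T = m(t := k)"
    have "N \<omega> t = k" using fun_cong[OF e, of t] t by simp
    moreover have "restrict (N \<omega>) (T - {t}) i = m i" for i
    proof (cases "i \<in> T - {t}")
      case True
      then show ?thesis using fun_cong[OF e, of i] by simp
    next
      case False
      then show ?thesis using PiE_arb[OF m False] by (simp only: restrict_apply if_False)
    qed
    ultimately show "N \<omega> t = k \<and> restrict (N \<omega>) (T - {t}) = m" by blast
  next
    assume e: "N \<omega> t = k \<and> restrict (N \<omega>) (T - {t}) = m"
    show "restrict (N \<omega>) T = m(t := k)"
    proof
      fix i
      show "restrict (N \<omega>) T i = (m(t := k)) i"
        using e t fun_cong[OF conjunct2[OF e], of i] by (cases "i = t") (auto simp: restrict_def)
    qed
  qed
  then have "indicat_real (N_event T (m(t := k))) \<omega> =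
      (if k = N \<omega> t then indicat_real (N_event (T - {t}) m) \<omega> else 0)" for k
    using \<omega> by (auto simp: N_event_def indicator_def)
  then show "(\<lambda>k. indicat_real (N_event T (m(t := k))) \<omega>) sums indicat_real (N_event (T - {t}) m) \<omega>"
    using sums_single[of "N \<omega> t" "\<lambda>_. indicat_real (N_event (T - {t}) m) \<omega>"] by simp
qed (auto simp: integrable_N_event)

lemma marg_insert_sums:
  assumes "t \<notin> T" "m \<in> T \<rightarrow>\<^sub>E UNIV"
  shows "AE \<omega> in M. (\<lambda>k. marg (insert t T) (m(t := k)) \<omega>) sums marg T m \<omega>"
  using marg_sums[of t "insert t T" m] assms by simp

lemma marg_mono:
  assumes "T \<subseteq> S"
  shows "AE \<omega> in M. marg S m \<omega> \<le> marg T (restrict m T) \<omega>"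
  unfolding marg_eq
proof (rule X_cond.real_cond_exp_mono[OF _ integrable_N_event integrable_N_event], rule AE_I2)
  fix \<omega> assume "\<omega> \<in> space M"
  have "restrict (N \<omega>) T = restrict m T" if "restrict (N \<omega>) S = m"
  proof
    show "restrict (N \<omega>) T x = restrict m T x" for x
      using fun_cong[OF that, of x] assms by (cases "x \<in> T") auto
  qed
  then show "indicat_real (N_event S m) \<omega> \<le> indicat_real (N_event T (restrict m T)) \<omega>"
    by (auto simp: N_event_def indicator_def)
qed

lemma pa_subset_V: "pa D i \<subseteq> V"
  using D_subset by (auto simp: pa_def)

lemma ancestral_V: "ancestral D V"
  using pa_subset_V by (auto simp: ancestral_def)

lemma not_pa_self: "i \<notin> pa D i"
  using acyclic_D by (auto simp: pa_def acyclic_def)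

lemma w_update: "t \<noteq> i \<Longrightarrow> t \<notin> pa D i \<Longrightarrow> w (n(t := k)) i u = w n i u"
  unfolding w_def by (rule arg_cong2[of _ _ _ _ "\<lambda>a b. q a b (u i)"]) (auto intro!: sum.cong)

lemma w_cong: "n i = m i \<Longrightarrow> (\<And>j. j \<in> pa D i \<Longrightarrow> n j = m j) \<Longrightarrow> w n i u = w m i u"
  by (simp add: w_def)

text \<open>Summing out a sink removes its factor, as its count occurs in no other factor.\<close>

lemma marg_ancestral:
  assumes "ancestral D S" "S \<subseteq> V" "m \<in> S \<rightarrow>\<^sub>E UNIV"
  shows "AE \<omega> in M. marg S m \<omega> = (\<Prod>i\<in>S. w m i (U_at \<omega>))"
  using finite_V acyclic_D D_subset assms
proof (induction S arbitrary: m rule: ancestral_downward_induct)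
  case all
  then show ?case using factorization unfolding w_def by blast
next
  case (sink S v)
  note m = sink.prems
  have fin: "finite S" using finite_V sink.hyps by (auto intro: finite_subset)
  have v_pa: "v \<notin> pa D i" if "i \<in> S" for i
    using sink.hyps that by (auto simp: ancestral_def)
  have split: "(\<Prod>i\<in>insert v S. w (m(v := k)) i u) = q k (\<Sum>j\<in>pa D v. m j) (u v) * (\<Prod>i\<in>S. w m i u)" for k u
  proof -
    have "(\<Sum>j\<in>pa D v. (m(v := k)) j) = (\<Sum>j\<in>pa D v. m j)"
      using not_pa_self[of v] by (intro sum.cong) auto
    moreover have "(\<Prod>i\<in>S. w (m(v := k)) i u) = (\<Prod>i\<in>S. w m i u)"
      by (intro prod.cong refl w_update) (use sink.hyps v_pa in auto)
    ultimately show ?thesis using fin sink.hyps by (simp add: w_def)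
  qed
  have "AE \<omega> in M. \<forall>k. marg (insert v S) (m(v := k)) \<omega> = (\<Prod>i\<in>insert v S. w (m(v := k)) i (U_at \<omega>))"
    unfolding AE_all_countable by (intro allI sink.IH PiE_fun_upd m UNIV_I)
  moreover note marg_insert_sums[OF \<open>v \<notin> S\<close> m]
  ultimately show ?case using AE_space
  proof eventually_elim
    fix \<omega> assume eq: "\<forall>k. marg (insert v S) (m(v := k)) \<omega> = (\<Prod>i\<in>insert v S. w (m(v := k)) i (U_at \<omega>))"
      and s: "(\<lambda>k. marg (insert v S) (m(v := k)) \<omega>) sums marg S m \<omega>" and \<omega>: "\<omega> \<in> space M"
    let ?P = "\<Prod>i\<in>S. w m i (U_at \<omega>)"
    have s': "(\<lambda>k. q k (\<Sum>j\<in>pa D v. m j) (U v \<omega>) * ?P) sums marg S m \<omega>"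
      using s unfolding eq[rule_format] split .
    show "marg S m \<omega> = ?P"
    proof (cases "?P = 0")
      case True
      then show ?thesis using s' sums_unique2[OF _ sums_zero] by simp
    next
      case False
      have anc: "j \<in> S" if "(j, v) \<in> D\<^sup>+" for j
      proof -
        have "j \<in> insert v S"
          using that by (induction rule: converse_trancl_induct)
            (use sink.hyps in \<open>auto simp: ancestral_def pa_def\<close>)
        then show ?thesis using that acyclic_D by (auto simp: acyclic_def)
      qed
      have "(\<lambda>k. q k (\<Sum>j\<in>pa D v. m j) (U v \<omega>)) sums 1"
        by (rule q_sums[of v "U_at \<omega>"]) (use anc False fin \<omega> U_range sink.hyps in \<open>auto simp: w_def\<close>)
      then have "(\<lambda>k. q k (\<Sum>j\<in>pa D v. m j) (U v \<omega>) * ?P) sums (1 * ?P)" by (rule sums_mult2)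
      then show ?thesis using sums_unique2[OF s'] by simp
    qed
  qed
qed

lemma marg_zero_ancestral:
  assumes "ancestral D S" "S \<subseteq> V"
  shows "AE \<omega> in M. marg S (\<lambda>i\<in>S. 0) \<omega> = (\<Prod>i\<in>S. q 0 0 (U i \<omega>))"
proof -
  have "w (\<lambda>i\<in>S. 0) i u = q 0 0 (u i)" if "i \<in> S" for i u
  proof -
    have "(\<Sum>j\<in>pa D i. (\<lambda>i\<in>S. 0::nat) j) = 0"
      by (rule sum.neutral) (use assms that in \<open>auto simp: ancestral_def\<close>)
    then show ?thesis using that by (simp add: w_def)
  qed
  then have "(\<Prod>i\<in>S. w (\<lambda>i\<in>S. 0) i u) = (\<Prod>i\<in>S. q 0 0 (u i))" for u by simp
  then show ?thesis using marg_ancestral[OF assms, of "\<lambda>i\<in>S. 0"] by simp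
qed

text \<open>The zero vector has positive probability under every parameter value, so it always
  belongs to the index set of a conditional family.\<close>

lemma marg_zero_pos:
  assumes "T \<subseteq> V"
  shows "AE \<omega> in M. 0 < marg T (\<lambda>i\<in>T. 0) \<omega>"
proof -
  have "restrict (\<lambda>i\<in>V. 0) T = (\<lambda>i\<in>T. 0 :: nat)" using assms by (auto simp: fun_eq_iff)
  then have "AE \<omega> in M. marg V (\<lambda>i\<in>V. 0) \<omega> \<le> marg T (\<lambda>i\<in>T. 0) \<omega>"
    using marg_mono[OF assms, of "\<lambda>i\<in>V. 0"] by simp
  with marg_zero_ancestral[OF ancestral_V order_refl] AE_space show ?thesis
  proof eventually_elim
    fix \<omega> assume "marg V (\<lambda>i\<in>V. 0) \<omega> = (\<Prod>i\<in>V. q 0 0 (U i \<omega>))" "\<omega> \<in> space M"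
      "marg V (\<lambda>i\<in>V. 0) \<omega> \<le> marg T (\<lambda>i\<in>T. 0) \<omega>"
    moreover have "0 < (\<Prod>i\<in>V. q 0 0 (U i \<omega>))"
      using q_pos U_range \<open>\<omega> \<in> space M\<close> by (intro prod_pos) auto
    ultimately show "0 < marg T (\<lambda>i\<in>T. 0) \<omega>" by simp
  qed
qed

lemma ancestral_nde:
  shows "ancestral D (nde V D v)" and "v \<in> V \<Longrightarrow> ancestral D (insert v (nde V D v))"
    and "pa D v \<subseteq> nde V D v" and "v \<notin> nde V D v"
proof -
  show 1: "ancestral D (nde V D v)"
    using D_subset by (auto simp: ancestral_def nde_def de_bar_def de_def pa_def intro: trancl_into_trancl)
  show 2: "pa D v \<subseteq> nde V D v"
  proof
    fix j assume "j \<in> pa D v"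
    then have jv: "(j, v) \<in> D" by (simp add: pa_def)
    then have "j \<noteq> v" "(v, j) \<notin> D\<^sup>+" using acyclic_D by (auto simp: acyclic_def intro: trancl_into_trancl)
    then show "j \<in> nde V D v" using jv D_subset by (auto simp: nde_def de_bar_def de_def)
  qed
  show "v \<in> V \<Longrightarrow> ancestral D (insert v (nde V D v))"
    using 1 2 by (auto simp: ancestral_def)
  show "v \<notin> nde V D v" by (simp add: nde_def de_bar_def)
qed

text \<open>By \<open>marg_ancestral\<close> the identity holds when \<open>T\<close> consists of all non-descendants; the
  other counts are summed out one at a time, and they do not occur in the factor of \<open>v\<close>.\<close>

lemma marg_parents:
  assumes v: "v \<in> V" and T: "pa D v \<subseteq> T" "T \<subseteq> nde V D v" and n: "n \<in> insert v T \<rightarrow>\<^sub>E UNIV"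
  shows "AE \<omega> in M. marg (insert v T) n \<omega> = w n v (U_at \<omega>) * marg T (restrict n T) \<omega>"
  using T n
proof (induction "card (nde V D v - T)" arbitrary: T n rule: less_induct)
  case less
  let ?S = "nde V D v"
  have SV: "?S \<subseteq> V" and vS: "v \<notin> ?S" by (auto simp: nde_def de_bar_def)
  have finS: "finite ?S" using SV finite_V finite_subset by blast
  have vT: "v \<notin> T" using less.prems vS by auto
  show ?case
  proof (cases "T = ?S")
    case True
    have n: "n \<in> insert v ?S \<rightarrow>\<^sub>E UNIV" using less.prems True by simp
    have rn: "restrict n ?S \<in> ?S \<rightarrow>\<^sub>E UNIV" by auto
    have "(\<Prod>i\<in>insert v ?S. w n i u) = w n v u * (\<Prod>i\<in>?S. w (restrict n ?S) i u)" for u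
    proof -
      have "(\<Prod>i\<in>?S. w n i u) = (\<Prod>i\<in>?S. w (restrict n ?S) i u)"
        by (intro prod.cong refl w_cong)
          (use ancestral_nde(1)[of v] in \<open>auto simp: ancestral_def subset_iff\<close>)
      then show ?thesis using finS vS by simp
    qed
    moreover have "AE \<omega> in M. marg (insert v ?S) n \<omega> = (\<Prod>i\<in>insert v ?S. w n i (U_at \<omega>))"
      by (rule marg_ancestral[OF ancestral_nde(2)[OF v] _ n]) (use SV v in auto)
    moreover note marg_ancestral[OF ancestral_nde(1) SV rn]
    ultimately show ?thesis unfolding True by (elim AE_mp) auto
  next
    case False
    then obtain t where t: "t \<in> ?S" "t \<notin> T" using less.prems by blast
    have tv: "t \<noteq> v" using t vS by auto
    have tpa: "t \<notin> pa D v" using t less.prems by auto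
    have "?S - insert t T \<subset> ?S - T" using t by auto
    then have card: "card (?S - insert t T) < card (?S - T)" using finS by (simp add: psubset_card_mono)
    have upd: "restrict (n(t := k)) (insert t T) = (restrict n T)(t := k)" for k
      using t by (auto simp: fun_eq_iff)
    have "AE \<omega> in M. marg (insert v (insert t T)) (n(t := k)) \<omega> =
        w n v (U_at \<omega>) * marg (insert t T) ((restrict n T)(t := k)) \<omega>" for k
    proof -
      have "n(t := k) \<in> insert t (insert v T) \<rightarrow>\<^sub>E UNIV"
        by (rule PiE_fun_upd) (use less.prems(3) in auto)
      then have "n(t := k) \<in> insert v (insert t T) \<rightarrow>\<^sub>E UNIV" by (simp only: insert_commute)
      from less.hyps[OF card _ _ this] show ?thesis
        unfolding upd w_update[OF tv tpa] using less.prems t by auto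
    qed
    then have "AE \<omega> in M. \<forall>k. marg (insert v (insert t T)) (n(t := k)) \<omega> =
        w n v (U_at \<omega>) * marg (insert t T) ((restrict n T)(t := k)) \<omega>"
      by (simp add: AE_all_countable)
    moreover have "AE \<omega> in M. (\<lambda>k. marg (insert t (insert v T)) (n(t := k)) \<omega>) sums marg (insert v T) n \<omega>"
      by (rule marg_insert_sums) (use t tv less.prems in auto)
    moreover have "AE \<omega> in M. (\<lambda>k. marg (insert t T) ((restrict n T)(t := k)) \<omega>) sums marg T (restrict n T) \<omega>"
      by (rule marg_insert_sums) (use t in auto)
    ultimately show ?thesis
    proof eventually_elim
      fix \<omega>
      assume "\<forall>k. marg (insert v (insert t T)) (n(t := k)) \<omega> =
          w n v (U_at \<omega>) * marg (insert t T) ((restrict n T)(t := k)) \<omega>"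
        and s1: "(\<lambda>k. marg (insert t (insert v T)) (n(t := k)) \<omega>) sums marg (insert v T) n \<omega>"
        and s2: "(\<lambda>k. marg (insert t T) ((restrict n T)(t := k)) \<omega>) sums marg T (restrict n T) \<omega>"
      then have "(\<lambda>k. marg (insert t (insert v T)) (n(t := k)) \<omega>) sums
          (w n v (U_at \<omega>) * marg T (restrict n T) \<omega>)"
        using sums_mult[OF s2, of "w n v (U_at \<omega>)"] by (simp add: insert_commute)
      then show "marg (insert v T) n \<omega> = w n v (U_at \<omega>) * marg T (restrict n T) \<omega>"
        using s1 sums_unique2 by blast
    qed
  qed
qed


lemma countable_marg_index: "A \<subseteq> V \<Longrightarrow> countable (marg_index A :: ('v \<Rightarrow> nat) set)"
  unfolding marg_index_def using finite_V by (intro countable_PiE) (auto intro: finite_subset)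

lemma countable_cond_index: "A \<union> B \<subseteq> V \<Longrightarrow> countable (cond_index M V X N B A)"
  using countable_marg_index[of "A \<union> B"]
  by (rule countable_subset[rotated]) (auto simp: cond_index_def marg_index_def)

lemma marg_family_measurable:
  "marg_family M V X N A \<in> measurable M (PiM (marg_index A) (\<lambda>_. borel))"
  unfolding marg_family_def by (rule measurable_restrict) (rule marg_measurable)

lemma cond_family_measurable:
  "cond_family M V X N B A \<in> measurable M (PiM (cond_index M V X N B A) (\<lambda>_. borel))"
  unfolding cond_family_def
  by (rule measurable_restrict) (intro borel_measurable_divide marg_measurable)

lemma q_coordinate_measurable:
  "i \<in> P \<Longrightarrow> (\<lambda>f. q k m (f i)) \<in> borel_measurable (PiM P (\<lambda>_. borel))"
  by (rule measurable_compose[OF _ q_measurable]) (rule measurable_component_singleton)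

text \<open>Functions of the coordinates in disjoint sets \<open>P\<close> and \<open>Q\<close> are independent. On the index
  set the denominators are almost surely nonzero, so there \<open>\<phi> n\<close> is the entry \<open>n\<close> of the
  conditional family.\<close>

lemma indep_cond_margI:
  assumes indep: "indep_vars (\<lambda>_. borel) U V" and PQ: "P \<inter> Q = {}" "P \<subseteq> V" "Q \<subseteq> V"
    and sub: "A \<union> B \<subseteq> V" "A' \<subseteq> V"
    and \<phi>: "\<And>n. n \<in> cond_index M V X N B A \<Longrightarrow> \<phi> n \<in> borel_measurable (PiM P (\<lambda>_. borel))"
      "\<And>n. n \<in> cond_index M V X N B A \<Longrightarrow>
        AE \<omega> in M. marg (A \<union> B) n \<omega> = \<phi> n (restrict (U_at \<omega>) P) * marg A (restrict n A) \<omega>"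
    and \<psi>: "\<And>m. m \<in> A' \<rightarrow>\<^sub>E UNIV \<Longrightarrow> \<psi> m \<in> borel_measurable (PiM Q (\<lambda>_. borel))"
      "\<And>m. m \<in> A' \<rightarrow>\<^sub>E UNIV \<Longrightarrow> AE \<omega> in M. marg A' m \<omega> = \<psi> m (restrict (U_at \<omega>) Q)"
  shows "indep_cond_marg M V X N B A A'"
  unfolding indep_cond_marg_def
proof (rule indep_var_cong_AE[OF _ cond_family_measurable marg_family_measurable])
  let ?I = "cond_index M V X N B A"
  let ?\<Phi> = "\<lambda>f. \<lambda>n\<in>?I. \<phi> n f" and ?\<Psi> = "\<lambda>f. \<lambda>m\<in>marg_index A'. \<psi> m f"
  have "indep_var (PiM P (\<lambda>_. borel)) (\<lambda>\<omega>. restrict (U_at \<omega>) P)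
      (PiM Q (\<lambda>_. borel)) (\<lambda>\<omega>. restrict (U_at \<omega>) Q)"
    by (rule indep_var_restrict[OF indep PQ])
  then show "indep_var (PiM ?I (\<lambda>_. borel)) (?\<Phi> \<circ> (\<lambda>\<omega>. restrict (U_at \<omega>) P))
      (PiM (marg_index A') (\<lambda>_. borel)) (?\<Psi> \<circ> (\<lambda>\<omega>. restrict (U_at \<omega>) Q))"
    by (rule indep_var_compose; intro measurable_restrict \<phi>(1) \<psi>(1))
      (auto simp: marg_index_def)
  have "AE \<omega> in M. \<forall>n\<in>?I. marg (A \<union> B) n \<omega> = \<phi> n (restrict (U_at \<omega>) P) * marg A (restrict n A) \<omega>
      \<and> marg A (restrict n A) \<omega> \<noteq> 0"
    using \<phi>(2) by (subst AE_ball_countable[OF countable_cond_index[OF sub(1)]])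
      (auto simp: cond_index_def)
  then show "AE \<omega> in M. (?\<Phi> \<circ> (\<lambda>\<omega>. restrict (U_at \<omega>) P)) \<omega> = cond_family M V X N B A \<omega>"
    by eventually_elim (auto simp: cond_family_def fun_eq_iff)
  have "AE \<omega> in M. \<forall>m\<in>marg_index A'. marg A' m \<omega> = \<psi> m (restrict (U_at \<omega>) Q)"
    using \<psi>(2) by (subst AE_ball_countable[OF countable_marg_index[OF sub(2)]])
      (auto simp: marg_index_def)
  then show "AE \<omega> in M. (?\<Psi> \<circ> (\<lambda>\<omega>. restrict (U_at \<omega>) Q)) \<omega> = marg_family M V X N A' \<omega>"
    by eventually_elim (auto simp: marg_family_def fun_eq_iff)
qed

lemma marg_ancestral_restrict:
  assumes "ancestral D S" "S \<subseteq> V" "m \<in> S \<rightarrow>\<^sub>E UNIV"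
  shows "AE \<omega> in M. marg S m \<omega> = (\<Prod>i\<in>S. w m i (restrict (U_at \<omega>) S))"
  using marg_ancestral[OF assms] by eventually_elim (simp add: w_def)

lemma prod_w_measurable:
  "A \<subseteq> P \<Longrightarrow> (\<lambda>f. \<Prod>i\<in>A. w m i f) \<in> borel_measurable (PiM P (\<lambda>_. borel))"
  unfolding w_def by (intro borel_measurable_prod q_coordinate_measurable) auto

lemma directed_if_indep:
  assumes "indep_vars (\<lambda>_. borel) U V"
  shows "strong_directed_hyper_markov M V D X N"
  unfolding strong_directed_hyper_markov_def
proof
  fix v assume v: "v \<in> V"
  let ?S = "nde V D v"
  have SV: "?S \<subseteq> V" by (auto simp: nde_def)
  show "indep_cond_marg M V X N {v} (pa D v) ?S"
  proof (rule indep_cond_margI[OF assms, where P = "{v}" and Q = ?S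
        and \<phi> = "\<lambda>n f. w n v f" and \<psi> = "\<lambda>m f. \<Prod>i\<in>?S. w m i f"])
    show "w n v \<in> borel_measurable (PiM {v} (\<lambda>_. borel))" for n
      using prod_w_measurable[of "{v}" "{v}" n] by simp
    show "AE \<omega> in M. marg (pa D v \<union> {v}) n \<omega> = w n v (restrict (U_at \<omega>) {v}) * marg (pa D v) (restrict n (pa D v)) \<omega>"
      if "n \<in> cond_index M V X N {v} (pa D v)" for n
      using marg_parents[OF v order_refl ancestral_nde(3), of n] that
      by (simp add: cond_index_def w_def)
    show "AE \<omega> in M. marg ?S m \<omega> = (\<Prod>i\<in>?S. w m i (restrict (U_at \<omega>) ?S))"
      if "m \<in> ?S \<rightarrow>\<^sub>E UNIV" for m
      by (rule marg_ancestral_restrict[OF ancestral_nde(1) SV that])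
  qed (use SV v pa_subset_V ancestral_nde(4) prod_w_measurable in auto)
qed

text \<open>The family of the ancestral set \<open>S\<close> depends on the coordinates in \<open>S\<close>, and in the
  quotient the factors of \<open>S\<close> cancel.\<close>

lemma indep_cond_marg_ancestral_if_indep:
  assumes "indep_vars (\<lambda>_. borel) U V" "ancestral D S" "S \<union> T = V"
  shows "indep_cond_marg M V X N T S S"
proof (rule indep_cond_margI[OF assms(1), where P = "V - S" and Q = S
      and \<phi> = "\<lambda>n f. \<Prod>i\<in>V - S. w n i f" and \<psi> = "\<lambda>m f. \<Prod>i\<in>S. w m i f"])
  have SV: "S \<subseteq> V" using assms(3) by auto
  show "AE \<omega> in M. marg (S \<union> T) n \<omega> =
      (\<Prod>i\<in>V - S. w n i (restrict (U_at \<omega>) (V - S))) * marg S (restrict n S) \<omega>"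
    if "n \<in> cond_index M V X N T S" for n
  proof -
    have n: "n \<in> V \<rightarrow>\<^sub>E UNIV" using that assms(3) by (auto simp: cond_index_def)
    have "(\<Prod>i\<in>V. w n i u) = (\<Prod>i\<in>V - S. w n i (restrict u (V - S))) * (\<Prod>i\<in>S. w (restrict n S) i u)" for u
    proof -
      have "(\<Prod>i\<in>S. w n i u) = (\<Prod>i\<in>S. w (restrict n S) i u)"
        by (intro prod.cong refl w_cong) (use assms(2) in \<open>auto simp: ancestral_def subset_iff\<close>)
      moreover have "(\<Prod>i\<in>V - S. w n i u) = (\<Prod>i\<in>V - S. w n i (restrict u (V - S)))"
        by (intro prod.cong refl) (auto simp: w_def)
      ultimately show ?thesis using prod.subset_diff[OF SV finite_V] by metis
    qed
    moreover note marg_ancestral[OF ancestral_V order_refl n]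
    moreover have "restrict n S \<in> S \<rightarrow>\<^sub>E UNIV" by auto
    moreover note marg_ancestral[OF assms(2) SV this]
    ultimately show ?thesis unfolding assms(3) by (elim AE_mp) auto
  qed
  show "AE \<omega> in M. marg S m \<omega> = (\<Prod>i\<in>S. w m i (restrict (U_at \<omega>) S))"
    if "m \<in> S \<rightarrow>\<^sub>E UNIV" for m
    by (rule marg_ancestral_restrict[OF assms(2) SV that])
qed (use assms(3) prod_w_measurable in auto)

text \<open>A marginal of a marginal, obtained by summing out counts; it is a measurable function of
  the bigger family.\<close>

lemma marg_function_of_family:
  assumes "T \<subseteq> S" "S \<subseteq> V" "m \<in> T \<rightarrow>\<^sub>E UNIV"
  shows "\<exists>\<phi> \<in> borel_measurable (PiM (marg_index S) (\<lambda>_. borel)).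
    AE \<omega> in M. marg T m \<omega> = \<phi> (marg_family M V X N S \<omega>)"
  using assms(1,3)
proof (induction "card (S - T)" arbitrary: T m rule: less_induct)
  case less
  have finS: "finite S" using assms(2) finite_V finite_subset by blast
  show ?case
  proof (cases "T = S")
    case True
    then have "m \<in> marg_index S" using less.prems by (simp add: marg_index_def)
    then show ?thesis
      using True by (intro bexI[of _ "\<lambda>f. f m"]) (auto simp: marg_family_def intro: measurable_component_singleton)
  next
    case False
    then obtain t where t: "t \<in> S" "t \<notin> T" using less.prems by blast
    have "S - insert t T \<subset> S - T" using t by auto
    then have card: "card (S - insert t T) < card (S - T)" using finS by (simp add: psubset_card_mono)
    have "m(t := k) \<in> insert t T \<rightarrow>\<^sub>E UNIV" for k
      by (rule PiE_fun_upd) (use less.prems in auto)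
    then have "\<forall>k. \<exists>\<phi> \<in> borel_measurable (PiM (marg_index S) (\<lambda>_. borel)).
        AE \<omega> in M. marg (insert t T) (m(t := k)) \<omega> = \<phi> (marg_family M V X N S \<omega>)"
      using less.hyps[OF card] less.prems t by auto
    then obtain \<phi> where \<phi>: "\<And>k. \<phi> k \<in> borel_measurable (PiM (marg_index S) (\<lambda>_. borel))"
      "\<And>k. AE \<omega> in M. marg (insert t T) (m(t := k)) \<omega> = \<phi> k (marg_family M V X N S \<omega>)"
      by metis
    have "AE \<omega> in M. \<forall>k. marg (insert t T) (m(t := k)) \<omega> = \<phi> k (marg_family M V X N S \<omega>)"
      unfolding AE_all_countable using \<phi>(2) by blast
    moreover note marg_insert_sums[OF t(2) less.prems(2)]
    ultimately have "AE \<omega> in M. marg T m \<omega> = suminf (\<lambda>k. \<phi> k (marg_family M V X N S \<omega>))"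
      by eventually_elim (simp add: sums_iff)
    moreover have "(\<lambda>f. suminf (\<lambda>k. \<phi> k f)) \<in> borel_measurable (PiM (marg_index S) (\<lambda>_. borel))"
      by (rule borel_measurable_suminf) (rule \<phi>(1))
    ultimately show ?thesis by (intro bexI[of _ "\<lambda>f. suminf (\<lambda>k. \<phi> k f)"])
  qed
qed

text \<open>Let \<open>T\<close> be \<open>j\<close> together with its ancestors. The probability of zero counts on \<open>T\<close> divided
  by that on \<open>T - {j}\<close> is the factor of \<open>j\<close> at zero counts, from which \<open>h\<close> recovers \<open>U j\<close>.\<close>

lemma U_function_of_family:
  assumes S: "ancestral D S" "S \<subseteq> V" and j: "j \<in> S"
  shows "\<exists>\<psi> \<in> borel_measurable (PiM (marg_index S) (\<lambda>_. borel)).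
    AE \<omega> in M. U j \<omega> = \<psi> (marg_family M V X N S \<omega>)"
proof -
  define T where "T = {k. (k, j) \<in> D\<^sup>*}"
  have TS: "T \<subseteq> S"
  proof
    fix k assume "k \<in> T"
    then have "(k, j) \<in> D\<^sup>*" by (simp add: T_def)
    then show "k \<in> S"
      by (induction rule: converse_rtrancl_induct) (use S j in \<open>auto simp: ancestral_def pa_def\<close>)
  qed
  then have TV: "T \<subseteq> V" using S by auto
  have jT: "j \<in> T" by (simp add: T_def)
  have anc: "ancestral D T"
    by (auto simp: ancestral_def pa_def T_def intro: converse_rtrancl_into_rtrancl)
  have sink: "\<forall>k\<in>T. (j, k) \<notin> D"
  proof (intro ballI notI)
    fix k assume "k \<in> T" "(j, k) \<in> D"
    then have "(j, j) \<in> D\<^sup>+" by (auto simp: T_def intro: rtrancl_into_trancl2)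
    then show False using acyclic_D by (simp add: acyclic_def)
  qed
  have anc': "ancestral D (T - {j})" by (rule ancestral_remove_sink[OF anc sink])
  obtain \<phi>1 where \<phi>1: "\<phi>1 \<in> borel_measurable (PiM (marg_index S) (\<lambda>_. borel))"
    "AE \<omega> in M. marg T (\<lambda>i\<in>T. 0) \<omega> = \<phi>1 (marg_family M V X N S \<omega>)"
    using marg_function_of_family[OF TS S(2), of "\<lambda>i\<in>T. 0"] by auto
  obtain \<phi>2 where \<phi>2: "\<phi>2 \<in> borel_measurable (PiM (marg_index S) (\<lambda>_. borel))"
    "AE \<omega> in M. marg (T - {j}) (\<lambda>i\<in>T - {j}. 0) \<omega> = \<phi>2 (marg_family M V X N S \<omega>)"
    using marg_function_of_family[of "T - {j}" S "\<lambda>i\<in>T - {j}. 0"] TS S(2) by auto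
  have TjV: "T - {j} \<subseteq> V" using TV by blast
  have fin: "finite T" using TV finite_V finite_subset by blast
  have "AE \<omega> in M. U j \<omega> = h (\<phi>1 (marg_family M V X N S \<omega>) / \<phi>2 (marg_family M V X N S \<omega>))"
    using \<phi>1(2) \<phi>2(2) marg_zero_ancestral[OF anc TV] marg_zero_ancestral[OF anc' TjV] AE_space
  proof eventually_elim
    fix \<omega> assume "marg T (\<lambda>i\<in>T. 0) \<omega> = \<phi>1 (marg_family M V X N S \<omega>)"
      "marg (T - {j}) (\<lambda>i\<in>T - {j}. 0) \<omega> = \<phi>2 (marg_family M V X N S \<omega>)"
      "marg T (\<lambda>i\<in>T. 0) \<omega> = (\<Prod>i\<in>T. q 0 0 (U i \<omega>))"
      "marg (T - {j}) (\<lambda>i\<in>T - {j}. 0) \<omega> = (\<Prod>i\<in>T - {j}. q 0 0 (U i \<omega>))"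
      and \<omega>: "\<omega> \<in> space M"
    then have e: "\<phi>1 (marg_family M V X N S \<omega>) = q 0 0 (U j \<omega>) * (\<Prod>i\<in>T - {j}. q 0 0 (U i \<omega>))"
      "\<phi>2 (marg_family M V X N S \<omega>) = (\<Prod>i\<in>T - {j}. q 0 0 (U i \<omega>))"
      by (simp_all add: prod.remove[OF fin jT])
    have "0 < (\<Prod>i\<in>T - {j}. q 0 0 (U i \<omega>))"
      using q_pos U_range[OF _ \<omega>] TV by (intro prod_pos) auto
    then have "\<phi>1 (marg_family M V X N S \<omega>) / \<phi>2 (marg_family M V X N S \<omega>) = q 0 0 (U j \<omega>)"
      unfolding e by simp
    then show "U j \<omega> = h (\<phi>1 (marg_family M V X N S \<omega>) / \<phi>2 (marg_family M V X N S \<omega>))"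
      using h_inverse[OF U_range[OF _ \<omega>, of j]] j S by auto
  qed
  moreover have "(\<lambda>f. h (\<phi>1 f / \<phi>2 f)) \<in> borel_measurable (PiM (marg_index S) (\<lambda>_. borel))"
    by (rule measurable_compose[OF _ h_measurable]) (intro borel_measurable_divide \<phi>1 \<phi>2)
  ultimately show ?thesis by (intro bexI[of _ "\<lambda>f. h (\<phi>1 f / \<phi>2 f)"])
qed

text \<open>The vertices are added in a topological order. When \<open>v\<close> is added as a sink of \<open>S\<close>, the
  rest of \<open>S\<close> consists of non-descendants of \<open>v\<close>; its coordinates are functions of the family of
  \<open>nde(v)\<close>, and that of \<open>v\<close> is a function of the conditional family of \<open>v\<close>, so the directed
  property makes them independent.\<close>

lemma indep_if_directed:
  assumes directed: "strong_directed_hyper_markov M V D X N"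
  shows "indep_vars (\<lambda>_. borel) U V"
proof -
  have "V \<subseteq> V \<longrightarrow> indep_vars (\<lambda>_. borel) U V"
    using finite_V acyclic_D ancestral_V
  proof (induction V rule: ancestral_induct[where P = "\<lambda>S. S \<subseteq> V \<longrightarrow> indep_vars (\<lambda>_. borel) U S"])
    case empty
    show ?case by (simp add: indep_vars_def2 indep_sets_def)
  next
    case (sink S v)
    show ?case
    proof
      assume SV: "S \<subseteq> V"
      let ?J = "S - {v}" and ?S = "nde V D v" and ?I = "cond_index M V X N {v} (pa D v)"
      have v: "v \<in> V" using sink SV by auto
      have SnV: "?S \<subseteq> V" by (auto simp: nde_def)
      have JS: "?J \<subseteq> ?S"
      proof
        fix j assume j: "j \<in> ?J"
        have "(v, j) \<notin> D\<^sup>+"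
        proof
          assume "(v, j) \<in> D\<^sup>+"
          then obtain c where c: "(v, c) \<in> D" "(c, j) \<in> D\<^sup>*" by (meson tranclD)
          have "c \<in> S" using c(2) by (induction rule: converse_rtrancl_induct)
              (use sink.hyps j in \<open>auto simp: ancestral_def pa_def\<close>)
          then show False using sink.hyps c(1) by blast
        qed
        then show "j \<in> ?S" using j SV by (auto simp: nde_def de_bar_def de_def)
      qed
      have "\<forall>j. \<exists>\<psi>. j \<in> ?J \<longrightarrow> \<psi> \<in> borel_measurable (PiM (marg_index ?S) (\<lambda>_. borel)) \<and>
          (AE \<omega> in M. U j \<omega> = \<psi> (marg_family M V X N ?S \<omega>))"
        using U_function_of_family[OF ancestral_nde(1) SnV] JS by blast
      then obtain \<psi> where \<psi>: "\<And>j. j \<in> ?J \<Longrightarrow> \<psi> j \<in> borel_measurable (PiM (marg_index ?S) (\<lambda>_. borel))"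
        "\<And>j. j \<in> ?J \<Longrightarrow> AE \<omega> in M. U j \<omega> = \<psi> j (marg_family M V X N ?S \<omega>)"
        by metis
      \<comment> \<open>The entry of the conditional family at zero counts determines \<open>U v\<close>.\<close>
      let ?z = "\<lambda>i\<in>pa D v \<union> {v}. 0 :: nat"
      have rz: "restrict ?z (pa D v) = (\<lambda>i\<in>pa D v. 0)" by (auto simp: fun_eq_iff)
      have zpos: "AE \<omega> in M. 0 < marg (pa D v) (restrict ?z (pa D v)) \<omega>"
        unfolding rz by (rule marg_zero_pos[OF pa_subset_V])
      then have z: "?z \<in> ?I" unfolding cond_index_def by (auto elim: eventually_mono)
      have wz: "w ?z v u = q 0 0 (u v)" for u
        by (simp add: w_def)
      have "AE \<omega> in M. marg (pa D v \<union> {v}) ?z \<omega> = w ?z v (U_at \<omega>) * marg (pa D v) (restrict ?z (pa D v)) \<omega>"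
        using marg_parents[OF v order_refl ancestral_nde(3), of ?z] by simp
      with zpos AE_space have Uv: "AE \<omega> in M. h (cond_family M V X N {v} (pa D v) \<omega> ?z) = U v \<omega>"
      proof eventually_elim
        fix \<omega> assume "\<omega> \<in> space M" "0 < marg (pa D v) (restrict ?z (pa D v)) \<omega>"
          "marg (pa D v \<union> {v}) ?z \<omega> = w ?z v (U_at \<omega>) * marg (pa D v) (restrict ?z (pa D v)) \<omega>"
        then have "cond_family M V X N {v} (pa D v) \<omega> ?z = q 0 0 (U v \<omega>)"
          using z unfolding wz by (simp add: cond_family_def)
        then show "h (cond_family M V X N {v} (pa D v) \<omega> ?z) = U v \<omega>"
          using h_inverse[OF U_range[OF v \<open>\<omega> \<in> space M\<close>]] by simp
      qed
      let ?Y1 = "\<lambda>f. \<lambda>j\<in>{v}. h (f ?z)" and ?Y2 = "\<lambda>f. \<lambda>j\<in>?J. \<psi> j f"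
      have "indep_cond_marg M V X N {v} (pa D v) ?S"
        using directed v by (simp add: strong_directed_hyper_markov_def)
      moreover have "?Y1 \<in> measurable (PiM ?I (\<lambda>_. borel)) (PiM {v} (\<lambda>_. borel))"
        by (rule measurable_restrict, rule measurable_compose[OF _ h_measurable],
            rule measurable_component_singleton[OF z])
      moreover have "?Y2 \<in> measurable (PiM (marg_index ?S) (\<lambda>_. borel)) (PiM ?J (\<lambda>_. borel))"
        by (rule measurable_restrict) (rule \<psi>(1))
      ultimately have "indep_var (PiM {v} (\<lambda>_. borel)) (?Y1 \<circ> cond_family M V X N {v} (pa D v))
          (PiM ?J (\<lambda>_. borel)) (?Y2 \<circ> marg_family M V X N ?S)"
        unfolding indep_cond_marg_def
        by (rule indep_var_compose)
      then have "indep_var (PiM {v} (\<lambda>_. borel)) (\<lambda>\<omega>. \<lambda>j\<in>{v}. U j \<omega>)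
          (PiM ?J (\<lambda>_. borel)) (\<lambda>\<omega>. \<lambda>j\<in>?J. U j \<omega>)"
      proof (rule indep_var_cong_AE)
        show "(\<lambda>\<omega>. \<lambda>j\<in>{v}. U j \<omega>) \<in> measurable M (PiM {v} (\<lambda>_. borel))"
          by (rule measurable_restrict) (use U_measurable v in auto)
        show "(\<lambda>\<omega>. \<lambda>j\<in>?J. U j \<omega>) \<in> measurable M (PiM ?J (\<lambda>_. borel))"
          by (rule measurable_restrict) (use U_measurable SV in auto)
        show "AE \<omega> in M. (?Y1 \<circ> cond_family M V X N {v} (pa D v)) \<omega> = (\<lambda>j\<in>{v}. U j \<omega>)"
          using Uv by eventually_elim (auto simp: fun_eq_iff)
        have "AE \<omega> in M. \<forall>j\<in>?J. U j \<omega> = \<psi> j (marg_family M V X N ?S \<omega>)"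
          using sink.hyps(1) \<psi>(2) by (subst AE_ball_countable) (auto intro: countable_finite)
        then show "AE \<omega> in M. (?Y2 \<circ> marg_family M V X N ?S) \<omega> = (\<lambda>j\<in>?J. U j \<omega>)"
          by eventually_elim (auto simp: fun_eq_iff)
      qed
      then have "indep_vars (\<lambda>_. borel) U (insert v ?J)"
        using sink SV U_measurable[OF v] by (intro indep_vars_insertI) auto
      then show "indep_vars (\<lambda>_. borel) U S" using sink.hyps by (simp add: insert_absorb)
    qed
  qed
  then show ?thesis by simp
qed

lemma directed_iff_indep:
  "strong_directed_hyper_markov M V D X N \<longleftrightarrow> indep_vars (\<lambda>_. borel) U V"
  using directed_if_indep indep_if_directed by blast

end

section \<open>Strong hyper Markov laws\<close>

lemma coordinate_borel_measurable:
  assumes "X \<in> measurable M (PiM V (\<lambda>_. borel))" "i \<in> V"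
  shows "(\<lambda>\<omega>. X \<omega> i :: real) \<in> borel_measurable M"
  by (rule measurable_compose[OF assms(1) measurable_component_singleton[OF assms(2)]])

lemma Delta_on_measurable:
  assumes "irrefl E" "A \<subseteq> V" "\<And>i. i \<in> V \<Longrightarrow> (\<lambda>\<omega>. X \<omega> i) \<in> borel_measurable M"
  shows "(\<lambda>\<omega>. Delta_on E A (X \<omega>)) \<in> borel_measurable M"
  unfolding Delta_on_eq[OF assms(1)]
  by (intro borel_measurable_sum borel_measurable_times borel_measurable_prod borel_measurable_const assms(3))
    (use assms(2) in \<open>auto simp: stable_sets_def\<close>)

lemma delta_on_measurable:
  assumes "irrefl E" "A \<subseteq> V" "finite V" "\<And>i. i \<in> V \<Longrightarrow> (\<lambda>\<omega>. X \<omega> i) \<in> borel_measurable M"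
  shows "(\<lambda>\<omega>. delta_on E A (X \<omega>)) \<in> borel_measurable M"
  unfolding delta_on_eq_Delta_on[OF assms(1) finite_subset[OF assms(2,3)]]
  by (rule Delta_on_measurable[OF assms(1,2)]) (intro borel_measurable_uminus assms(4))

lemma nb_term_measurable: "nb_term r k m \<in> borel_measurable borel"
  unfolding nb_term_def[abs_def] by measurable

lemma nb_term_0_0: "u < 1 \<Longrightarrow> nb_term r 0 0 u = (1 - u) powr r"
  by (simp add: nb_term_def)

text \<open>The directed properties are covered by \<open>directed_iff_indep\<close>, one moral DAG at a time; for
  the undirected property the DAG is adapted to the decomposition at hand.\<close>

lemma markov_iff_indep:
  assumes G: "simple_graph V E" "decomposable V E"
    and fact: "\<And>D. moral_dag E D \<Longrightarrow> conditional_factorization M V D X N (U D) R q h"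
  shows "((\<forall>D. moral_dag E D \<longrightarrow> strong_directed_hyper_markov M V D X N) \<longleftrightarrow>
      (\<forall>D. moral_dag E D \<longrightarrow> prob_space.indep_vars M (\<lambda>_. borel) (U D) V)) \<and>
    (strong_hyper_markov M V E X N \<and> (\<forall>D. moral_dag E D \<longrightarrow> strong_directed_hyper_markov M V D X N) \<longleftrightarrow>
      (\<forall>D. moral_dag E D \<longrightarrow> prob_space.indep_vars M (\<lambda>_. borel) (U D) V))"
proof -
  have iff: "strong_directed_hyper_markov M V D X N \<longleftrightarrow> prob_space.indep_vars M (\<lambda>_. borel) (U D) V"
    if "moral_dag E D" for D
    by (rule conditional_factorization.directed_iff_indep[OF fact[OF that]])
  have "strong_hyper_markov M V E X N"
    if indep: "\<forall>D. moral_dag E D \<longrightarrow> prob_space.indep_vars M (\<lambda>_. borel) (U D) V"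
    unfolding strong_hyper_markov_def
  proof (intro allI impI)
    fix A B C assume dec: "decomposition V E A B C"
    obtain D where D: "moral_dag E D" "\<forall>(j, i)\<in>D. i \<in> A \<union> C \<longrightarrow> j \<in> A \<union> C"
      using ex_moral_dag_decomposition[OF G dec] by blast
    have "ancestral D (A \<union> C)" using D(2) by (auto simp: ancestral_def pa_def)
    moreover have "A \<union> C \<union> (B \<union> C) = V" using dec by (auto simp: decomposition_def)
    ultimately show "indep_cond_marg M V X N (B \<union> C) (A \<union> C) (A \<union> C)"
      using conditional_factorization.indep_cond_marg_ancestral_if_indep[OF fact[OF D(1)]] indep D(1)
      by blast
  qed
  then show ?thesis using iff by blast
qed

lemma moral_dag_facts:
  assumes "simple_graph V E" "moral_dag E D"
  shows "finite V" "irrefl E" "D \<subseteq> V \<times> V" "acyclic D" "\<And>i. i \<in> V \<Longrightarrow> de_bar D i \<subseteq> V"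
    "\<And>i. i \<in> V \<Longrightarrow> de D i \<subseteq> V"
proof -
  show "finite V" "irrefl E" and DV: "D \<subseteq> V \<times> V" and "acyclic D"
    using assms moral_dagD(1,2)[OF assms(2)] by (auto simp: simple_graph_def)
  have "ancestral (D\<inverse>) V" using DV by (auto simp: ancestral_def pa_def)
  then show "\<And>i. i \<in> V \<Longrightarrow> de_bar D i \<subseteq> V" by (rule de_bar_subset)
  then show "\<And>i. i \<in> V \<Longrightarrow> de D i \<subseteq> V" by (auto simp: de_bar_def)
qed

text \<open>With no counts at the parents, the count at \<open>i\<close> is zero with probability \<open>(1 - u)^r\<close>,
  where \<open>u\<close> is the coordinate of \<open>i\<close>.\<close>

lemma conditional_factorization_nm:
  fixes E :: "('v \<times> 'v) set"
  assumes G: "simple_graph V E" and D: "moral_dag E D" and M: "prob_space M" and "0 < r"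
    and X: "X \<in> measurable M (PiM V (\<lambda>_. borel))" "\<forall>\<omega>\<in>space M. X \<omega> \<in> M_graph V E"
    and N: "has_cond_law M V X N (nm_mass V E r)"
  shows "conditional_factorization M V D X N (\<lambda>i \<omega>. u_map E D (X \<omega>) i)
    {0<..<1} (nb_term r) (\<lambda>t. 1 - t powr (1 / r))"
proof -
  interpret prob_space M by fact
  note facts = moral_dag_facts[OF G D]
  have pos: "0 < Delta_on E A (X \<omega>)" if "\<omega> \<in> space M" "A \<subseteq> V" for \<omega> A
    using X(2) that by (auto simp: M_graph_def)
  show ?thesis
  proof
    show "(\<lambda>\<omega>. u_map E D (X \<omega>) i) \<in> borel_measurable M" if "i \<in> V" for i
      unfolding u_map_def
      by (intro borel_measurable_diff borel_measurable_divide borel_measurable_const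
          Delta_on_measurable[OF facts(2) facts(5)[OF that]] Delta_on_measurable[OF facts(2) facts(6)[OF that]]
          coordinate_borel_measurable[OF X(1)])
    show "u_map E D (X \<omega>) i \<in> {0<..<1}" if "i \<in> V" "\<omega> \<in> space M" for i \<omega>
    proof -
      have "X \<omega> i > 0" using X(2) that by (auto simp: M_graph_def PiE_iff)
      then show ?thesis
        using u_map_parametrization(1,3)[OF G D pos[OF that(2)] that(1)] by simp
    qed
    show "AE \<omega> in M. cond_marg M V X N V n \<omega> =
        (\<Prod>i\<in>V. nb_term r (n i) (\<Sum>j\<in>pa D i. n j) (u_map E D (X \<omega>) i))"
      if "n \<in> V \<rightarrow>\<^sub>E UNIV" for n
    proof -
      have "AE \<omega> in M. cond_marg M V X N V n \<omega> = nm_mass V E r (X \<omega>) n"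
        using N that by (auto simp: has_cond_law_def)
      then show ?thesis using AE_space
        by eventually_elim (simp add: nm_mass_eq_prod[OF G D pos])
    qed
    show "(\<lambda>k. nb_term r k (\<Sum>j\<in>pa D v. n j) (u v)) sums 1"
      if "v \<in> V" "\<And>i. i \<in> V \<Longrightarrow> u i \<in> {0<..<1}" for v u n
      using that(2)[OF that(1)] by (intro nb_term_sums) auto
    show "1 - nb_term r 0 0 x powr (1 / r) = x" if "x \<in> {0<..<1}" for x
      using that \<open>0 < r\<close> by (simp add: nb_term_0_0 powr_powr)
    show "0 < nb_term r 0 0 x" if "x \<in> {0<..<1}" for x
      using that by (simp add: nb_term_0_0)
    show "(\<lambda>t. 1 - t powr (1 / r)) \<in> borel_measurable borel" by measurable
  qed (use facts X N in \<open>auto simp: has_cond_law_def nb_term_measurable\<close>)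
qed

text \<open>With no counts at the parents, the count at \<open>i\<close> is zero with probability \<open>(1 + w)^(-r)\<close>,
  where \<open>w\<close> is the coordinate of \<open>i\<close>. If the parents carry more than \<open>r\<close>, then the factor of an
  ancestor vanishes; this is the case that the hypothesis on the weights excludes.\<close>

lemma conditional_factorization_mult:
  fixes E :: "('v \<times> 'v) set"
  assumes G: "simple_graph V E" and D: "moral_dag E D" and M: "prob_space M" and "1 \<le> r"
    and Y: "Y \<in> measurable M (PiM V (\<lambda>_. borel))" "\<forall>\<omega>\<in>space M. Y \<omega> \<in> V \<rightarrow>\<^sub>E {0<..}"
    and N: "has_cond_law M V Y N (mult_mass V E r)"
  shows "conditional_factorization M V D Y N (\<lambda>i \<omega>. w_map E D (Y \<omega>) i)
    {-1<..} (\<lambda>k m t. nb_term (- real r) k m (- t)) (\<lambda>t. t powr (- 1 / real r) - 1)"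
proof -
  interpret prob_space M by fact
  note facts = moral_dag_facts[OF G D]
  have Ypos: "0 < Y \<omega> i" if "\<omega> \<in> space M" "i \<in> V" for \<omega> i
    using Y(2) that by (auto simp: PiE_iff)
  have pos: "0 < delta_on E A (Y \<omega>)" if "\<omega> \<in> space M" "A \<subseteq> V" for \<omega> A
    by (rule delta_on_pos[OF facts(2) finite_subset[OF that(2) facts(1)]]) (use Ypos that in auto)
  show ?thesis
  proof
    show "(\<lambda>\<omega>. w_map E D (Y \<omega>) i) \<in> borel_measurable M" if "i \<in> V" for i
      unfolding w_map_def
      by (intro borel_measurable_diff borel_measurable_divide borel_measurable_const
          delta_on_measurable[OF facts(2) facts(5)[OF that] facts(1)]
          delta_on_measurable[OF facts(2) facts(6)[OF that] facts(1)] coordinate_borel_measurable[OF Y(1)])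
    show "w_map E D (Y \<omega>) i \<in> {-1<..}" if "i \<in> V" "\<omega> \<in> space M" for i \<omega>
      using pos[OF that(2)] facts(5,6)[OF that(1)] by (simp add: w_map_def)
    show "AE \<omega> in M. cond_marg M V Y N V n \<omega> =
        (\<Prod>i\<in>V. nb_term (- real r) (n i) (\<Sum>j\<in>pa D i. n j) (- w_map E D (Y \<omega>) i))"
      if "n \<in> V \<rightarrow>\<^sub>E UNIV" for n
    proof -
      have "AE \<omega> in M. cond_marg M V Y N V n \<omega> = mult_mass V E r (Y \<omega>) n"
        using N that by (auto simp: has_cond_law_def)
      then show ?thesis using AE_space
      proof eventually_elim
        fix \<omega> assume "cond_marg M V Y N V n \<omega> = mult_mass V E r (Y \<omega>) n" "\<omega> \<in> space M"
        then show "cond_marg M V Y N V n \<omega> =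
          (\<Prod>i\<in>V. nb_term (- real r) (n i) (\<Sum>j\<in>pa D i. n j) (- w_map E D (Y \<omega>) i))"
          using mult_mass_eq_prod[OF G D Ypos that] by simp
      qed
    qed
    show "(\<lambda>k. nb_term (- real r) k (\<Sum>j\<in>pa D v. n j) (- u v)) sums 1"
      if v: "v \<in> V" and u: "\<And>i. i \<in> V \<Longrightarrow> u i \<in> {-1<..}"
        and nz: "\<And>j. (j, v) \<in> D\<^sup>+ \<Longrightarrow> nb_term (- real r) (n j) (\<Sum>i\<in>pa D j. n i) (- u j) \<noteq> 0"
      for v u n
    proof (rule nb_term_nat_sums)
      show "(\<Sum>j\<in>pa D v. n j) \<le> r"
      proof (rule ccontr)
        assume "\<not> ?thesis"
        then obtain k where "(k, v) \<in> D\<^sup>+" "(\<Sum>j\<in>pa D k. n j) \<le> r" "r < (\<Sum>j\<in>pa D k. n j) + n k"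
          using overloaded_parents[OF facts(1,3) D] by (metis not_le)
        then show False using nz nb_term_overloaded by blast
      qed
      show "- u v < 1" using u[OF v] by simp
    qed
    show "nb_term (- real r) 0 0 (- x) powr (- 1 / real r) - 1 = x" if "x \<in> {-1<..}" for x
      using that \<open>1 \<le> r\<close> by (simp add: nb_term_0_0 powr_powr)
    show "0 < nb_term (- real r) 0 0 (- x)" if "x \<in> {-1<..}" for x
      using that by (simp add: nb_term_0_0)
    show "(\<lambda>t. t powr (- 1 / real r) - 1) \<in> borel_measurable borel" by measurable
    show "(\<lambda>t. nb_term (- real r) k m (- t)) \<in> borel_measurable borel" for k m
      by (rule measurable_compose[OF _ nb_term_measurable]) measurable
  qed (use facts Y N in \<open>auto simp: has_cond_law_def\<close>)
qed

theorem theorem7p4: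
  fixes V :: "'v set" and E :: "('v \<times> 'v) set" and M :: "'a measure"
  assumes "simple_graph V E" "connected_graph V E" "decomposable V E"
    and "prob_space M"
  shows
    "(\<forall>(r::real) X N.
        0 < r \<longrightarrow>
        X \<in> measurable M (PiM V (\<lambda>_. borel)) \<longrightarrow>
        (\<forall>\<omega>\<in>space M. X \<omega> \<in> M_graph V E) \<longrightarrow>
        has_cond_law M V X N (nm_mass V E r) \<longrightarrow>
        (let indep_u = (\<forall>D. moral_dag E D \<longrightarrow>
               prob_space.indep_vars M (\<lambda>_. borel) (\<lambda>i \<omega>. u_map E D (X \<omega>) i) V);
             directed = (\<forall>D. moral_dag E D \<longrightarrow> strong_directed_hyper_markov M V D X N)
         in (directed \<longleftrightarrow> indep_u) \<and>
            (strong_hyper_markov M V E X N \<and> directed \<longleftrightarrow> indep_u))) \<and>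
     (\<forall>(r::nat) Y N.
        1 \<le> r \<longrightarrow>
        Y \<in> measurable M (PiM V (\<lambda>_. borel)) \<longrightarrow>
        (\<forall>\<omega>\<in>space M. Y \<omega> \<in> V \<rightarrow>\<^sub>E {0<..}) \<longrightarrow>
        has_cond_law M V Y N (mult_mass V E r) \<longrightarrow>
        (let indep_w = (\<forall>D. moral_dag E D \<longrightarrow>
               prob_space.indep_vars M (\<lambda>_. borel) (\<lambda>i \<omega>. w_map E D (Y \<omega>) i) V);
             directed = (\<forall>D. moral_dag E D \<longrightarrow> strong_directed_hyper_markov M V D Y N)
         in (directed \<longleftrightarrow> indep_w) \<and>
            (strong_hyper_markov M V E Y N \<and> directed \<longleftrightarrow> indep_w)))"
proof (intro conjI allI impI)
  fix r :: real and X :: "'a \<Rightarrow> 'v \<Rightarrow> real" and N :: "'a \<Rightarrow> 'v \<Rightarrow> nat"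
  assume law: "0 < r" "X \<in> measurable M (PiM V (\<lambda>_. borel))" "\<forall>\<omega>\<in>space M. X \<omega> \<in> M_graph V E"
    "has_cond_law M V X N (nm_mass V E r)"
  have "conditional_factorization M V D X N (\<lambda>i \<omega>. u_map E D (X \<omega>) i)
    {0<..<1} (nb_term r) (\<lambda>t. 1 - t powr (1 / r))"
    if "moral_dag E D" for D
    by (rule conditional_factorization_nm[OF assms(1) that assms(4) law])
  from markov_iff_indep[OF assms(1,3) this]
  show "let indep_u = (\<forall>D. moral_dag E D \<longrightarrow>
               prob_space.indep_vars M (\<lambda>_. borel) (\<lambda>i \<omega>. u_map E D (X \<omega>) i) V);
             directed = (\<forall>D. moral_dag E D \<longrightarrow> strong_directed_hyper_markov M V D X N)
         in (directed \<longleftrightarrow> indep_u) \<and>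
            (strong_hyper_markov M V E X N \<and> directed \<longleftrightarrow> indep_u)"
    unfolding Let_def .
next
  fix r :: nat and Y :: "'a \<Rightarrow> 'v \<Rightarrow> real" and N :: "'a \<Rightarrow> 'v \<Rightarrow> nat"
  assume law: "1 \<le> r" "Y \<in> measurable M (PiM V (\<lambda>_. borel))" "\<forall>\<omega>\<in>space M. Y \<omega> \<in> V \<rightarrow>\<^sub>E {0<..}"
    "has_cond_law M V Y N (mult_mass V E r)"
  have "conditional_factorization M V D Y N (\<lambda>i \<omega>. w_map E D (Y \<omega>) i)
    {-1<..} (\<lambda>k m t. nb_term (- real r) k m (- t)) (\<lambda>t. t powr (- 1 / real r) - 1)"
    if "moral_dag E D" for D
    by (rule conditional_factorization_mult[OF assms(1) that assms(4) law])
  from markov_iff_indep[OF assms(1,3) this]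
  show "let indep_w = (\<forall>D. moral_dag E D \<longrightarrow>
               prob_space.indep_vars M (\<lambda>_. borel) (\<lambda>i \<omega>. w_map E D (Y \<omega>) i) V);
             directed = (\<forall>D. moral_dag E D \<longrightarrow> strong_directed_hyper_markov M V D Y N)
         in (directed \<longleftrightarrow> indep_w) \<and>
            (strong_hyper_markov M V E Y N \<and> directed \<longleftrightarrow> indep_w)"
    unfolding Let_def .
qed

end
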